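(* The set of finite-gap compacts $E \in \mathcal{K}_1$ for which there exists a discrete Schrödinger operator $H \in \mathcal{J}(E)$ is meager in $\mathcal{K}_1$ and has measure zero.
   Context: **Operators.** A Jacobi operator is a bounded self-adjoint operator $J=J(a,b)$ on $\ell^2(\mathbb{Z})$, $(Ju)_n = a_n u_{n-1} + b_n u_n + a_{n+1}u_{n+1}$, where $a,b\in\ell^\infty(\mathbb{Z})$ are real and the entries of $a$ are positive and bounded uniformly away from $0$. A discrete Schrödinger operator (DSO) is a Jacobi operator $H=H_V$ with $a_n=1$ for all $n$, i.e. $(Hu)_n = u_{n+1}+u_{n-1}+V(n)u_n$ with $V:\mathbb{Z}\to\mathbb{R}$ bounded. **Reflectionless operators and the isospectral torus.** Let $r(n,z,J)=\langle \delta_n,(J-z)^{-1}\delta_n\rangle$ and $r(n,x+i0,J)=\lim_{\varepsilon\downarrow 0} r(n,x+i\varepsilon,J)$, which exists for Lebesgue-a.e. $x\in\mathbb{R}$. For a compact $E\subset\mathbb{R}$ of positive Lebesgue measure, $J$ is reflectionless on $E$ if for every $n\in\mathbb{Z}$, $\operatorname{Re}\, r(n,x+i0,J)=0$ for Lebesgue-a.e. $x\in E$. The isospectral torus is $\mathcal{J}(E)=\{J \text{ Jacobi operator}: \sigma(J)\subset E \text{ and } J \text{ is reflectionless on } E\}$. **Capacity.** For compact $E$, $\operatorname{cap}(E)=\sup_{\mu}\exp\left(-\int_E\int_E\log|x-y|^{-1}\,d\mu(x)\,d\mu(y)\right)$, the supremum being over Borel probability measures $\mu$ supported on $E$. **Spaces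 of finite-gap compacts.** An $n$-gap compact is a union of $n+1$ pairwise disjoint nondegenerate compact intervals in $\mathbb{R}$. Let $\mathcal{K}^n$ be the set of $n$-gap compacts, $\mathcal{K}^n_\alpha=\{E\in\mathcal{K}^n:\operatorname{cap}(E)=\alpha\}$ for $\alpha>0$, and $\mathcal{K}_\alpha=\bigcup_{n=1}^\infty\mathcal{K}^n_\alpha$ (so $\mathcal K_1$ is the case $\alpha = 1$). **Topology and measure.** Listing the $2(n+1)$ interval endpoints in increasing order identifies $\mathcal{K}^n$ with the open set $T^{2(n+1)}=\{x\in\mathbb{R}^{2(n+1)}:x_1<\cdots<x_{2(n+1)}\}$, from which it gets its topology and Lebesgue measure. $\mathcal{K}^n_\alpha$ carries the subspace topology and the pushforward of Lebesgue measure under the projection $\pi_\alpha:\mathcal{K}^n\to\mathcal{K}^n_\alpha$, $\pi_\alpha(E)=\frac{\alpha}{\operatorname{cap}(E)}E$; thus $A\subset\mathcal{K}^n_\alpha$ has measure zero iff $\pi_\alpha^{-1}(A)$ is Lebesgue-null in $T^{2(n+1)}$. $\mathcal{K}_1$ is given the topology and measure of the disjoint union of the $\mathcal{K}^n_1$, $n\ge 1$; in particular a subset of $\mathcal{K}_1$ is meager (a countable union of nowhere dense sets), respectively of measure zero, iff its intersection with each $\mathcal{K}^n_1$ is. *)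

theory Defs
  imports "HOL-Probability.Probability"
begin

section \<open>Operators on \<open>\<ell>\<^sup>2(\<int>)\<close>\<close>

definition l2 :: "(int \<Rightarrow> complex) set" where
  "l2 = {u. (\<lambda>k. (cmod (u k))\<^sup>2) summable_on UNIV}"

definition l2_norm :: "(int \<Rightarrow> complex) \<Rightarrow> real" where
  "l2_norm u = sqrt (\<Sum>\<^sub>\<infinity>k. (cmod (u k))\<^sup>2)"

definition l2_inner :: "(int \<Rightarrow> complex) \<Rightarrow> (int \<Rightarrow> complex) \<Rightarrow> complex" where
  "l2_inner u v = (\<Sum>\<^sub>\<infinity>k. cnj (u k) * v k)"

definition delta :: "int \<Rightarrow> int \<Rightarrow> complex" where
  "delta n = (\<lambda>k. if k = n then 1 else 0)"

text \<open>An operator is represented by a map on all complex sequences, of which only the restriction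
  to \<^term>\<open>l2\<close> matters.\<close>

type_synonym l2_op = "(int \<Rightarrow> complex) \<Rightarrow> (int \<Rightarrow> complex)"

definition op_minus_scalar :: "l2_op \<Rightarrow> complex \<Rightarrow> l2_op" where
  "op_minus_scalar T z = (\<lambda>u k. T u k - z * u k)"

definition resolvent_set :: "l2_op \<Rightarrow> complex set" where
  "resolvent_set T = {z. bij_betw (op_minus_scalar T z) l2 l2 \<and>
     (\<exists>C. \<forall>u\<in>l2. l2_norm u \<le> C * l2_norm (op_minus_scalar T z u))}"

definition spectrum :: "l2_op \<Rightarrow> complex set" where
  "spectrum T = - resolvent_set T"

definition resolvent :: "l2_op \<Rightarrow> complex \<Rightarrow> l2_op" where
  "resolvent T z = inv_into l2 (op_minus_scalar T z)"

definition green :: "int \<Rightarrow> complex \<Rightarrow> l2_op \<Rightarrow> complex" where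
  "green n z T = l2_inner (delta n) (resolvent T z (delta n))"

definition jacobi_op :: "(int \<Rightarrow> real) \<Rightarrow> (int \<Rightarrow> real) \<Rightarrow> l2_op" where
  "jacobi_op a b = (\<lambda>u n. of_real (a n) * u (n - 1) + of_real (b n) * u n
                          + of_real (a (n + 1)) * u (n + 1))"

definition is_jacobi :: "l2_op \<Rightarrow> bool" where
  "is_jacobi J \<longleftrightarrow> (\<exists>a b. bounded (range a) \<and> bounded (range b) \<and>
     (\<exists>c>0. \<forall>n. c \<le> a n) \<and> J = jacobi_op a b)"

definition is_dso :: "l2_op \<Rightarrow> bool" where
  "is_dso H \<longleftrightarrow> (\<exists>V. bounded (range V) \<and> H = jacobi_op (\<lambda>_. 1) V)"

text \<open>The boundary value \<open>r(n, x + i0, J)\<close> exists for almost every \<open>x\<close>; the condition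
  \<open>Re r(n, x + i0, J) = 0\<close> is read as including that existence.\<close>

definition reflectionless :: "l2_op \<Rightarrow> real set \<Rightarrow> bool" where
  "reflectionless J E \<longleftrightarrow> (\<forall>n. AE x in lebesgue. x \<in> E \<longrightarrow>
     (\<exists>r. ((\<lambda>\<epsilon>. green n (Complex x \<epsilon>) J) \<longlongrightarrow> r) (at_right 0) \<and> Re r = 0))"

definition isospectral_torus :: "real set \<Rightarrow> l2_op set" where
  "isospectral_torus E =
     {J. is_jacobi J \<and> spectrum J \<subseteq> of_real ` E \<and> reflectionless J E}"

section \<open>Logarithmic capacity\<close>

text \<open>\<open>log |x - y|\<^sup>-\<^sup>1\<close> is \<open>+\<infinity>\<close> on the diagonal, whereas \<open>ln 0 = 0\<close> in the library.\<close>

definition log_kernel :: "real \<Rightarrow> real \<Rightarrow> ereal" where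
  "log_kernel x y = (if x = y then \<infinity> else ereal (ln (1 / \<bar>x - y\<bar>)))"

text \<open>The energy is the integral of the positive part minus that of the negative part
  (\<^const>\<open>e2ennreal\<close> truncates negative values to \<open>0\<close>). The latter is finite for compact
  \<open>E\<close> and finite \<open>\<mu>\<close>, so the energy is in \<open>(-\<infinity>, \<infinity>]\<close>. The Bochner integral
  would assign the value \<open>0\<close> to infinite energy.\<close>

definition log_energy :: "real set \<Rightarrow> real measure \<Rightarrow> ereal" where
  "log_energy E \<mu> =
     enn2ereal (\<integral>\<^sup>+x\<in>E. (\<integral>\<^sup>+y\<in>E. e2ennreal (log_kernel x y) \<partial>\<mu>) \<partial>\<mu>)
     - enn2ereal (\<integral>\<^sup>+x\<in>E. (\<integral>\<^sup>+y\<in>E. e2ennreal (- log_kernel x y) \<partial>\<mu>) \<partial>\<mu>)"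

definition exp_minus :: "ereal \<Rightarrow> real" where
  "exp_minus t = (if t = \<infinity> then 0 else exp (- real_of_ereal t))"

definition capacity :: "real set \<Rightarrow> real" where
  "capacity E = Sup {exp_minus (log_energy E \<mu>) | \<mu>.
     prob_space \<mu> \<and> sets \<mu> = sets borel \<and> emeasure \<mu> (- E) = 0}"

section \<open>Spaces of finite-gap compacts\<close>

definition gap_compacts :: "nat \<Rightarrow> real set set" where
  "gap_compacts n = {E. \<exists>\<I>. finite \<I> \<and> card \<I> = n + 1 \<and> disjoint \<I> \<and>
     (\<forall>I\<in>\<I>. \<exists>c d. c < d \<and> I = {c..d}) \<and> E = \<Union>\<I>}"

definition gap_compacts_cap :: "nat \<Rightarrow> real \<Rightarrow> real set set" where
  "gap_compacts_cap n \<alpha> = {E \<in> gap_compacts n. capacity E = \<alpha>}"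

definition finite_gap_compacts :: "real \<Rightarrow> real set set" where
  "finite_gap_compacts \<alpha> = (\<Union>n\<in>{1..}. gap_compacts_cap n \<alpha>)"

text \<open>The interval endpoints of \<open>E\<close> are its boundary points. Vectors in \<open>\<real>\<^sup>m\<close> are extensional
  functions on \<open>{..<m}\<close>.\<close>

definition endpoints :: "nat \<Rightarrow> real set \<Rightarrow> nat \<Rightarrow> real" where
  "endpoints n E = (\<lambda>i\<in>{..<2 * (n + 1)}. sorted_list_of_set (frontier E) ! i)"

definition gap_topology :: "nat \<Rightarrow> real set topology" where
  "gap_topology n = pullback_topology (gap_compacts n) (endpoints n)
     (powertop_real {..<2 * (n + 1)})"

definition gap_topology_cap :: "nat \<Rightarrow> real \<Rightarrow> real set topology" where
  "gap_topology_cap n \<alpha> = subtopology (gap_topology n) (gap_compacts_cap n \<alpha>)"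

text \<open>The disjoint union topology; the sets \<^term>\<open>gap_compacts_cap n \<alpha>\<close> are pairwise disjoint.\<close>

definition finite_gap_topology :: "real \<Rightarrow> real set topology" where
  "finite_gap_topology \<alpha> = topology (\<lambda>U. U \<subseteq> finite_gap_compacts \<alpha> \<and>
     (\<forall>n\<ge>1. openin (gap_topology_cap n \<alpha>) (U \<inter> gap_compacts_cap n \<alpha>)))"

lemma topspace_gap_topology: "topspace (gap_topology n) = gap_compacts n"
  by (auto simp: gap_topology_def topspace_pullback_topology endpoints_def)

lemma topspace_gap_topology_cap: "topspace (gap_topology_cap n \<alpha>) = gap_compacts_cap n \<alpha>"
  by (auto simp: gap_topology_cap_def topspace_gap_topology gap_compacts_cap_def)

lemma openin_finite_gap_topology:
  "openin (finite_gap_topology \<alpha>) U \<longleftrightarrow> U \<subseteq> finite_gap_compacts \<alpha> \<and>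
     (\<forall>n\<ge>1. openin (gap_topology_cap n \<alpha>) (U \<inter> gap_compacts_cap n \<alpha>))"
proof -
  let ?G = "\<lambda>n. gap_compacts_cap n \<alpha>"
  have "istopology (\<lambda>U. U \<subseteq> finite_gap_compacts \<alpha> \<and>
          (\<forall>n\<ge>1. openin (gap_topology_cap n \<alpha>) (U \<inter> ?G n)))"
    unfolding istopology_def
  proof (intro conjI allI impI)
    fix S T n assume
      S: "S \<subseteq> finite_gap_compacts \<alpha> \<and> (\<forall>n\<ge>1. openin (gap_topology_cap n \<alpha>) (S \<inter> ?G n))" and
      T: "T \<subseteq> finite_gap_compacts \<alpha> \<and> (\<forall>n\<ge>1. openin (gap_topology_cap n \<alpha>) (T \<inter> ?G n))"
    show "S \<inter> T \<subseteq> finite_gap_compacts \<alpha>" using S by blast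
    assume "(1::nat) \<le> n"
    then have "openin (gap_topology_cap n \<alpha>) ((S \<inter> ?G n) \<inter> (T \<inter> ?G n))"
      using S T by blast
    then show "openin (gap_topology_cap n \<alpha>) (S \<inter> T \<inter> ?G n)"
      by (simp add: Int_ac)
  next
    fix \<K> n assume
      K: "\<forall>K\<in>\<K>. K \<subseteq> finite_gap_compacts \<alpha> \<and> (\<forall>n\<ge>1. openin (gap_topology_cap n \<alpha>) (K \<inter> ?G n))"
    show "\<Union>\<K> \<subseteq> finite_gap_compacts \<alpha>" using K by blast
    assume "(1::nat) \<le> n"
    then have "openin (gap_topology_cap n \<alpha>) (\<Union>K\<in>\<K>. K \<inter> ?G n)"
      using K by blast
    then show "openin (gap_topology_cap n \<alpha>) (\<Union>\<K> \<inter> ?G n)"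
      by (simp only: Int_Union2)
  qed
  then show ?thesis
    by (simp add: finite_gap_topology_def topology_inverse')
qed

lemma topspace_finite_gap_topology:
  "topspace (finite_gap_topology \<alpha>) = finite_gap_compacts \<alpha>"
proof -
  have "finite_gap_compacts \<alpha> \<inter> gap_compacts_cap n \<alpha> = gap_compacts_cap n \<alpha>" if "1 \<le> n" for n
    using that by (auto simp: finite_gap_compacts_def)
  moreover have "openin (gap_topology_cap n \<alpha>) (gap_compacts_cap n \<alpha>)" for n
    using openin_topspace[of "gap_topology_cap n \<alpha>"] by (simp add: topspace_gap_topology_cap)
  ultimately have "openin (finite_gap_topology \<alpha>) (finite_gap_compacts \<alpha>)"
    by (simp add: openin_finite_gap_topology)
  then have "finite_gap_compacts \<alpha> \<subseteq> topspace (finite_gap_topology \<alpha>)"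
    by (rule openin_subset)
  moreover have "topspace (finite_gap_topology \<alpha>) \<subseteq> finite_gap_compacts \<alpha>"
    using openin_topspace[of "finite_gap_topology \<alpha>"]
    unfolding openin_finite_gap_topology[of \<alpha> "topspace (finite_gap_topology \<alpha>)"] by (rule conjunct1)
  ultimately show ?thesis by (rule subset_antisym[rotated])
qed

definition nowhere_dense_in :: "'a topology \<Rightarrow> 'a set \<Rightarrow> bool" where
  "nowhere_dense_in X S \<longleftrightarrow>
     S \<subseteq> topspace X \<and> X interior_of (X closure_of S) = {}"

definition meager_in :: "'a topology \<Rightarrow> 'a set \<Rightarrow> bool" where
  "meager_in X S \<longleftrightarrow>
     (\<exists>\<N>. countable \<N> \<and> (\<forall>N\<in>\<N>. nowhere_dense_in X N) \<and> S = \<Union>\<N>)"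

definition normalize_cap :: "real \<Rightarrow> real set \<Rightarrow> real set" where
  "normalize_cap \<alpha> E = (\<lambda>x. \<alpha> / capacity E * x) ` E"

definition gap_null :: "nat \<Rightarrow> real set set \<Rightarrow> bool" where
  "gap_null n A \<longleftrightarrow> A \<subseteq> gap_compacts n \<and>
     endpoints n ` A \<in> null_sets (completion (\<Pi>\<^sub>M i\<in>{..<2 * (n + 1)}. lborel))"

text \<open>Null sets of the pushforward of Lebesgue measure under \<^term>\<open>normalize_cap \<alpha>\<close>.\<close>

definition gap_cap_null :: "nat \<Rightarrow> real \<Rightarrow> real set set \<Rightarrow> bool" where
  "gap_cap_null n \<alpha> A \<longleftrightarrow> A \<subseteq> gap_compacts_cap n \<alpha> \<and>
     gap_null n {E \<in> gap_compacts n. normalize_cap \<alpha> E \<in> A}"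

definition finite_gap_null :: "real \<Rightarrow> real set set \<Rightarrow> bool" where
  "finite_gap_null \<alpha> A \<longleftrightarrow> A \<subseteq> finite_gap_compacts \<alpha> \<and>
     (\<forall>n\<ge>1. gap_cap_null n \<alpha> (A \<inter> gap_compacts_cap n \<alpha>))"

end

theory Submission
  imports Defs "HOL-Complex_Analysis.Complex_Analysis"
begin

text \<open>The diagonal Green functions of a discrete Schroedinger operator in the isospectral torus of \<open>E\<close> are \<open>\<plusminus>P\<^sub>n(z) / \<surd>(\<Prod>k. z - e\<^sub>k)\<close>
  with a polynomial \<open>P\<^sub>n\<close> of degree \<open>g\<close>, where \<open>e\<close> lists the \<open>2g + 2\<close> edges of \<open>E\<close>: the difference of the
  logarithms of both sides has a bounded imaginary part whose boundary values vanish almost everywhere. Expanding at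
  infinity, the convolution of the moments \<open>(H\<^sup>j)\<^sub>n\<^sub>n\<close> with the coefficients \<open>c\<close> of \<open>\<surd>(\<Prod>k. 1 - e\<^sub>k X)\<close> vanishes in
  all degrees \<open>j > g\<close>. Because the off-diagonal entries are \<open>1\<close>, the moments are \<open>V\<^sub>n\<^sup>j\<close> plus terms of lower degree, so
  these relations make so many of the \<open>V\<^sub>n\<close> integral over the remaining quantities that, even after adjoining a
  dilation factor, at most \<open>2g + 1\<close> algebraically independent quantities are left. The edges are integral over these as well,
  hence the \<open>2g + 2\<close> edges satisfy a fixed nontrivial polynomial equation, together with all their dilates. Its zero
  set is closed, null and nowhere dense, and the capacity, being continuous and homogeneous, allows one to normalize
  inside it.\<close>

section \<open>Counting dimensions in filtered algebras of functions\<close>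

text \<open>The capacity is not a polynomial in the edges, so a relation on the normalized slice
  alone would not directly control its preimage under normalization. The relation is therefore
  demanded for all dilates, and the dilation factor is charged as one more independent quantity,
  which leaves room for \<open>2g\<close> others. Dependence comes from counting, not from
  elimination: there are \<open>q ^ (2g+2)\<close> products of powers below \<open>q\<close> of the
  edges, against a span whose dimension grows like \<open>q ^ (2g+1)\<close>. Integrality enters
  only as the rewriting of one power of a quantity in lower weight. Parity matters because the
  moment of degree \<open>g + 1\<close> at a site reaches the outermost potentials quadratically for
  odd \<open>g\<close>, but linearly for even \<open>g\<close>; in the even case it determines one
  outer potential from the others instead of bounding its powers. On the analytic side,
  reflectionlessness controls boundary values only almost everywhere and admits the boundary value
  0, near which the argument of the Green function may fail to converge. This forces a maximum
  principle with exceptional null sets and a barrier function.\<close>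

lemma homogeneous_linear_system_nontrivial:
  fixes M :: "'a \<Rightarrow> 'b \<Rightarrow> real"
  assumes "finite B" "finite A" "card B < card A"
  shows "\<exists>a. (\<exists>\<alpha>\<in>A. a \<alpha> \<noteq> 0) \<and> (\<forall>\<beta>\<in>B. (\<Sum>\<alpha>\<in>A. a \<alpha> * M \<alpha> \<beta>) = 0)"
  using assms
proof (induction B arbitrary: A M rule: finite_induct)
  case empty
  then have "A \<noteq> {}" by auto
  then show ?case by (intro exI[of _ "\<lambda>_. 1"]) auto
next
  case (insert b B)
  show ?case
  proof (cases "\<forall>\<alpha>\<in>A. M \<alpha> b = 0")
    case True
    have "card B < card A" using insert by auto
    from insert.IH[OF insert.prems(1) this, of M] True show ?thesis by auto
  next
    case False
    then obtain p where p: "p \<in> A" "M p b \<noteq> 0" by auto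
    define A' where "A' = A - {p}"
    define M' where "M' \<alpha> \<beta> = M \<alpha> \<beta> - M \<alpha> b / M p b * M p \<beta>" for \<alpha> \<beta>
    have "finite A'" "card B < card A'"
      using insert p by (auto simp: A'_def)
    from insert.IH[OF this, of M'] obtain a where
      a: "\<exists>\<alpha>\<in>A'. a \<alpha> \<noteq> 0" "\<forall>\<beta>\<in>B. (\<Sum>\<alpha>\<in>A'. a \<alpha> * M' \<alpha> \<beta>) = 0" by auto
    \<comment> \<open>The value that equation \<open>b\<close> forces on the pivot unknown
      \<open>p\<close>; \<open>M'\<close> is the system that remains after eliminating this
      unknown.\<close>
    define c where "c = - (\<Sum>\<alpha>\<in>A'. a \<alpha> * M \<alpha> b / M p b)"
    define a' where "a' = a(p := c)"
    have split: "(\<Sum>\<alpha>\<in>A. a' \<alpha> * M \<alpha> \<beta>) = c * M p \<beta> + (\<Sum>\<alpha>\<in>A'. a \<alpha> * M \<alpha> \<beta>)" for \<beta>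
    proof -
      have "(\<Sum>\<alpha>\<in>A'. a' \<alpha> * M \<alpha> \<beta>) = (\<Sum>\<alpha>\<in>A'. a \<alpha> * M \<alpha> \<beta>)"
        by (intro sum.cong) (auto simp: a'_def A'_def)
      then show ?thesis
        using sum.remove[OF insert.prems(1) p(1), of "\<lambda>\<alpha>. a' \<alpha> * M \<alpha> \<beta>"]
        by (simp add: A'_def a'_def)
    qed
    have "(\<Sum>\<alpha>\<in>A. a' \<alpha> * M \<alpha> \<beta>) = (\<Sum>\<alpha>\<in>A'. a \<alpha> * M' \<alpha> \<beta>)" for \<beta>
    proof -
      have "c * M p \<beta> = - (\<Sum>\<alpha>\<in>A'. a \<alpha> * (M \<alpha> b / M p b * M p \<beta>))"
        unfolding c_def by (simp add: sum_distrib_right mult.assoc)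
      then show ?thesis
        unfolding split M'_def by (simp add: right_diff_distrib sum_subtractf)
    qed
    moreover have "(\<Sum>\<alpha>\<in>A'. a \<alpha> * M' \<alpha> b) = 0"
      using p by (simp add: M'_def)
    ultimately have "\<forall>\<beta>\<in>insert b B. (\<Sum>\<alpha>\<in>A. a' \<alpha> * M \<alpha> \<beta>) = 0"
      using a(2) by auto
    moreover have "\<exists>\<alpha>\<in>A. a' \<alpha> \<noteq> 0"
      using a(1) by (auto simp: a'_def A'_def)
    ultimately show ?thesis by blast
  qed
qed

text \<open>\<open>filt X I y \<rho> d f\<close>: on \<open>X\<close>, \<open>f\<close> agrees with a polynomial in the functions \<open>y\<^sub>i\<close>, \<open>i \<in> I\<close>, of degree at
  most \<open>d\<close>, where \<open>y\<^sub>i\<close> has weight \<open>\<rho>\<^sub>i\<close>. Relations among the \<open>y\<^sub>i\<close> that hold on \<open>X\<close> are built in by the last rule.\<close>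

inductive filt :: "'a set \<Rightarrow> 'i set \<Rightarrow> ('i \<Rightarrow> 'a \<Rightarrow> real) \<Rightarrow> ('i \<Rightarrow> nat) \<Rightarrow> nat \<Rightarrow> ('a \<Rightarrow> real) \<Rightarrow> bool"
  for X I y \<rho> where
  filt_const: "filt X I y \<rho> d (\<lambda>_. c)"
| filt_gen: "i \<in> I \<Longrightarrow> \<rho> i \<le> d \<Longrightarrow> filt X I y \<rho> d (y i)"
| filt_add: "filt X I y \<rho> d f \<Longrightarrow> filt X I y \<rho> d g \<Longrightarrow> filt X I y \<rho> d (\<lambda>x. f x + g x)"
| filt_mult: "filt X I y \<rho> a f \<Longrightarrow> filt X I y \<rho> b g \<Longrightarrow> a + b \<le> d \<Longrightarrow> filt X I y \<rho> d (\<lambda>x. f x * g x)"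
| filt_cong: "filt X I y \<rho> d f \<Longrightarrow> (\<And>x. x \<in> X \<Longrightarrow> f x = g x) \<Longrightarrow> filt X I y \<rho> d g"

lemma filt_mono: "filt X I y \<rho> d f \<Longrightarrow> d \<le> e \<Longrightarrow> filt X I y \<rho> e f"
proof (induction arbitrary: e rule: filt.induct)
  case (filt_mult a f b g d)
  then show ?case using filt.filt_mult[of X I y \<rho> a f b g e] by auto
qed (blast intro: filt.intros le_trans)+

lemma filt_cmult: "filt X I y \<rho> d f \<Longrightarrow> filt X I y \<rho> d (\<lambda>x. c * f x)"
  using filt_mult[OF filt_const[of X I y \<rho> 0 c], of d f d] by simp

lemma filt_minus: "filt X I y \<rho> d f \<Longrightarrow> filt X I y \<rho> d (\<lambda>x. - f x)"
  using filt_cmult[of X I y \<rho> d f "-1"] by simp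

lemma filt_diff: "filt X I y \<rho> d f \<Longrightarrow> filt X I y \<rho> d g \<Longrightarrow> filt X I y \<rho> d (\<lambda>x. f x - g x)"
  using filt_add[OF _ filt_minus, of X I y \<rho> d f g] by simp

lemma filt_sum:
  assumes "\<And>k. k \<in> K \<Longrightarrow> filt X I y \<rho> d (f k)"
  shows "filt X I y \<rho> d (\<lambda>x. \<Sum>k\<in>K. f k x)"
proof (cases "finite K")
  case True
  then show ?thesis using assms
    by (induction K rule: finite_induct) (auto intro: filt_const filt_add)
qed (auto intro: filt_const)

lemma filt_power:
  assumes "filt X I y \<rho> a f" "n * a \<le> d"
  shows "filt X I y \<rho> d (\<lambda>x. f x ^ n)"
proof -
  have "filt X I y \<rho> (n * a) (\<lambda>x. f x ^ n)"
    by (induction n) (auto intro: filt_const filt_mult[OF assms(1)])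
  then show ?thesis by (rule filt_mono) fact
qed

lemma filt_prod:
  assumes "finite K" "\<And>k. k \<in> K \<Longrightarrow> filt X I y \<rho> (d k) (f k)" "(\<Sum>k\<in>K. d k) \<le> e"
  shows "filt X I y \<rho> e (\<lambda>x. \<Prod>k\<in>K. f k x)"
proof -
  have "filt X I y \<rho> (\<Sum>k\<in>K. d k) (\<lambda>x. \<Prod>k\<in>K. f k x)"
    using assms(1,2)
  proof (induction K rule: finite_induct)
    case (insert k K)
    have "filt X I y \<rho> (d k + sum d K) (\<lambda>x. f k x * (\<Prod>k\<in>K. f k x))"
      by (rule filt_mult[OF _ _ order_refl]) (use insert in auto)
    then show ?case using insert.hyps by simp
  qed (auto intro: filt_const)
  then show ?thesis by (rule filt_mono) fact
qed

text \<open>The powers \<open>y\<^sub>i ^ N\<^sub>i\<close>, \<open>i \<in> R\<close>, can be rewritten in lower weight, so only the functions with index in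
  \<open>I - R\<close> contribute to the growth of the filtration.\<close>

locale filtered_reduction =
  fixes X :: "'a set" and I :: "'i set" and y :: "'i \<Rightarrow> 'a \<Rightarrow> real" and \<rho> :: "'i \<Rightarrow> nat"
    and R :: "'i set" and N :: "'i \<Rightarrow> nat"
  assumes finI: "finite I" and \<rho>_pos: "\<And>i. i \<in> I \<Longrightarrow> 0 < \<rho> i"
    and RI: "R \<subseteq> I" and N_pos: "\<And>i. i \<in> R \<Longrightarrow> 0 < N i"
    and red: "\<And>i. i \<in> R \<Longrightarrow> filt X I y \<rho> (N i * \<rho> i - 1) (\<lambda>x. y i x ^ N i)"
begin

definition monom :: "('i \<Rightarrow> nat) \<Rightarrow> 'a \<Rightarrow> real" where
  "monom \<alpha> x = (\<Prod>i\<in>I. y i x ^ \<alpha> i)"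

definition weight :: "('i \<Rightarrow> nat) \<Rightarrow> nat" where
  "weight \<alpha> = (\<Sum>i\<in>I. \<alpha> i * \<rho> i)"

text \<open>Extensionality pins the exponents off \<open>I\<close>, so that distinct members are
  distinct monomials and the set is finite.\<close>

definition reduced :: "nat \<Rightarrow> ('i \<Rightarrow> nat) set" where
  "reduced d = {\<alpha> \<in> extensional I. weight \<alpha> \<le> d \<and> (\<forall>i\<in>R. \<alpha> i < N i)}"

definition in_span :: "nat \<Rightarrow> ('a \<Rightarrow> real) \<Rightarrow> bool" where
  "in_span d f \<longleftrightarrow> (\<exists>a. \<forall>x\<in>X. f x = (\<Sum>\<alpha>\<in>reduced d. a \<alpha> * monom \<alpha> x))"

lemma reduced_subset:
  "reduced d \<subseteq> PiE I (\<lambda>i. if i \<in> R then {..<N i} else {..d})"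
proof
  fix \<alpha> assume a: "\<alpha> \<in> reduced d"
  have "\<alpha> i \<le> d" if "i \<in> I" for i
  proof -
    have "\<alpha> i \<le> \<alpha> i * \<rho> i" using \<rho>_pos[OF that] by simp
    also have "\<dots> \<le> weight \<alpha>" unfolding weight_def
      by (rule member_le_sum) (use that finI in auto)
    finally show ?thesis using a by (auto simp: reduced_def)
  qed
  then show "\<alpha> \<in> PiE I (\<lambda>i. if i \<in> R then {..<N i} else {..d})"
    using a by (auto simp: reduced_def PiE_def Pi_def)
qed

lemma finite_reduced: "finite (reduced d)"
  by (rule finite_subset[OF reduced_subset]) (auto intro!: finite_PiE finI)

text \<open>Weights are at least 1, so no exponent exceeds \<open>d\<close>; those on
  \<open>R\<close> are bounded independently of \<open>d\<close>. What grows is a power of order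
  \<open>card (I - R)\<close>.\<close>

lemma card_reduced: "card (reduced d) \<le> (\<Prod>i\<in>R. N i) * (d + 1) ^ card (I - R)"
proof -
  have "card (reduced d) \<le> card (PiE I (\<lambda>i. if i \<in> R then {..<N i} else {..d}))"
    by (rule card_mono[OF _ reduced_subset]) (auto intro!: finite_PiE finI)
  also have "\<dots> = (\<Prod>i\<in>I. if i \<in> R then N i else d + 1)"
    by (subst card_PiE[OF finI]) (auto intro!: prod.cong)
  also have "\<dots> = (\<Prod>i\<in>I \<inter> R. N i) * (\<Prod>i\<in>I \<inter> - R. d + 1)"
    using finI by (subst prod.If_cases) auto
  also have "\<dots> = (\<Prod>i\<in>R. N i) * (d + 1) ^ card (I - R)"
    using RI by (simp add: Int_absorb1 Diff_eq)
  finally show ?thesis .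
qed

lemma in_span_add: "in_span d f \<Longrightarrow> in_span d g \<Longrightarrow> in_span d (\<lambda>x. f x + g x)"
proof -
  assume "in_span d f" "in_span d g"
  then obtain a b where "\<forall>x\<in>X. f x = (\<Sum>\<alpha>\<in>reduced d. a \<alpha> * monom \<alpha> x)"
    "\<forall>x\<in>X. g x = (\<Sum>\<alpha>\<in>reduced d. b \<alpha> * monom \<alpha> x)" unfolding in_span_def by blast
  then show ?thesis unfolding in_span_def
    by (intro exI[of _ "\<lambda>\<alpha>. a \<alpha> + b \<alpha>"]) (simp add: sum.distrib algebra_simps)
qed

lemma in_span_cmult: "in_span d f \<Longrightarrow> in_span d (\<lambda>x. c * f x)"
  unfolding in_span_def
  by (elim exE, rule_tac x = "\<lambda>\<alpha>. c * a \<alpha>" in exI) (simp add: sum_distrib_left mult.assoc)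

lemma in_span_sum:
  "(\<And>k. k \<in> K \<Longrightarrow> in_span d (f k)) \<Longrightarrow> in_span d (\<lambda>x. \<Sum>k\<in>K. f k x)"
proof (induction K rule: infinite_finite_induct)
  case (insert k K)
  then show ?case using in_span_add[of d "f k"] by simp
qed (auto simp: in_span_def intro!: exI[of _ "\<lambda>_. 0"])

lemma in_span_cong: "in_span d f \<Longrightarrow> (\<And>x. x \<in> X \<Longrightarrow> f x = g x) \<Longrightarrow> in_span d g"
  unfolding in_span_def by auto

lemma in_span_reduced: "\<alpha> \<in> reduced d \<Longrightarrow> in_span d (monom \<alpha>)"
  unfolding in_span_def
proof (intro exI[of _ "\<lambda>\<beta>. if \<beta> = \<alpha> then 1 else 0"] ballI)
  fix x assume "\<alpha> \<in> reduced d"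
  then show "monom \<alpha> x = (\<Sum>\<beta>\<in>reduced d. (if \<beta> = \<alpha> then 1 else 0) * monom \<beta> x)"
    by (subst sum.remove[of _ \<alpha>]) (auto simp: finite_reduced)
qed

lemma reduced_mono: "d \<le> e \<Longrightarrow> reduced d \<subseteq> reduced e"
  by (auto simp: reduced_def)

lemma in_span_mono: "in_span d f \<Longrightarrow> d \<le> e \<Longrightarrow> in_span e f"
proof -
  assume f: "in_span d f" and de: "d \<le> e"
  then obtain a where a: "\<forall>x\<in>X. f x = (\<Sum>\<alpha>\<in>reduced d. a \<alpha> * monom \<alpha> x)"
    unfolding in_span_def by blast
  have "in_span e (\<lambda>x. \<Sum>\<alpha>\<in>reduced d. a \<alpha> * monom \<alpha> x)"
    using reduced_mono[OF de] by (intro in_span_sum in_span_cmult in_span_reduced) auto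
  then show ?thesis by (rule in_span_cong) (use a in auto)
qed

lemma filt_monom: "filt X I y \<rho> (weight \<alpha>) (monom \<alpha>)"
  unfolding monom_def weight_def
  by (rule filt_prod[OF finI, of _ _ _ _ "\<lambda>i. \<alpha> i * \<rho> i"])
     (auto intro!: filt_power[OF filt_gen])

text \<open>Rewriting \<open>y i x ^ N i\<close> returns an arbitrary filtered function of smaller
  weight, not a monomial. Hence the strong induction on the weight, inside which \<open>mon\<close>
  treats all monomials and a rule induction assembles the function.\<close>

lemma filt_in_span: "filt X I y \<rho> d f \<Longrightarrow> in_span d f"
proof (induction d arbitrary: f rule: less_induct)
  case (less d)
  have mon: "in_span (weight \<gamma>) (monom \<gamma>)" if "weight \<gamma> \<le> d" for \<gamma>
  proof (cases "\<forall>i\<in>R. \<gamma> i < N i")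
    case True
    have "monom \<gamma> = monom (restrict \<gamma> I)" "weight \<gamma> = weight (restrict \<gamma> I)"
      by (auto simp: monom_def weight_def fun_eq_iff intro!: prod.cong sum.cong)
    moreover have "restrict \<gamma> I \<in> reduced (weight \<gamma>)"
      using True calculation(2) RI by (auto simp: reduced_def)
    ultimately show ?thesis using in_span_reduced by metis
  next
    case False
    then obtain i where i: "i \<in> R" "N i \<le> \<gamma> i" by auto
    define \<gamma>' where "\<gamma>' = \<gamma>(i := \<gamma> i - N i)"
    have iI: "i \<in> I" using i RI by auto
    have "weight \<gamma> = \<gamma> i * \<rho> i + (\<Sum>j\<in>I-{i}. \<gamma> j * \<rho> j)"
      unfolding weight_def by (rule sum.remove[OF finI iI])
    moreover have "weight \<gamma>' = (\<gamma> i - N i) * \<rho> i + (\<Sum>j\<in>I-{i}. \<gamma>' j * \<rho> j)"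
      unfolding weight_def by (subst sum.remove[OF finI iI]) (auto simp: \<gamma>'_def)
    moreover have "(\<Sum>j\<in>I-{i}. \<gamma>' j * \<rho> j) = (\<Sum>j\<in>I-{i}. \<gamma> j * \<rho> j)"
      by (rule sum.cong) (auto simp: \<gamma>'_def)
    moreover have "\<gamma> i * \<rho> i = (\<gamma> i - N i) * \<rho> i + N i * \<rho> i"
      using i by (metis le_add_diff_inverse2 distrib_right)
    ultimately have w: "weight \<gamma> = N i * \<rho> i + weight \<gamma>'" by linarith
    have m: "monom \<gamma> x = y i x ^ N i * monom \<gamma>' x" for x
    proof -
      have "monom \<gamma> x = y i x ^ \<gamma> i * (\<Prod>j\<in>I-{i}. y j x ^ \<gamma> j)"
        unfolding monom_def by (rule prod.remove[OF finI iI])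
      moreover have "monom \<gamma>' x = y i x ^ (\<gamma> i - N i) * (\<Prod>j\<in>I-{i}. y j x ^ \<gamma>' j)"
        unfolding monom_def by (subst prod.remove[OF finI iI]) (auto simp: \<gamma>'_def)
      moreover have "(\<Prod>j\<in>I-{i}. y j x ^ \<gamma>' j) = (\<Prod>j\<in>I-{i}. y j x ^ \<gamma> j)"
        by (rule prod.cong) (auto simp: \<gamma>'_def)
      moreover have "y i x ^ \<gamma> i = y i x ^ N i * y i x ^ (\<gamma> i - N i)"
        using i by (metis le_add_diff_inverse power_add)
      ultimately show ?thesis by simp
    qed
    have pos: "0 < N i * \<rho> i" using N_pos[OF i(1)] \<rho>_pos[OF iI] by simp
    have "filt X I y \<rho> (weight \<gamma> - 1) (\<lambda>x. y i x ^ N i * monom \<gamma>' x)"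
      by (rule filt_mult[OF red[OF i(1)] filt_monom]) (use w pos in auto)
    then have "filt X I y \<rho> (weight \<gamma> - 1) (monom \<gamma>)"
      by (rule filt_cong) (simp add: m)
    then have "in_span (weight \<gamma> - 1) (monom \<gamma>)"
      using less.IH[of "weight \<gamma> - 1" "monom \<gamma>"] that w pos by linarith
    then show ?thesis by (rule in_span_mono) simp
  qed
  have "d' \<le> d \<Longrightarrow> in_span d' h" if "filt X I y \<rho> d' h" for d' h
    using that
  proof (induction rule: filt.induct)
    case (filt_const d' c)
    have "in_span (weight (\<lambda>_. 0)) (\<lambda>x. c * monom (\<lambda>_. 0) x)"
      by (rule in_span_cmult[OF mon]) (simp add: weight_def)
    then have "in_span d' (\<lambda>x. c * monom (\<lambda>_. 0) x)"
      by (rule in_span_mono) (simp add: weight_def)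
    then show ?case by (simp add: monom_def)
  next
    case (filt_gen i d')
    have w: "weight (\<lambda>j. if j = i then 1 else 0) = \<rho> i"
      using filt_gen finI by (simp add: weight_def if_distrib[of "\<lambda>a. a * _"] cong: if_cong)
    moreover have "monom (\<lambda>j. if j = i then 1 else 0) = y i"
      using filt_gen finI by (auto simp: monom_def fun_eq_iff if_distrib[of "\<lambda>a. _ ^ a"] cong: if_cong)
    ultimately have "in_span (\<rho> i) (y i)"
      using mon[of "\<lambda>j. if j = i then 1 else 0"] filt_gen by simp
    then show ?case by (rule in_span_mono) fact
  next
    case (filt_mult a f b g d')
    then have fg: "in_span a f" "in_span b g" by simp_all
    from fg(1)[unfolded in_span_def] obtain p where p: "\<forall>x\<in>X. f x = (\<Sum>\<alpha>\<in>reduced a. p \<alpha> * monom \<alpha> x)" ..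
    from fg(2)[unfolded in_span_def] obtain q where
      q: "\<forall>x\<in>X. g x = (\<Sum>\<beta>\<in>reduced b. q \<beta> * monom \<beta> x)" ..
    have mm: "monom \<alpha> x * monom \<beta> x = monom (\<lambda>i. \<alpha> i + \<beta> i) x" for \<alpha> \<beta> x
      by (simp add: monom_def power_add prod.distrib)
    have ww: "weight (\<lambda>i. \<alpha> i + \<beta> i) = weight \<alpha> + weight \<beta>" for \<alpha> \<beta>
      by (simp add: weight_def sum.distrib algebra_simps)
    have "in_span d' (\<lambda>x. \<Sum>\<alpha>\<in>reduced a. \<Sum>\<beta>\<in>reduced b.
            (p \<alpha> * q \<beta>) * monom (\<lambda>i. \<alpha> i + \<beta> i) x)"
    proof (intro in_span_sum in_span_cmult)
      fix \<alpha> \<beta> assume "\<alpha> \<in> reduced a" "\<beta> \<in> reduced b"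
      then have "weight (\<lambda>i. \<alpha> i + \<beta> i) \<le> d'" using filt_mult.hyps
        unfolding ww by (auto simp: reduced_def)
      then show "in_span d' (monom (\<lambda>i. \<alpha> i + \<beta> i))"
        using in_span_mono[OF mon[of "\<lambda>i. \<alpha> i + \<beta> i"]] filt_mult.prems le_trans by blast
    qed
    then show ?case
    proof (rule in_span_cong)
      fix x assume "x \<in> X"
      then have "f x * g x = (\<Sum>\<alpha>\<in>reduced a. p \<alpha> * monom \<alpha> x) * (\<Sum>\<beta>\<in>reduced b. q \<beta> * monom \<beta> x)"
        using p q by simp
      also have "\<dots> = (\<Sum>\<alpha>\<in>reduced a. \<Sum>\<beta>\<in>reduced b.
            (p \<alpha> * q \<beta>) * monom (\<lambda>i. \<alpha> i + \<beta> i) x)"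
        by (simp add: sum_product mm[symmetric] ac_simps)
      finally show "(\<Sum>\<alpha>\<in>reduced a. \<Sum>\<beta>\<in>reduced b.
            (p \<alpha> * q \<beta>) * monom (\<lambda>i. \<alpha> i + \<beta> i) x) = f x * g x" by simp
    qed
  qed (auto intro: in_span_add in_span_cong)
  with less.prems show ?case by blast
qed

text \<open>The \<open>q ^ m\<close> products of powers below \<open>q\<close> lie in a space whose
  dimension is of order \<open>q ^ card (I - R)\<close>. Since the exponent is smaller than
  \<open>m\<close>, a large \<open>q\<close> leaves more products than dimensions.\<close>

theorem algebraically_dependent:
  assumes F: "\<And>k. k < m \<Longrightarrow> filt X I y \<rho> D (F k)" and m: "card (I - R) < m"
  shows "\<exists>q a. (\<exists>\<alpha>\<in>PiE {..<m} (\<lambda>_. {..<q}). a \<alpha> \<noteq> 0) \<and>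
           (\<forall>x\<in>X. (\<Sum>\<alpha>\<in>PiE {..<m} (\<lambda>_. {..<q::nat}). a \<alpha> * (\<Prod>k<m. F k x ^ \<alpha> k)) = 0)"
proof -
  define s where "s = card (I - R)"
  define K where "K = (\<Prod>i\<in>R. N i)"
  \<comment> \<open>Just larger than the constant left over when the dimension bound
    \<open>K * (D * m * q + 1) ^ s\<close> is estimated by a multiple of
    \<open>q ^ s\<close>.\<close>
  define q where "q = K * (D * m + 1) ^ s + 1"
  define A where "A = PiE {..<m} (\<lambda>_. {..<q})"
  define d where "d = D * m * q"
  have finA: "finite A" unfolding A_def by (intro finite_PiE) auto
  have cardA: "card A = q ^ m" unfolding A_def by (subst card_PiE) auto
  have "card (reduced d) \<le> K * (d + 1) ^ s"
    using card_reduced unfolding K_def s_def .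
  also have "\<dots> \<le> K * ((D * m + 1) * q) ^ s"
    unfolding d_def by (intro mult_left_mono power_mono) (auto simp: q_def)
  also have "\<dots> = (K * (D * m + 1) ^ s) * q ^ s" by (simp only: power_mult_distrib mult.assoc)
  also have "\<dots> < q * q ^ s"
    by (rule mult_strict_right_mono) (auto simp: q_def)
  also have "\<dots> = q ^ (s + 1)" by simp
  also have "\<dots> \<le> q ^ m" using m by (intro power_increasing) (auto simp: s_def q_def)
  finally have card: "card (reduced d) < card A" by (simp add: cardA)
  have "in_span d (\<lambda>x. \<Prod>k<m. F k x ^ \<alpha> k)" if "\<alpha> \<in> A" for \<alpha>
  proof (rule filt_in_span, rule filt_prod)
    show "filt X I y \<rho> (q * D) (\<lambda>x. F k x ^ \<alpha> k)" if "k \<in> {..<m}" for k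
    proof (rule filt_power[OF F])
      show "k < m" using that by simp
      have "\<alpha> k < q" using \<open>\<alpha> \<in> A\<close> that by (auto simp: A_def PiE_def Pi_def)
      then show "\<alpha> k * D \<le> q * D" by simp
    qed
  qed (auto simp: d_def)
  then have "\<forall>\<alpha>\<in>A. \<exists>M. \<forall>x\<in>X. (\<Prod>k<m. F k x ^ \<alpha> k) = (\<Sum>\<beta>\<in>reduced d. M \<beta> * monom \<beta> x)"
    unfolding in_span_def ..
  from bchoice[OF this] obtain M where M: "\<forall>\<alpha>\<in>A. \<forall>x\<in>X.
      (\<Prod>k<m. F k x ^ \<alpha> k) = (\<Sum>\<beta>\<in>reduced d. M \<alpha> \<beta> * monom \<beta> x)" ..
  obtain a where a: "\<exists>\<alpha>\<in>A. a \<alpha> \<noteq> 0" "\<forall>\<beta>\<in>reduced d. (\<Sum>\<alpha>\<in>A. a \<alpha> * M \<alpha> \<beta>) = 0"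
    using homogeneous_linear_system_nontrivial[OF finite_reduced finA card, of M] by (elim exE conjE)
  have "(\<Sum>\<alpha>\<in>A. a \<alpha> * (\<Prod>k<m. F k x ^ \<alpha> k)) = 0" if "x \<in> X" for x
  proof -
    have "(\<Sum>\<alpha>\<in>A. a \<alpha> * (\<Prod>k<m. F k x ^ \<alpha> k))
        = (\<Sum>\<alpha>\<in>A. \<Sum>\<beta>\<in>reduced d. a \<alpha> * M \<alpha> \<beta> * monom \<beta> x)"
      by (rule sum.cong) (simp_all add: M that sum_distrib_left mult.assoc)
    also have "\<dots> = (\<Sum>\<beta>\<in>reduced d. (\<Sum>\<alpha>\<in>A. a \<alpha> * M \<alpha> \<beta>) * monom \<beta> x)"
      by (subst sum.swap) (simp add: sum_distrib_right)
    also have "\<dots> = 0" using a(2) by simp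
    finally show ?thesis .
  qed
  then have main: "\<forall>x\<in>X. (\<Sum>\<alpha>\<in>A. a \<alpha> * (\<Prod>k<m. F k x ^ \<alpha> k)) = 0" ..
  show ?thesis
    by (rule exI[of _ q], rule exI[of _ a], fold A_def, rule conjI[OF a(1) main])
qed

end

section \<open>Moments of a Schroedinger operator\<close>

text \<open>The entry \<open>(H\<^sup>j)\<^sub>m\<^sub>n\<close>, as a sum over walks of length \<open>j\<close> from \<open>n\<close> to \<open>m\<close>.\<close>

fun walk :: "(int \<Rightarrow> real) \<Rightarrow> nat \<Rightarrow> int \<Rightarrow> int \<Rightarrow> real" where
  "walk V 0 n m = (if m = n then 1 else 0)"
| "walk V (Suc j) n m = walk V j n (m - 1) + V m * walk V j n m + walk V j n (m + 1)"

lemma walk_eq_0: "int j < \<bar>m - n\<bar> \<Longrightarrow> walk V j n m = 0"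
  by (induction j arbitrary: m) auto

lemma walk_eq_1: "\<bar>m - n\<bar> = int j \<Longrightarrow> walk V j n m = 1"
proof (induction j arbitrary: m)
  case (Suc j)
  have "walk V j n m = 0" using Suc.prems by (intro walk_eq_0) auto
  moreover have "walk V j n (m - 1) + walk V j n (m + 1) = 1"
  proof (cases "m \<ge> n")
    case True
    then show ?thesis using Suc.prems Suc.IH[of "m - 1"] walk_eq_0[of j "m + 1" n V] by auto
  next
    case False
    then show ?thesis using Suc.prems Suc.IH[of "m + 1"] walk_eq_0[of j "m - 1" n V] by auto
  qed
  ultimately show ?case by simp
qed auto

text \<open>The value \<open>V i\<close> enters only through walks that go from \<open>n\<close> to
  \<open>i\<close>, rest there for one step and go on to \<open>m\<close>; such a walk needs
  \<open>|i - n| + 1 + |i - m|\<close> steps.\<close>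

lemma walk_cong:
  assumes "\<And>i. \<bar>i - n\<bar> + \<bar>i - m\<bar> + 1 \<le> int j \<Longrightarrow> V i = V' i"
  shows "walk V j n m = walk V' j n m"
  using assms
proof (induction j arbitrary: m)
  case (Suc j)
  have 1: "walk V j n (m - 1) = walk V' j n (m - 1)"
    by (rule Suc.IH) (rule Suc.prems, auto)
  have 2: "walk V j n (m + 1) = walk V' j n (m + 1)"
    by (rule Suc.IH) (rule Suc.prems, auto)
  have 3: "walk V j n m = walk V' j n m"
    by (rule Suc.IH) (rule Suc.prems, auto)
  have 4: "V m * walk V' j n m = V' m * walk V' j n m"
  proof (cases "\<bar>m - n\<bar> \<le> int j")
    case True
    then show ?thesis using Suc.prems[of m] by auto
  next
    case False
    then show ?thesis using walk_eq_0[of j m n V'] by auto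
  qed
  show ?case using 1 2 3 4 by simp
qed auto

lemma sum_shift_int:
  fixes f :: "int \<Rightarrow> real"
  assumes "f (A - 1) = 0" "f B = 0" "A \<le> B"
  shows "(\<Sum>m\<in>{A..B}. f (m - 1)) = (\<Sum>m\<in>{A..B}. f m)"
proof -
  have "(\<Sum>m\<in>{A..B}. f (m - 1)) = (\<Sum>m\<in>{A-1..B-1}. f m)"
    by (rule sum.reindex_bij_witness[of _ "\<lambda>m. m + 1" "\<lambda>m. m - 1"]) auto
  also have "\<dots> = (\<Sum>m\<in>{A..B-1}. f m)"
  proof (rule sum.mono_neutral_right)
    show "\<forall>i\<in>{A-1..B-1} - {A..B-1}. f i = 0"
    proof
      fix i assume "i \<in> {A-1..B-1} - {A..B-1}"
      then have "i = A - 1" by auto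
      then show "f i = 0" using assms by simp
    qed
  qed auto
  also have "\<dots> = (\<Sum>m\<in>{A..B}. f m)"
  proof (rule sum.mono_neutral_left)
    show "\<forall>i\<in>{A..B} - {A..B-1}. f i = 0"
    proof
      fix i assume "i \<in> {A..B} - {A..B-1}"
      then have "i = B" by auto
      then show "f i = 0" using assms by simp
    qed
  qed auto
  finally show ?thesis .
qed

text \<open>Moves one factor of the symmetric operator at a time from the left vector to the right
  one. \<open>L\<close> exceeds the reach of both, so shifting the finite sums produces no boundary
  terms.\<close>

lemma walk_split_aux:
  assumes "int a + int b < L"
  shows "(\<Sum>m\<in>{n-L..n+L}. walk V (a + b) n m * walk V 0 n m)
       = (\<Sum>m\<in>{n-L..n+L}. walk V a n m * walk V b n m)"
  using assms
proof (induction b arbitrary: a)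
  case (Suc b)
  let ?u = "walk V a n" and ?v = "walk V b n" and ?S = "{n-L..n+L}"
  have z: "walk V a n m = 0" "walk V b n m = 0" if "\<bar>m - n\<bar> \<ge> L" for m
    using that Suc.prems by (auto intro!: walk_eq_0)
  have "(\<Sum>m\<in>?S. walk V (a + Suc b) n m * walk V 0 n m)
      = (\<Sum>m\<in>?S. walk V (Suc a) n m * ?v m)"
    using Suc.IH[of "Suc a"] Suc.prems by simp
  also have "\<dots> = (\<Sum>m\<in>?S. ?u (m - 1) * ?v m) + (\<Sum>m\<in>?S. V m * ?u m * ?v m)
      + (\<Sum>m\<in>?S. ?u (m + 1) * ?v m)"
    by (simp add: sum.distrib algebra_simps)
  also have "(\<Sum>m\<in>?S. ?u (m - 1) * ?v m) = (\<Sum>m\<in>?S. ?u m * ?v (m + 1))"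
    using sum_shift_int[of "\<lambda>m. ?u m * ?v (m + 1)" "n - L" "n + L"] z Suc.prems by simp
  also have "(\<Sum>m\<in>?S. ?u (m + 1) * ?v m) = (\<Sum>m\<in>?S. ?u m * ?v (m - 1))"
    using sum_shift_int[of "\<lambda>m. ?u (m + 1) * ?v m" "n - L" "n + L"] z Suc.prems by simp
  also have "(\<Sum>m\<in>?S. ?u m * ?v (m + 1)) + (\<Sum>m\<in>?S. V m * ?u m * ?v m)
      + (\<Sum>m\<in>?S. ?u m * ?v (m - 1)) = (\<Sum>m\<in>?S. ?u m * walk V (Suc b) n m)"
    by (simp add: sum.distrib algebra_simps)
  finally show ?case .
qed auto

text \<open>Self-adjointness: \<open>\<langle>\<delta>, H\<^sup>a\<^sup>+\<^sup>b \<delta>\<rangle> = \<langle>H\<^sup>a \<delta>, H\<^sup>b \<delta>\<rangle>\<close>.\<close>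

lemma walk_split:
  assumes "int a + int b < L"
  shows "walk V (a + b) n n = (\<Sum>m\<in>{n-L..n+L}. walk V a n m * walk V b n m)"
proof -
  have "(\<Sum>m\<in>{n-L..n+L}. walk V (a + b) n m * walk V 0 n m) = walk V (a + b) n n"
    using assms by (simp add: if_distrib[of "\<lambda>x. _ * x"] cong: if_cong)
  with walk_split_aux[OF assms, of V n] show ?thesis by simp
qed

text \<open>Moments at \<open>n\<close> of degree up to \<open>2 * k\<close> do not see the removed
  values. The truncation isolates what the sites \<open>n + k\<close> and \<open>n - k\<close>
  contribute to the next two degrees.\<close>

definition cut :: "nat \<Rightarrow> int \<Rightarrow> (int \<Rightarrow> real) \<Rightarrow> int \<Rightarrow> real" where
  "cut k n V i = (if \<bar>i - n\<bar> < int k then V i else 0)"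

context
  fixes k :: nat and n :: int and V :: "int \<Rightarrow> real"
  assumes k: "1 \<le> k"
begin

lemma walk_cut: "walk (cut k n V) k n m = walk V k n m"
  by (rule walk_cong) (auto simp: cut_def)

text \<open>Among walks of length \<open>k + 1\<close>, only the straight one to
  \<open>n + k\<close> or \<open>n - k\<close> that rests at its end meets a removed value.\<close>

lemma walk_Suc_cut:
  "walk V (Suc k) n m = walk (cut k n V) (Suc k) n m
     + (if m = n + int k then V m else 0) + (if m = n - int k then V m else 0)"
proof -
  have "V m * walk V k n m = cut k n V m * walk V k n m
     + (if m = n + int k then V m else 0) + (if m = n - int k then V m else 0)"
  proof -
    consider "\<bar>m - n\<bar> < int k" | "m = n + int k" | "m = n - int k" | "int k < \<bar>m - n\<bar>"
      by linarith
    then show ?thesis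
      using k walk_eq_0[of k m n V] walk_eq_1[of m n k V] by cases (auto simp: cut_def)
  qed
  then show ?thesis by (simp add: walk_cut)
qed

text \<open>In the uneven split the half of length \<open>k\<close> is blind to the outer values and
  equals 1 at both outer sites, so these values enter linearly.\<close>

lemma walk_odd:
  "walk V (2 * k + 1) n n = walk (cut k n V) (2 * k + 1) n n + V (n + int k) + V (n - int k)"
proof -
  define L where "L = 2 * int k + 2"
  let ?S = "{n-L..n+L}" and ?w = "walk (cut k n V) (Suc k) n" and ?u = "walk V k n"
  have e: "2 * k + 1 = Suc k + k" by simp
  have u: "?u (n + int k) = 1" "?u (n - int k) = 1" by (auto intro: walk_eq_1)
  have "walk V (2 * k + 1) n n = (\<Sum>m\<in>?S. walk V (Suc k) n m * ?u m)"
    unfolding e by (rule walk_split) (simp add: L_def)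
  also have "\<dots> = (\<Sum>m\<in>?S. ?w m * ?u m
      + (if m = n + int k then V m * ?u m else 0) + (if m = n - int k then V m * ?u m else 0))"
  proof (rule sum.cong)
    fix m
    show "walk V (Suc k) n m * ?u m = ?w m * ?u m
      + (if m = n + int k then V m * ?u m else 0) + (if m = n - int k then V m * ?u m else 0)"
      unfolding walk_Suc_cut by (simp add: distrib_right del: walk.simps)
  qed simp
  also have "\<dots> = (\<Sum>m\<in>?S. ?w m * ?u m) + V (n + int k) * ?u (n + int k) + V (n - int k) * ?u (n - int k)"
    by (simp add: sum.distrib L_def del: walk.simps)
  also have "(\<Sum>m\<in>?S. ?w m * ?u m) = walk (cut k n V) (2 * k + 1) n n"
    unfolding e walk_cut[symmetric] by (rule walk_split[symmetric]) (simp add: L_def)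
  finally show ?thesis by (simp only: u mult_1_right)
qed

text \<open>Here both halves reach the outer sites, so the correction of \<open>walk_Suc_cut\<close>
  is squared: each outer value enters as a monic quadratic.\<close>

lemma walk_even:
  "walk V (2 * k + 2) n n = walk (cut k n V) (2 * k + 2) n n
     + (V (n + int k))\<^sup>2 + 2 * V (n + int k) * walk (cut k n V) (Suc k) n (n + int k)
     + (V (n - int k))\<^sup>2 + 2 * V (n - int k) * walk (cut k n V) (Suc k) n (n - int k)"
proof -
  define L where "L = 2 * int k + 3"
  let ?S = "{n-L..n+L}" and ?w = "walk (cut k n V) (Suc k) n"
  have e: "2 * k + 2 = Suc k + Suc k" by simp
  have "walk V (2 * k + 2) n n = (\<Sum>m\<in>?S. walk V (Suc k) n m * walk V (Suc k) n m)"
    unfolding e by (rule walk_split) (simp add: L_def)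
  also have "\<dots> = (\<Sum>m\<in>?S. ?w m * ?w m
      + (if m = n + int k then (V m)\<^sup>2 + 2 * V m * ?w m else 0)
      + (if m = n - int k then (V m)\<^sup>2 + 2 * V m * ?w m else 0))"
  proof (rule sum.cong)
    fix m
    \<comment> \<open>The two corrections sit at different sites, so squaring produces no product of
      the two outer values.\<close>
    have "n + int k \<noteq> n - int k" using k by simp
    then show "walk V (Suc k) n m * walk V (Suc k) n m = ?w m * ?w m
      + (if m = n + int k then (V m)\<^sup>2 + 2 * V m * ?w m else 0)
      + (if m = n - int k then (V m)\<^sup>2 + 2 * V m * ?w m else 0)"
      unfolding walk_Suc_cut by (simp add: algebra_simps power2_eq_square del: walk.simps)
  qed simp
  also have "\<dots> = (\<Sum>m\<in>?S. ?w m * ?w m)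
      + ((V (n + int k))\<^sup>2 + 2 * V (n + int k) * ?w (n + int k))
      + ((V (n - int k))\<^sup>2 + 2 * V (n - int k) * ?w (n - int k))"
    by (simp add: sum.distrib L_def del: walk.simps)
  also have "(\<Sum>m\<in>?S. ?w m * ?w m) = walk (cut k n V) (2 * k + 2) n n"
    unfolding e by (rule walk_split[symmetric]) (simp add: L_def)
  finally show ?thesis by (simp only: add.assoc)
qed

end

text \<open>At least \<open>|m - n|\<close> steps are spent on moving, which leaves at most
  \<open>j - |m - n|\<close> factors of the potential. Truncated subtraction is harmless: the entry
  vanishes once \<open>|m - n|\<close> exceeds \<open>j\<close>.\<close>

lemma filt_walk:
  assumes "\<And>i. \<bar>i - n\<bar> + \<bar>i - m\<bar> + 1 \<le> int j \<Longrightarrow> filt X I y \<rho> w (\<lambda>x. V x i)"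
  shows "filt X I y \<rho> (w * (j - nat \<bar>m - n\<bar>)) (\<lambda>x. walk (V x) j n m)"
  using assms
proof (induction j arbitrary: m)
  case 0
  then show ?case by (auto intro: filt_const)
next
  case (Suc j)
  let ?d = "w * (Suc j - nat \<bar>m - n\<bar>)"
  have 1: "filt X I y \<rho> ?d (\<lambda>x. walk (V x) j n (m - 1))"
    by (rule filt_mono[OF Suc.IH]) (auto intro!: Suc.prems mult_left_mono)
  have 2: "filt X I y \<rho> ?d (\<lambda>x. walk (V x) j n (m + 1))"
    by (rule filt_mono[OF Suc.IH]) (auto intro!: Suc.prems mult_left_mono)
  have 3: "filt X I y \<rho> (w * (j - nat \<bar>m - n\<bar>)) (\<lambda>x. walk (V x) j n m)"
    by (rule Suc.IH) (auto intro!: Suc.prems)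
  have 4: "filt X I y \<rho> ?d (\<lambda>x. V x m * walk (V x) j n m)"
  proof (cases "\<bar>m - n\<bar> \<le> int j")
    case True
    have "filt X I y \<rho> w (\<lambda>x. V x m)" by (rule Suc.prems) (use True in auto)
    then show ?thesis
    proof (rule filt_mult[OF _ 3])
      have "Suc j - nat \<bar>m - n\<bar> = Suc (j - nat \<bar>m - n\<bar>)" using True by auto
      then show "w + w * (j - nat \<bar>m - n\<bar>) \<le> ?d" by simp
    qed
  next
    case False
    then have "walk (V x) j n m = 0" for x by (intro walk_eq_0) auto
    then show ?thesis by (auto intro: filt_const)
  qed
  show ?case unfolding walk.simps by (intro filt_add 1 2 4)
qed

lemma filt_walk_diag:
  assumes "\<And>i. 2 * \<bar>i - n\<bar> + 1 \<le> int j \<Longrightarrow> filt X I y \<rho> w (\<lambda>x. V x i)" "w * j \<le> d"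
  shows "filt X I y \<rho> d (\<lambda>x. walk (V x) j n n)"
proof -
  have "filt X I y \<rho> (w * (j - nat \<bar>n - n\<bar>)) (\<lambda>x. walk (V x) j n n)"
    by (rule filt_walk) (auto intro: assms)
  then show ?thesis by (rule filt_mono) (use assms in auto)
qed

text \<open>Only the walk that rests at every step yields the full power of \<open>V x n\<close>;
  all others lose weight by moving. A loss of one unit is all that the reductions below
  require.\<close>

lemma filt_walk_top:
  assumes "\<And>i. 2 * \<bar>i - n\<bar> + 1 \<le> int j \<Longrightarrow> filt X I y \<rho> 2 (\<lambda>x. V x i)"
  shows "filt X I y \<rho> (2 * j - 1) (\<lambda>x. walk (V x) j n n - V x n ^ j)"
  using assms
proof (induction j)
  case 0
  then show ?case by (auto intro: filt_const)
next
  case (Suc j)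
  have 1: "filt X I y \<rho> (2 * Suc j - 1) (\<lambda>x. walk (V x) j n (n - 1))"
    by (rule filt_mono[OF filt_walk[where w = 2]]) ((rule Suc.prems, arith) | simp)+
  have 2: "filt X I y \<rho> (2 * Suc j - 1) (\<lambda>x. walk (V x) j n (n + 1))"
    by (rule filt_mono[OF filt_walk[where w = 2]]) ((rule Suc.prems, arith) | simp)+
  have 3: "filt X I y \<rho> (2 * Suc j - 1) (\<lambda>x. V x n * (walk (V x) j n n - V x n ^ j))"
  proof (cases j)
    case 0
    then show ?thesis by (auto intro: filt_const)
  next
    case (Suc j')
    show ?thesis
      by (rule filt_mult[OF Suc.prems Suc.IH[OF Suc.prems]]) (use Suc in auto)
  qed
  show ?case
    by (rule filt_cong[OF filt_add[OF filt_add[OF 1 2] 3]]) (simp add: algebra_simps)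
qed

section \<open>Algebraic dependence of the edges\<close>

text \<open>\<open>scale\<close> is a free parameter, subject to none of the relations: it replaces
  an edge vector by the line of all its multiples at the price of one generator.\<close>

datatype spectral_data = Spectral_data
  (scale: real) (potential: "int \<Rightarrow> real") (rcoeff: "nat \<Rightarrow> real") (edge: "nat \<Rightarrow> real")

text \<open>The coefficients \<open>c\<close> are those of \<open>\<surd>(\<Prod>k. 1 - e\<^sub>k X)\<close>; the second condition
  says that \<open>c\<close> times the generating function of \<open>(H\<^sup>j)\<^sub>n\<^sub>n\<close> is a polynomial of degree \<open>g\<close>.\<close>

definition finite_gap_data :: "nat \<Rightarrow> spectral_data set" where
  "finite_gap_data g = {x. rcoeff x 0 = 1
     \<and> (\<forall>n j. g < j \<longrightarrow> (\<Sum>i\<le>j. rcoeff x i * walk (potential x) (j - i) n n) = 0)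
     \<and> (\<forall>k<2*g+2. (\<Sum>j\<le>2*g+2. (\<Sum>i\<le>j. rcoeff x i * rcoeff x (j - i)) * edge x k ^ (2*g+2-j)) = 0)}"

datatype coord = Scale | Potential int | Coeff nat | Edge nat

fun coord_val :: "coord \<Rightarrow> spectral_data \<Rightarrow> real" where
  "coord_val Scale x = scale x"
| "coord_val (Potential n) x = potential x n"
| "coord_val (Coeff i) x = rcoeff x i"
| "coord_val (Edge k) x = edge x k"

lemma coord_val_eta:
  "coord_val Scale = scale" "coord_val (Potential n) = (\<lambda>x. potential x n)"
  "coord_val (Coeff i) = (\<lambda>x. rcoeff x i)" "coord_val (Edge k) = (\<lambda>x. edge x k)"
  by auto

lemma filt_extend:
  assumes "filt X I y \<rho> d f" "I \<subseteq> I'" "\<And>i. i \<in> I \<Longrightarrow> \<rho>' i = \<rho> i"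
  shows "filt X I' y \<rho>' d f"
  using assms(1)
proof induction
  case (filt_gen i d)
  show ?case by (rule filt.filt_gen) (use assms filt_gen in auto)
next
  case (filt_mult a f b g d)
  show ?case by (rule filt.filt_mult[OF filt_mult.IH filt_mult.hyps(3)])
next
  case (filt_cong d f g)
  show ?case by (rule filt.filt_cong[OF filt_cong.IH]) (rule filt_cong.hyps)
next
  case (filt_add d f g)
  show ?case by (rule filt.filt_add[OF filt_add.IH])
next
  case (filt_const d c)
  show ?case by (rule filt.filt_const)
qed

text \<open>The edge is a root of the reversed polynomial of \<open>c\<close> squared, monic of
  degree \<open>2*g+2\<close> because \<open>rcoeff x 0 = 1\<close>. All other coefficients have
  weight at most \<open>2 * d\<close>; giving the edge the weight \<open>2 * d + 1\<close> makes its
  leading power strictly dominant.\<close>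

lemma edge_power_filt:
  assumes c: "\<And>j. j \<le> 2*g+2 \<Longrightarrow> filt (finite_gap_data g) I coord_val \<rho> d (\<lambda>x. rcoeff x j)"
    and k: "k < 2*g+2" "Edge k \<in> I" "\<rho> (Edge k) = 2 * d + 1"
  shows "filt (finite_gap_data g) I coord_val \<rho> ((2*g+2) * (2*d+1) - 1) (\<lambda>x. coord_val (Edge k) x ^ (2*g+2))"
proof -
  let ?F = "filt (finite_gap_data g) I coord_val \<rho>"
  let ?r = "\<lambda>x j. \<Sum>i\<le>j. rcoeff x i * rcoeff x (j - i)"
  have r: "?F (2 * d) (\<lambda>x. ?r x j)" if "j \<le> 2*g+2" for j
    by (rule filt_sum, rule filt_mult[OF c c]) (use that in auto)
  have e: "?F (2*d+1) (\<lambda>x. edge x k)"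
    using filt_gen[OF k(2), of \<rho> "2*d+1" "finite_gap_data g" coord_val] k(3) by (simp add: coord_val_eta)
  have "?F ((2*g+2) * (2*d+1) - 1) (\<lambda>x. - (\<Sum>j\<in>{1..2*g+2}. ?r x j * edge x k ^ (2*g+2-j)))"
  proof (rule filt_minus, rule filt_sum)
    fix j assume j: "j \<in> {1..2*g+2}"
    have "2*d + (2*g+2-j) * (2*d+1) \<le> 2*d + (2*g+1) * (2*d+1)"
      using j by (intro add_left_mono mult_right_mono) auto
    also have "\<dots> \<le> (2*g+2) * (2*d+1) - 1" by (simp add: algebra_simps)
    finally show "?F ((2*g+2) * (2*d+1) - 1) (\<lambda>x. ?r x j * edge x k ^ (2*g+2-j))"
      using j by (intro filt_mult[OF r filt_power[OF e order_refl]]) auto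
  qed
  then show ?thesis
  proof (rule filt_cong)
    fix x assume x: "x \<in> finite_gap_data g"
    then have "(\<Sum>j\<le>2*g+2. ?r x j * edge x k ^ (2*g+2-j)) = 0"
      using k(1) unfolding finite_gap_data_def by blast
    also have "{..2*g+2} = insert 0 {1..2*g+2}" by auto
    finally have "?r x 0 * edge x k ^ (2*g+2) + (\<Sum>j\<in>{1..2*g+2}. ?r x j * edge x k ^ (2*g+2-j)) = 0"
      by (subst (asm) sum.insert) auto
    then show "- (\<Sum>j\<in>{1..2*g+2}. ?r x j * edge x k ^ (2*g+2-j)) = coord_val (Edge k) x ^ (2*g+2)"
      using x by (simp add: finite_gap_data_def)
  qed
qed

text \<open>Adjoining the edges enlarges \<open>I\<close> and \<open>R\<close> alike, so
  \<open>card (I - R)\<close> stays at most \<open>2*g+1\<close> while there are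
  \<open>2*g+2\<close> scaled edges to relate.\<close>

lemma edges_dependent_aux:
  assumes fr: "filtered_reduction (finite_gap_data g) I coord_val \<rho> R N"
    and card: "card (I - R) \<le> 2*g+1" and Scale: "Scale \<in> I" and no_edge: "\<And>k. Edge k \<notin> I"
    and c: "\<And>j. j \<le> 2*g+2 \<Longrightarrow> \<exists>d. filt (finite_gap_data g) I coord_val \<rho> d (\<lambda>x. rcoeff x j)"
  shows "\<exists>q a. (\<exists>\<alpha>\<in>PiE {..<2*g+2} (\<lambda>_. {..<q}). a \<alpha> \<noteq> 0) \<and>
     (\<forall>x\<in>finite_gap_data g. (\<Sum>\<alpha>\<in>PiE {..<2*g+2} (\<lambda>_. {..<q::nat}).
        a \<alpha> * (\<Prod>k<2*g+2. (scale x * edge x k) ^ \<alpha> k)) = 0)"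
proof -
  let ?X = "finite_gap_data g"
  interpret fr: filtered_reduction ?X I coord_val \<rho> R N by fact
  from c have "\<forall>j\<in>{..2*g+2}. \<exists>d. filt ?X I coord_val \<rho> d (\<lambda>x. rcoeff x j)" by simp
  from bchoice[OF this] obtain ds where
    ds: "\<forall>j\<in>{..2*g+2}. filt ?X I coord_val \<rho> (ds j) (\<lambda>x. rcoeff x j)" ..
  define d where "d = Max (ds ` {..2*g+2})"
  define I' where "I' = I \<union> Edge ` {..<2*g+2}"
  define R' where "R' = R \<union> Edge ` {..<2*g+2}"
  define \<rho>' where "\<rho>' i = (case i of Edge k \<Rightarrow> 2*d+1 | _ \<Rightarrow> \<rho> i)" for i
  define N' where "N' i = (case i of Edge k \<Rightarrow> 2*g+2 | _ \<Rightarrow> N i)" for i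
  have \<rho>': "\<rho>' i = \<rho> i" "N' i = N i" if "i \<in> I" for i
    using that no_edge by (auto simp: \<rho>'_def N'_def split: coord.split)
  have ext: "filt ?X I' coord_val \<rho>' e f" if "filt ?X I coord_val \<rho> e f" for e f
    by (rule filt_extend[OF that]) (auto simp: I'_def \<rho>')
  have c': "filt ?X I' coord_val \<rho>' d (\<lambda>x. rcoeff x j)" if "j \<le> 2*g+2" for j
  proof (rule ext, rule filt_mono)
    show "filt ?X I coord_val \<rho> (ds j) (\<lambda>x. rcoeff x j)" using ds that by simp
    show "ds j \<le> d" unfolding d_def by (rule Max_ge) (use that in auto)
  qed
  have "filtered_reduction ?X I' coord_val \<rho>' R' N'"
  proof
    show "finite I'" using fr.finI by (simp add: I'_def)
    show "0 < \<rho>' i" if "i \<in> I'" for i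
      using that fr.\<rho>_pos \<rho>' by (auto simp: I'_def) (simp add: \<rho>'_def)
    show "R' \<subseteq> I'" using fr.RI by (auto simp: R'_def I'_def)
    show "0 < N' i" if "i \<in> R'" for i
    proof (cases "i \<in> R")
      case True
      then show ?thesis using fr.N_pos \<rho>' fr.RI by auto
    next
      case False
      then show ?thesis using that by (auto simp: R'_def N'_def)
    qed
    show "filt ?X I' coord_val \<rho>' (N' i * \<rho>' i - 1) (\<lambda>x. coord_val i x ^ N' i)" if iR: "i \<in> R'" for i
    proof (cases "i \<in> R")
      case True
      then show ?thesis using ext[OF fr.red[OF True]] \<rho>' fr.RI by auto
    next
      case False
      then obtain k where k: "i = Edge k" "k < 2*g+2" using iR by (auto simp: R'_def)
      then show ?thesis using edge_power_filt[of g I' \<rho>' d k, OF c'] by (simp add: N'_def \<rho>'_def I'_def)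
    qed
  qed
  then interpret fr': filtered_reduction ?X I' coord_val \<rho>' R' N' .
  have "card (I' - R') < 2*g+2"
  proof -
    have "I' - R' = I - R" using no_edge by (auto simp: I'_def R'_def)
    then show ?thesis using card by simp
  qed
  moreover have "filt ?X I' coord_val \<rho>' (\<rho>' Scale + (2*d+1)) (\<lambda>x. scale x * edge x k)" if "k < 2*g+2" for k
  proof -
    have "filt ?X I' coord_val \<rho>' (\<rho>' Scale) (coord_val Scale)"
      by (rule filt_gen) (use Scale in \<open>auto simp: I'_def\<close>)
    moreover have "filt ?X I' coord_val \<rho>' (2*d+1) (coord_val (Edge k))"
      by (rule filt_gen) (use that in \<open>auto simp: I'_def \<rho>'_def\<close>)
    ultimately have "filt ?X I' coord_val \<rho>' (\<rho>' Scale + (2*d+1)) (\<lambda>x. coord_val Scale x * coord_val (Edge k) x)"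
      by (rule filt_mult) simp
    then show ?thesis by simp
  qed
  ultimately show ?thesis
    by (intro fr'.algebraically_dependent[of "2*g+2" "\<rho>' Scale + (2*d+1)" "\<lambda>k x. scale x * edge x k"])
qed

text \<open>Beyond degree \<open>g\<close>, the relation at site 0 is solved for
  \<open>rcoeff x j\<close>, whose cofactor is the moment 1 of degree 0. Moments of degree up to
  \<open>2*g+2\<close> at site 0 involve only sites at distance at most \<open>g\<close>.\<close>

lemma coeff_polynomial:
  assumes "\<And>j. j \<le> g + 1 \<Longrightarrow> \<exists>d. filt (finite_gap_data g) I y \<rho> d (\<lambda>x. rcoeff x j)"
    and "\<And>n. \<bar>n\<bar> \<le> int g \<Longrightarrow> \<exists>d. filt (finite_gap_data g) I y \<rho> d (\<lambda>x. potential x n)"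
    and "j \<le> 2*g+2"
  shows "\<exists>d. filt (finite_gap_data g) I y \<rho> d (\<lambda>x. rcoeff x j)"
  using assms(3)
proof (induction j rule: less_induct)
  case (less j)
  show ?case
  proof (cases "j \<le> g + 1")
    case True
    then show ?thesis by (rule assms(1))
  next
    case False
    let ?X = "finite_gap_data g"
    have "\<forall>n\<in>{-int g..int g}. \<exists>d. filt ?X I y \<rho> d (\<lambda>x. potential x n)" using assms(2) by auto
    from bchoice[OF this] obtain ds where
      ds: "\<forall>n\<in>{-int g..int g}. filt ?X I y \<rho> (ds n) (\<lambda>x. potential x n)" ..
    define w where "w = Max (ds ` {-int g..int g})"
    have w: "filt ?X I y \<rho> w (\<lambda>x. potential x n)" if "\<bar>n\<bar> \<le> int g" for n
    proof (rule filt_mono)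
      show "filt ?X I y \<rho> (ds n) (\<lambda>x. potential x n)"
        by (rule ds[rule_format]) (use that in auto)
      show "ds n \<le> w" unfolding w_def by (rule Max_ge) (use that in \<open>auto intro!: imageI\<close>)
    qed
    have "\<forall>i\<in>{..<j}. \<exists>d. filt ?X I y \<rho> d (\<lambda>x. rcoeff x i)" using less by auto
    from bchoice[OF this] obtain es where
      es: "\<forall>i\<in>{..<j}. filt ?X I y \<rho> (es i) (\<lambda>x. rcoeff x i)" ..
    define v where "v = Max (es ` {..<j})"
    have v: "filt ?X I y \<rho> v (\<lambda>x. rcoeff x i)" if "i < j" for i
    proof (rule filt_mono)
      show "filt ?X I y \<rho> (es i) (\<lambda>x. rcoeff x i)" by (rule es[rule_format]) (use that in auto)
      show "es i \<le> v" unfolding v_def by (rule Max_ge) (use that in auto)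
    qed
    have "filt ?X I y \<rho> (v + w * j) (\<lambda>x. - (\<Sum>i<j. rcoeff x i * walk (potential x) (j - i) 0 0))"
    proof (intro filt_minus filt_sum)
      fix i assume "i \<in> {..<j}"
      then show "filt ?X I y \<rho> (v + w * j) (\<lambda>x. rcoeff x i * walk (potential x) (j - i) 0 0)"
        using less.prems by (intro filt_mult[OF v filt_walk_diag[OF w]]) auto
    qed
    then have "filt ?X I y \<rho> (v + w * j) (\<lambda>x. rcoeff x j)"
    proof (rule filt_cong)
      fix x assume "x \<in> ?X"
      then have "(\<Sum>i\<le>j. rcoeff x i * walk (potential x) (j - i) 0 0) = 0"
        using False by (auto simp: finite_gap_data_def)
      also have "{..j} = insert j {..<j}" by auto
      finally show "- (\<Sum>i<j. rcoeff x i * walk (potential x) (j - i) 0 0) = rcoeff x j"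
        by (subst (asm) sum.insert) auto
    qed
    then show ?thesis ..
  qed
qed

lemma finite_gap_dataD:
  assumes "x \<in> finite_gap_data g" "g < j"
  shows "walk (potential x) j n n = - (\<Sum>i\<in>{1..j}. rcoeff x i * walk (potential x) (j - i) n n)"
proof -
  have "(\<Sum>i\<le>j. rcoeff x i * walk (potential x) (j - i) n n) = 0"
    using assms by (auto simp: finite_gap_data_def)
  also have "{..j} = insert 0 {1..j}" by auto
  finally show ?thesis using assms by (subst (asm) sum.insert) (auto simp: finite_gap_data_def)
qed

text \<open>By the relation in degree \<open>g + 1\<close>, whose top term is \<open>V\<^sub>n\<^sup>g\<^sup>+\<^sup>1\<close>, the inner potentials in the window
  \<open>-g..g\<close> are reducible; the \<open>2k\<close> outer ones, \<open>c\<^sub>1, \<dots>, c\<^sub>g\<^sub>+\<^sub>1\<close> and the scale make \<open>2g + 1\<close>.\<close>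

theorem edges_dependent_odd:
  assumes g: "g = 2*k+1"
  shows "\<exists>q a. (\<exists>\<alpha>\<in>PiE {..<2*g+2} (\<lambda>_. {..<q}). a \<alpha> \<noteq> 0) \<and>
     (\<forall>x\<in>finite_gap_data g. (\<Sum>\<alpha>\<in>PiE {..<2*g+2} (\<lambda>_. {..<q::nat}).
        a \<alpha> * (\<Prod>k<2*g+2. (scale x * edge x k) ^ \<alpha> k)) = 0)"
proof -
  let ?X = "finite_gap_data g"
  define I where "I = {Scale} \<union> Potential ` {-int g..int g} \<union> Coeff ` {1..g+1}"
  \<comment> \<open>The centres whose window of radius \<open>k\<close>, all that the moment of
    degree \<open>g + 1\<close> sees, stays within \<open>-g..g\<close>.\<close>
  define R where "R = Potential ` {-int (k+1)..int (k+1)}"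
  \<comment> \<open>The relations are homogeneous if the potential has weight 1 and
    \<open>Coeff j\<close> weight \<open>j\<close>. Doubling and then lowering the coefficients by
    one breaks the tie: terms containing a coefficient fall below the pure power of the
    potential.\<close>
  define \<rho> where "\<rho> i = (case i of Potential _ \<Rightarrow> 2 | Coeff j \<Rightarrow> 2 * j - 1 | _ \<Rightarrow> 1)" for i
  let ?F = "filt ?X I coord_val \<rho>"
  have V: "?F 2 (\<lambda>x. potential x n)" if "\<bar>n\<bar> \<le> int g" for n
  proof -
    have "Potential n \<in> I" unfolding I_def using that by (auto intro!: imageI)
    then show ?thesis using filt_gen[of "Potential n" I \<rho> 2 ?X coord_val] by (simp add: \<rho>_def coord_val_eta)
  qed
  have C: "?F (2*i-1) (\<lambda>x. rcoeff x i)" if "i \<in> {1..g+1}" for i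
  proof -
    have "Coeff i \<in> I" unfolding I_def using that by (auto intro!: imageI)
    then show ?thesis using filt_gen[of "Coeff i" I \<rho> "2*i-1" ?X coord_val] by (simp add: \<rho>_def coord_val_eta)
  qed
  have red: "?F (2*g+1) (\<lambda>x. potential x n ^ (g+1))" if n: "\<bar>n\<bar> \<le> int (k+1)" for n
  proof -
    have win: "?F 2 (\<lambda>x. potential x i)" if "2 * \<bar>i - n\<bar> + 1 \<le> int (g+1)" for i
    proof (rule V)
      have "\<bar>i - n\<bar> \<le> int k" using that g by presburger
      then show "\<bar>i\<bar> \<le> int g" using n g by linarith
    qed
    have 1: "?F (2*g+1) (\<lambda>x. \<Sum>i\<in>{1..g+1}. rcoeff x i * walk (potential x) (g+1 - i) n n)"
    proof (rule filt_sum)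
      fix i assume i: "i \<in> {1..g+1}"
      have "?F (2*(g+1-i)) (\<lambda>x. walk (potential x) (g+1 - i) n n)"
        by (rule filt_walk_diag[where w = 2]) (use i in \<open>auto intro!: win\<close>)
      note w = this
      show "?F (2*g+1) (\<lambda>x. rcoeff x i * walk (potential x) (g+1 - i) n n)"
        by (rule filt_mult[OF C w]) (use i in auto)
    qed
    have "?F (2*(g+1)-1) (\<lambda>x. walk (potential x) (g+1) n n - potential x n ^ (g+1))"
      by (rule filt_walk_top) (rule win)
    then have 2: "?F (2*g+1) (\<lambda>x. walk (potential x) (g+1) n n - potential x n ^ (g+1))" by simp
    show ?thesis
      by (rule filt_cong[OF filt_minus[OF filt_add[OF 1 2]]]) (simp add: finite_gap_dataD del: walk.simps)
  qed
  show ?thesis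
  proof (rule edges_dependent_aux)
    show "filtered_reduction ?X I coord_val \<rho> R (\<lambda>_. g+1)"
    proof
      show "finite I" by (simp add: I_def)
      show "0 < \<rho> i" if "i \<in> I" for i using that by (auto simp: I_def \<rho>_def)
      show "R \<subseteq> I" using g by (auto simp: I_def R_def)
      show "?F ((g+1) * \<rho> i - 1) (\<lambda>x. coord_val i x ^ (g+1))" if iR: "i \<in> R" for i
      proof -
        obtain n where n: "i = Potential n" "\<bar>n\<bar> \<le> int (k+1)" using iR by (auto simp: R_def)
        show ?thesis using red[OF n(2)] n(1) by (simp add: \<rho>_def mult.commute)
      qed
    qed auto
    \<comment> \<open>With \<open>g = 2*k+1\<close> the count is \<open>1 + k + k + (g + 1)\<close>,
      which equals \<open>2*g+1\<close>.\<close>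
    have "I - R \<subseteq> {Scale} \<union> Potential ` {-int g..-int (k+2)} \<union> Potential ` {int (k+2)..int g} \<union> Coeff ` {1..g+1}"
      by (auto simp: I_def R_def image_iff)
    then have "card (I - R) \<le> card ({Scale} \<union> Potential ` {-int g..-int (k+2)} \<union> Potential ` {int (k+2)..int g} \<union> Coeff ` {1..g+1})"
      by (intro card_mono) auto
    also have "\<dots> \<le> 1 + card {-int g..-int (k+2)} + card {int (k+2)..int g} + card {1..g+1}"
      by (intro card_Un_le[THEN order_trans] add_mono card_image_le) auto
    also have "\<dots> = 2*g+1" using g by auto
    finally show "card (I - R) \<le> 2*g+1" .
    show "Scale \<in> I" by (simp add: I_def)
    show "Edge i \<notin> I" for i by (auto simp: I_def)
    fix j assume "j \<le> 2*g+2"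
    show "\<exists>d. ?F d (\<lambda>x. rcoeff x j)"
    proof (rule coeff_polynomial)
      fix i assume i: "i \<le> g + 1"
      show "\<exists>d. ?F d (\<lambda>x. rcoeff x i)"
      proof (cases "i = 0")
        case True
        have "?F 0 (\<lambda>x. rcoeff x i)"
          by (rule filt_cong[OF filt_const[of _ _ _ _ _ 1]]) (simp add: finite_gap_data_def True)
        then show ?thesis ..
      next
        case False
        then show ?thesis using C[of i] i by (intro exI) auto
      qed
    next
      fix n :: int assume "\<bar>n\<bar> \<le> int g"
      then show "\<exists>d. ?F d (\<lambda>x. potential x n)" using V by blast
    qed fact
  qed
qed


text \<open>For even \<open>g\<close> the relation in degree \<open>g + 1\<close> alone leaves one quantity too many. It expresses the outer potential
  \<open>V(n - \<sigma>k)\<close> as \<open>- V\<^sub>n\<^sup>g\<^sup>+\<^sup>1\<close> plus lower terms; inserting this into the relation in degree \<open>g + 2\<close>, which is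
  monic quadratic in \<open>V(n - \<sigma>k)\<close>, makes \<open>V\<^sub>n\<close> integral.\<close>

lemma potential_power_even:
  fixes \<sigma> :: int
  assumes g: "g = 2*k" "1 \<le> k" and \<sigma>: "\<sigma> = 1 \<or> \<sigma> = -1"
    and V: "\<And>i. \<bar>i - n\<bar> < int k \<or> i = n + \<sigma> * int k \<Longrightarrow> filt (finite_gap_data g) I y \<rho> 2 (\<lambda>x. potential x i)"
    and C: "\<And>i. i \<in> {1..g+2} \<Longrightarrow> filt (finite_gap_data g) I y \<rho> (2*i-1) (\<lambda>x. rcoeff x i)"
  shows "filt (finite_gap_data g) I y \<rho> (4*g+3) (\<lambda>x. potential x n ^ (2*g+2))"
proof -
  let ?X = "finite_gap_data g"
  let ?F = "filt ?X I y \<rho>"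
  let ?W = "\<lambda>x. cut k n (potential x)"
  let ?a = "n - \<sigma> * int k" and ?b = "n + \<sigma> * int k"
  have W: "?F 2 (\<lambda>x. ?W x i)" for i
    by (cases "\<bar>i - n\<bar> < int k") (auto simp: cut_def intro: V filt_const)
  have win: "?F 2 (\<lambda>x. potential x i)" if "2 * \<bar>i - n\<bar> + 1 \<le> int j" "j \<le> g" for i j
    by (rule V) (use that g in auto)
  have f: "?F d (\<lambda>x. walk (potential x) j n n)" if "j \<le> g" "2 * j \<le> d" for j d
    by (rule filt_walk_diag[where w = 2]) (use that in \<open>auto intro!: win\<close>)
  have S1: "?F (2*g+1) (\<lambda>x. \<Sum>i\<in>{1..g+1}. rcoeff x i * walk (potential x) (g+1 - i) n n)"
  proof (rule filt_sum)
    fix i assume i: "i \<in> {1..g+1}"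
    show "?F (2*g+1) (\<lambda>x. rcoeff x i * walk (potential x) (g+1 - i) n n)"
      by (rule filt_mult[OF C f[OF _ order_refl]]) (use i in auto)
  qed
  have top: "?F (2*g+1) (\<lambda>x. walk (?W x) (g+1) n n - potential x n ^ (g+1))"
  proof (rule filt_cong)
    have "?F (2*(g+1)-1) (\<lambda>x. walk (?W x) (g+1) n n - ?W x n ^ (g+1))"
      by (rule filt_walk_top) (rule W)
    moreover have "2*(g+1)-1 = 2*g+1" by simp
    ultimately show "?F (2*g+1) (\<lambda>x. walk (?W x) (g+1) n n - ?W x n ^ (g+1))" by (simp only:)
  qed (use g in \<open>simp add: cut_def\<close>)
  \<comment> \<open>Everything of weight at most \<open>2*g+1\<close> in the expression for the
    outer potential at \<open>?a\<close>.\<close>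
  define T where "T x = - (walk (?W x) (g+1) n n - potential x n ^ (g+1)) - potential x ?b
    - (\<Sum>i\<in>{1..g+1}. rcoeff x i * walk (potential x) (g+1 - i) n n)" for x
  have T: "?F (2*g+1) T"
    unfolding T_def by (rule filt_diff[OF filt_diff[OF filt_minus[OF top] filt_mono[OF V]] S1]) (use g in auto)
  have Va: "potential x ?a = T x - potential x n ^ (g+1)" if "x \<in> ?X" for x
  proof -
    have "walk (potential x) (g+1) n n = walk (?W x) (g+1) n n + potential x ?a + potential x ?b"
      using walk_odd[OF g(2), of "potential x" n] g(1) \<sigma> by (auto simp del: walk.simps)
    then show ?thesis using finite_gap_dataD[OF that, of "g+1" n] by (simp add: T_def del: walk.simps)
  qed
  define B where "B x = walk (?W x) (Suc k) n ?b" for x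
  define A where "A x = walk (?W x) (Suc k) n ?a" for x
  have s: "nat \<bar>\<sigma> * int k\<bar> = k" using \<sigma> by auto
  have B: "?F 2 B" unfolding B_def
    by (rule filt_mono[OF filt_walk[where w = 2]]) (use s in \<open>auto intro: W\<close>)
  have A: "?F 2 A" unfolding A_def
    by (rule filt_mono[OF filt_walk[where w = 2]]) (use s in \<open>auto intro: W\<close>)
  have Vn: "?F 2 (\<lambda>x. potential x n)" by (rule V) (use g in auto)
  have Vb: "?F 2 (\<lambda>x. potential x ?b)" by (rule V) simp
  have Vn': "?F (2*g+2) (\<lambda>x. potential x n ^ (g+1))"
    by (rule filt_power[OF Vn]) simp
  have U: "?F (2*g+2) (\<lambda>x. T x - potential x n ^ (g+1))"
    by (intro filt_diff filt_mono[OF T] Vn') simp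
  have S2: "?F (4*g+3) (\<lambda>x. \<Sum>i\<in>{2..g+2}. rcoeff x i * walk (potential x) (g+2 - i) n n)"
  proof (rule filt_sum)
    fix i assume i: "i \<in> {2..g+2}"
    show "?F (4*g+3) (\<lambda>x. rcoeff x i * walk (potential x) (g+2 - i) n n)"
      by (rule filt_mult[OF C f[OF _ order_refl]]) (use i in auto)
  qed
  have Y: "?F (4*g+3) (\<lambda>x. walk (?W x) (g+2) n n)"
    by (rule filt_walk_diag[where w = 2], rule W) (use g in auto)
  \<comment> \<open>The moment of degree \<open>g + 1\<close> contains the potential at
    \<open>?a\<close>, which \<open>V\<close> does not cover; the relation of that degree replaces
    it by the sum bounded in \<open>S1\<close>.\<close>
  have Z: "?F (4*g+3) (\<lambda>x. rcoeff x 1 * (\<Sum>i\<in>{1..g+1}. rcoeff x i * walk (potential x) (g+1 - i) n n))"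
    by (rule filt_mult[OF C[of 1] S1]) auto
  \<comment> \<open>What \<open>walk_even\<close> adds to the truncated moment after substituting
    \<open>Va\<close>, apart from the square \<open>potential x n ^ (2*g+2)\<close>. The mixed term
    of \<open>T\<close> with the power of the potential attains the weight
    \<open>4*g+3\<close>.\<close>
  let ?P = "\<lambda>x. potential x ?b * potential x ?b + 2 * (potential x ?b * B x)
      + 2 * ((T x - potential x n ^ (g+1)) * A x) + T x * T x - 2 * (potential x n ^ (g+1) * T x)"
  have P: "?F (4*g+3) ?P"
    by (intro filt_add filt_diff filt_cmult filt_mult[OF Vb Vb] filt_mult[OF Vb B] filt_mult[OF U A]
        filt_mult[OF T T] filt_mult[OF Vn' T]) (use g in auto)
  show ?thesis
  proof (rule filt_cong[OF filt_diff[OF filt_diff[OF Z S2] filt_add[OF Y P]]])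
    fix x assume x: "x \<in> ?X"
    have 1: "walk (potential x) (g+2) n n = walk (?W x) (g+2) n n
        + (potential x ?b)\<^sup>2 + 2 * potential x ?b * B x + (potential x ?a)\<^sup>2 + 2 * potential x ?a * A x"
      using walk_even[OF g(2), of "potential x" n] g(1) \<sigma> by (auto simp: A_def B_def simp del: walk.simps)
    have 2: "walk (potential x) (g+2) n n = - (rcoeff x 1 * walk (potential x) (g+1) n n)
        - (\<Sum>i\<in>{2..g+2}. rcoeff x i * walk (potential x) (g+2 - i) n n)"
    proof -
      have "{1..g+2} = insert 1 {2..g+2}" by auto
      then show ?thesis using finite_gap_dataD[OF x, of "g+2" n] by (simp del: walk.simps)
    qed
    have 3: "walk (potential x) (g+1) n n = - (\<Sum>i\<in>{1..g+1}. rcoeff x i * walk (potential x) (g+1 - i) n n)"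
      by (rule finite_gap_dataD[OF x]) simp
    have 4: "potential x n ^ (2*g+2) = potential x n ^ (g+1) * potential x n ^ (g+1)"
      by (simp add: power_add[symmetric] mult_2)
    show "rcoeff x 1 * (\<Sum>i\<in>{1..g+1}. rcoeff x i * walk (potential x) (g+1 - i) n n)
       - (\<Sum>i\<in>{2..g+2}. rcoeff x i * walk (potential x) (g+2 - i) n n)
       - (walk (?W x) (g+2) n n + ?P x) = potential x n ^ (2*g+2)"
      using 1 2 unfolding 3 Va[OF x] 4 by (simp add: power2_eq_square algebra_simps del: walk.simps power_Suc)
  qed
qed

text \<open>For even \<open>g\<close> the relation in degree \<open>g + 1\<close> is affine in the
  two outermost potentials with coefficient 1, so it can be solved for either. The weight may grow,
  since only polynomial dependence is wanted here.\<close>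

lemma potential_polynomial_step:
  fixes \<sigma> :: int
  assumes g: "g = 2*k" "1 \<le> k" and \<sigma>: "\<sigma> = 1 \<or> \<sigma> = -1"
    and V: "\<And>i. \<bar>i - n\<bar> < int k \<or> i = n - \<sigma> * int k \<Longrightarrow> filt (finite_gap_data g) I y \<rho> d (\<lambda>x. potential x i)"
    and C: "\<And>i. i \<in> {1..g+1} \<Longrightarrow> filt (finite_gap_data g) I y \<rho> (2*i-1) (\<lambda>x. rcoeff x i)"
  shows "\<exists>d. filt (finite_gap_data g) I y \<rho> d (\<lambda>x. potential x (n + \<sigma> * int k))"
proof -
  let ?X = "finite_gap_data g"
  let ?e = "2*g+2 + d * (g+1)"
  let ?F = "filt ?X I y \<rho>"
  let ?W = "\<lambda>x. cut k n (potential x)"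
  let ?a = "n - \<sigma> * int k" and ?b = "n + \<sigma> * int k"
  have W: "?F d (\<lambda>x. ?W x i)" for i
    by (cases "\<bar>i - n\<bar> < int k") (auto simp: cut_def intro: V filt_const)
  have S: "?F ?e (\<lambda>x. \<Sum>i\<in>{1..g+1}. rcoeff x i * walk (potential x) (g+1 - i) n n)"
  proof (rule filt_sum)
    fix i assume i: "i \<in> {1..g+1}"
    have "?F (d * (g+1)) (\<lambda>x. walk (potential x) (g+1 - i) n n)"
    proof (rule filt_walk_diag[where w = d])
      show "d * (g+1-i) \<le> d * (g+1)" by (intro mult_left_mono) auto
    qed (rule V, use i g in auto)
    note w = this
    show "?F ?e (\<lambda>x. rcoeff x i * walk (potential x) (g+1 - i) n n)"
      by (rule filt_mult[OF C w]) (use i in auto)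
  qed
  have Y: "?F ?e (\<lambda>x. walk (?W x) (g+1) n n)"
    by (rule filt_walk_diag[where w = d]) (auto intro: W)
  have "d \<le> ?e" by simp
  then have Va: "?F ?e (\<lambda>x. potential x ?a)" by (rule filt_mono[OF V, rotated]) simp
  have "?F ?e (\<lambda>x. potential x ?b)"
  proof (rule filt_cong[OF filt_minus[OF filt_add[OF filt_add[OF S Y] Va]]])
    fix x assume x: "x \<in> ?X"
    have "walk (potential x) (g+1) n n = walk (?W x) (g+1) n n + potential x ?a + potential x ?b"
      using walk_odd[OF g(2), of "potential x" n] g(1) \<sigma> by (auto simp del: walk.simps)
    then show "- ((\<Sum>i\<in>{1..g+1}. rcoeff x i * walk (potential x) (g+1 - i) n n)
        + walk (?W x) (g+1) n n + potential x ?a) = potential x ?b"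
      using finite_gap_dataD[OF x, of "g+1" n] by (simp del: walk.simps)
  qed
  then show ?thesis ..
qed

text \<open>The centre \<open>m + 1\<close> yields the next site on the right and the centre
  \<open>- m\<close> the next one on the left.\<close>

lemma potential_polynomial:
  assumes g: "g = 2*k" "1 \<le> k"
    and V: "\<And>i. i \<in> {1 - int k..int k} \<Longrightarrow> filt (finite_gap_data g) I y \<rho> 2 (\<lambda>x. potential x i)"
    and C: "\<And>i. i \<in> {1..g+1} \<Longrightarrow> filt (finite_gap_data g) I y \<rho> (2*i-1) (\<lambda>x. rcoeff x i)"
  shows "\<exists>d. \<forall>i\<in>{1 - int k - int m..int k + int m}. filt (finite_gap_data g) I y \<rho> d (\<lambda>x. potential x i)"
proof (induction m)
  case 0
  then show ?case using V by (intro exI[of _ 2]) auto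
next
  case (Suc m)
  then obtain d where d: "\<forall>i\<in>{1 - int k - int m..int k + int m}. filt (finite_gap_data g) I y \<rho> d (\<lambda>x. potential x i)" ..
  have "\<exists>d. filt (finite_gap_data g) I y \<rho> d (\<lambda>x. potential x ((int m + 1) + 1 * int k))"
    by (rule potential_polynomial_step[OF g _ _ C, where d = d])
       (use g(2) in \<open>auto intro!: d[rule_format]\<close>)
  then obtain d1 where d1: "filt (finite_gap_data g) I y \<rho> d1 (\<lambda>x. potential x ((int m + 1) + 1 * int k))" ..
  have "\<exists>d. filt (finite_gap_data g) I y \<rho> d (\<lambda>x. potential x ((- int m) + (-1) * int k))"
    by (rule potential_polynomial_step[OF g _ _ C, where d = d])
       (use g(2) in \<open>auto intro!: d[rule_format]\<close>)
  then obtain d2 where d2: "filt (finite_gap_data g) I y \<rho> d2 (\<lambda>x. potential x ((- int m) + (-1) * int k))" ..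
  show ?case
  proof (intro exI[of _ "d + d1 + d2"] ballI)
    fix i assume "i \<in> {1 - int k - int (Suc m)..int k + int (Suc m)}"
    then consider "i \<in> {1 - int k - int m..int k + int m}" | "i = (int m + 1) + 1 * int k"
      | "i = (- int m) + (-1) * int k" by (auto, linarith)
    then show "filt (finite_gap_data g) I y \<rho> (d + d1 + d2) (\<lambda>x. potential x i)"
    proof cases
      case 1
      show ?thesis by (rule filt_mono[OF d[rule_format, OF 1]]) simp
    next
      case 2
      show ?thesis unfolding 2 by (rule filt_mono[OF d1]) simp
    next
      case 3
      show ?thesis unfolding 3 by (rule filt_mono[OF d2]) simp
    qed
  qed
qed

theorem edges_dependent_even:
  assumes g: "g = 2*k" "1 \<le> k"
  shows "\<exists>q a. (\<exists>\<alpha>\<in>PiE {..<2*g+2} (\<lambda>_. {..<q}). a \<alpha> \<noteq> 0) \<and>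
     (\<forall>x\<in>finite_gap_data g. (\<Sum>\<alpha>\<in>PiE {..<2*g+2} (\<lambda>_. {..<q::nat}).
        a \<alpha> * (\<Prod>k<2*g+2. (scale x * edge x k) ^ \<alpha> k)) = 0)"
proof -
  let ?X = "finite_gap_data g"
  \<comment> \<open>These \<open>2 * k\<close> sites serve both centres: 0 with outer site
    \<open>k\<close> and 1 with outer site \<open>1 - k\<close>. Coefficients go up to
    \<open>g + 2\<close> because the relation of that degree is used; after removing two potentials,
    \<open>1 + 2 * k + (g + 2) - 2 = 2*g+1\<close> quantities remain.\<close>
  define I where "I = {Scale} \<union> Potential ` {1 - int k..int k} \<union> Coeff ` {1..g+2}"
  define R where "R = {Potential 0, Potential 1}"
  define \<rho> where "\<rho> i = (case i of Potential _ \<Rightarrow> 2 | Coeff j \<Rightarrow> 2 * j - 1 | _ \<Rightarrow> 1)" for i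
  let ?F = "filt ?X I coord_val \<rho>"
  have V: "?F 2 (\<lambda>x. potential x n)" if "n \<in> {1 - int k..int k}" for n
  proof -
    have "Potential n \<in> I" unfolding I_def using that by (auto intro!: imageI)
    then show ?thesis using filt_gen[of "Potential n" I \<rho> 2 ?X coord_val] by (simp add: \<rho>_def coord_val_eta)
  qed
  have C: "?F (2*i-1) (\<lambda>x. rcoeff x i)" if "i \<in> {1..g+2}" for i
  proof -
    have "Coeff i \<in> I" unfolding I_def using that by (auto intro!: imageI)
    then show ?thesis using filt_gen[of "Coeff i" I \<rho> "2*i-1" ?X coord_val] by (simp add: \<rho>_def coord_val_eta)
  qed
  have red0: "?F (4*g+3) (\<lambda>x. potential x 0 ^ (2*g+2))"
    by (rule potential_power_even[where \<sigma> = 1, OF g _ V C]) (use g in auto)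
  have red1: "?F (4*g+3) (\<lambda>x. potential x 1 ^ (2*g+2))"
    by (rule potential_power_even[where \<sigma> = "-1", OF g _ V C]) (use g in auto)
  obtain d where d: "\<forall>i\<in>{1 - int k - int g..int k + int g}. ?F d (\<lambda>x. potential x i)"
    using potential_polynomial[OF g V C, of g] by auto
  show ?thesis
  proof (rule edges_dependent_aux)
    show "filtered_reduction ?X I coord_val \<rho> R (\<lambda>_. 2*g+2)"
    proof
      show "finite I" by (simp add: I_def)
      show "0 < \<rho> i" if "i \<in> I" for i using that by (auto simp: I_def \<rho>_def)
      show "R \<subseteq> I" using g by (auto simp: I_def R_def)
      show "?F ((2*g+2) * \<rho> i - 1) (\<lambda>x. coord_val i x ^ (2*g+2))" if iR: "i \<in> R" for i
      proof -
        have "(2*g+2) * \<rho> i - 1 = 4*g+3" using iR by (auto simp: R_def \<rho>_def)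
        moreover have "i = Potential 0 \<or> i = Potential 1" using iR by (auto simp: R_def)
        ultimately show ?thesis using red0 red1 by (auto simp del: power_Suc)
      qed
    qed auto
    have "R \<subseteq> I" using g by (auto simp: I_def R_def)
    then have "card (I - R) = card I - card R" by (intro card_Diff_subset) (auto simp: R_def)
    also have "card R = 2" by (simp add: R_def)
    also have "card I \<le> 1 + card {1 - int k..int k} + card {1..g+2}" unfolding I_def
      by (intro card_Un_le[THEN order_trans] add_mono card_image_le) auto
    then have "card I - 2 \<le> 2*g+1" using g by auto
    finally show "card (I - R) \<le> 2*g+1" .
    show "Scale \<in> I" by (simp add: I_def)
    show "Edge i \<notin> I" for i by (auto simp: I_def)
    fix j assume "j \<le> 2*g+2"
    show "\<exists>d. ?F d (\<lambda>x. rcoeff x j)"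
    proof (rule coeff_polynomial)
      fix i assume i: "i \<le> g + 1"
      show "\<exists>d. ?F d (\<lambda>x. rcoeff x i)"
      proof (cases "i = 0")
        case True
        have "?F 0 (\<lambda>x. rcoeff x i)"
          by (rule filt_cong[OF filt_const[of _ _ _ _ _ 1]]) (simp add: finite_gap_data_def True)
        then show ?thesis ..
      next
        case False
        then show ?thesis using C[of i] i by (intro exI) auto
      qed
    next
      fix n :: int assume "\<bar>n\<bar> \<le> int g"
      then show "\<exists>d. ?F d (\<lambda>x. potential x n)"
        by (intro exI[of _ d] d[rule_format]) (use g in auto)
    qed fact
  qed
qed

theorem edges_dependent:
  assumes "1 \<le> g"
  shows "\<exists>q a. (\<exists>\<alpha>\<in>PiE {..<2*g+2} (\<lambda>_. {..<q}). a \<alpha> \<noteq> 0) \<and>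
     (\<forall>x\<in>finite_gap_data g. (\<Sum>\<alpha>\<in>PiE {..<2*g+2} (\<lambda>_. {..<q::nat}).
        a \<alpha> * (\<Prod>k<2*g+2. (scale x * edge x k) ^ \<alpha> k)) = 0)"
proof (cases "even g")
  case True
  then obtain k where k: "g = 2 * k" by (elim evenE)
  then have "1 \<le> k" using assms by simp
  from edges_dependent_even[OF k this] show ?thesis .
next
  case False
  then obtain k where "g = 2 * k + 1" by (elim oddE)
  from edges_dependent_odd[OF this] show ?thesis .
qed

section \<open>A maximum principle with almost everywhere boundary values\<close>

lemma open_upper: "open {z. 0 < Im z}" and convex_upper: "convex {z. 0 < Im z}"
  by (auto intro: open_halfspace_Im_gt simp: convex_halfspace_Im_gt)

text \<open>A Phragmen-Lindelof argument. The Lipschitz bound spreads the boundary bound to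
  \<open>1 + K * Im z\<close>, uniformly on horizontal lines. Dividing by
  \<open>1 - \<i> * \<eta> * (z - \<i> * \<epsilon>)\<close>, of modulus at least 1 above height
  \<epsilon> and growing linearly, controls large arcs; then \<eta> and \<epsilon> tend to
  0.\<close>

lemma norm_le_one_upper_Lipschitz:
  assumes hol: "F holomorphic_on {z. 0 < Im z}"
    and bd: "\<And>z. 0 < Im z \<Longrightarrow> cmod (F z) \<le> M"
    and lip: "\<And>z w. 0 < Im z \<Longrightarrow> 0 < Im w \<Longrightarrow> cmod (F z - F w) \<le> K * cmod (z - w)"
    and bdry: "\<And>x e. 0 < e \<Longrightarrow> \<exists>\<epsilon>. 0 < \<epsilon> \<and> \<epsilon> < e \<and> cmod (F (Complex x \<epsilon>)) \<le> 1 + e"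
    and z0: "0 < Im z0"
  shows "cmod (F z0) \<le> 1"
proof -
  have K: "0 \<le> K"
  proof -
    have "cmod (\<i> - 2 * \<i>) = 1" by (simp add: cmod_def)
    then have "cmod (F \<i> - F (2 * \<i>)) \<le> K" using lip[of \<i> "2 * \<i>"] by simp
    then show ?thesis using norm_ge_zero order_trans by blast
  qed
  have M: "0 \<le> M" using bd[OF z0] norm_ge_zero order_trans by blast
  have line: "cmod (F z) \<le> 1 + K * Im z" if "0 < Im z" for z
  proof (rule field_le_epsilon)
    fix e :: real assume "0 < e"
    then have "0 < min e (Im z)" using that by simp
    from bdry[OF this, of "Re z"] obtain \<epsilon> where
      \<epsilon>: "0 < \<epsilon>" "\<epsilon> < e" "\<epsilon> < Im z" "cmod (F (Complex (Re z) \<epsilon>)) \<le> 1 + min e (Im z)" by auto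
    have "cmod (F z) \<le> cmod (F (Complex (Re z) \<epsilon>)) + cmod (F z - F (Complex (Re z) \<epsilon>))"
      by (metis norm_triangle_sub)
    also have "cmod (F z - F (Complex (Re z) \<epsilon>)) \<le> K * cmod (z - Complex (Re z) \<epsilon>)"
      using lip that \<epsilon> by simp
    also have "cmod (z - Complex (Re z) \<epsilon>) = Im z - \<epsilon>" using \<epsilon> by (simp add: cmod_def)
    also have "K * (Im z - \<epsilon>) \<le> K * Im z" using K \<epsilon> by (intro mult_left_mono) auto
    finally show "cmod (F z) \<le> 1 + K * Im z + e" using \<epsilon> by linarith
  qed
  have main: "cmod (F z0) \<le> (1 + K * \<epsilon>) * cmod (1 - \<i> * of_real \<eta> * (z0 - \<i> * of_real \<epsilon>))"
    if \<epsilon>: "0 < \<epsilon>" "\<epsilon> < Im z0" and \<eta>: "0 < \<eta>" for \<epsilon> \<eta>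
  proof -
    define c where "c = \<i> * of_real \<epsilon>"
    define D where "D z = 1 - \<i> * of_real \<eta> * (z - c)" for z
    \<comment> \<open>Large enough that \<open>M \<le> \<eta> * r\<close>, which bounds the quotient
      by 1 on the arc, and that \<open>z0\<close> lies inside.\<close>
    define r where "r = max (M / \<eta>) (cmod (z0 - c)) + 1"
    define S where "S = {z. \<epsilon> < Im z} \<inter> ball c r"
    have D: "(cmod (D z))\<^sup>2 = (1 + \<eta> * (Im z - \<epsilon>))\<^sup>2 + (\<eta> * Re z)\<^sup>2" for z
      unfolding cmod_power2 by (simp add: D_def c_def)
    have D1: "1 \<le> cmod (D z)" if "\<epsilon> \<le> Im z" for z
    proof -
      have "1\<^sup>2 \<le> (cmod (D z))\<^sup>2" unfolding D using that \<eta>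
        by (intro add_increasing2 power_mono) auto
      then show ?thesis by (rule power2_le_imp_le) simp
    qed
    have D2: "\<eta> * cmod (z - c) \<le> cmod (D z)" if "\<epsilon> \<le> Im z" for z
    proof (rule power2_le_imp_le)
      have "(\<eta> * cmod (z - c))\<^sup>2 = (\<eta> * (Im z - \<epsilon>))\<^sup>2 + (\<eta> * Re z)\<^sup>2"
        by (simp add: power_mult_distrib cmod_power2 c_def distrib_left)
      also have "\<dots> \<le> (cmod (D z))\<^sup>2" unfolding D using that \<eta>
        by (intro add_mono power_mono order_refl) auto
      finally show "(\<eta> * cmod (z - c))\<^sup>2 \<le> (cmod (D z))\<^sup>2" .
    qed simp
    have op: "open S" unfolding S_def by (intro open_Int open_halfspace_Im_gt) simp
    have "closure S \<subseteq> closure {z. \<epsilon> < Im z} \<inter> closure (ball c r)"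
      unfolding S_def by (intro Int_greatest closure_mono) auto
    also have "closure {z. \<epsilon> < Im z} \<subseteq> {z. \<epsilon> \<le> Im z}"
      by (rule closure_minimal) (auto intro: closed_halfspace_Im_ge)
    also have "closure (ball c r) \<subseteq> cball c r" by (rule closure_minimal) auto
    finally have cl: "closure S \<subseteq> {z. \<epsilon> \<le> Im z} \<inter> cball c r" by blast
    have D0: "D z \<noteq> 0" if "\<epsilon> \<le> Im z" for z using D1[OF that] by auto
    have sub: "{z. \<epsilon> \<le> Im z} \<inter> cball c r \<subseteq> {z. 0 < Im z}" using \<epsilon> by auto
    have hol': "(\<lambda>z. F z / D z) holomorphic_on T" if "T \<subseteq> {z. \<epsilon> \<le> Im z} \<inter> cball c r" for T
      using that sub D0 unfolding D_def
      by (intro holomorphic_intros holomorphic_on_subset[OF hol]) auto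
    have "cmod (F z0 / D z0) \<le> 1 + K * \<epsilon>"
    proof (rule maximum_modulus_frontier[where f = "\<lambda>z. F z / D z"])
      show "(\<lambda>z. F z / D z) holomorphic_on interior S"
        by (rule hol'[OF order_trans[OF interior_subset order_trans[OF closure_subset cl]]])
      show "continuous_on (closure S) (\<lambda>z. F z / D z)"
        by (rule holomorphic_on_imp_continuous_on[OF hol'[OF cl]])
      show "bounded S" unfolding S_def by (rule bounded_subset[OF bounded_ball]) auto
      show "z0 \<in> S" using \<epsilon> by (auto simp: S_def r_def dist_norm norm_minus_commute)
      fix z assume "z \<in> frontier S"
      then have z: "z \<in> closure S" "z \<notin> S" using op by (auto simp: frontier_def interior_open)
      then have zc: "\<epsilon> \<le> Im z" "cmod (z - c) \<le> r" using cl by (auto simp: dist_norm norm_minus_commute)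
      have zp: "0 < Im z" using zc \<epsilon> by simp
      show "cmod (F z / D z) \<le> 1 + K * \<epsilon>"
      proof (cases "Im z = \<epsilon>")
        case True
        have "cmod (F z) \<le> 1 + K * \<epsilon>" using line[OF zp] True by simp
        also have "\<dots> \<le> (1 + K * \<epsilon>) * cmod (D z)"
          using mult_left_mono[OF D1[OF zc(1)], of "1 + K * \<epsilon>"] K \<epsilon> by simp
        finally show ?thesis using D0[OF zc(1)] by (simp add: norm_divide divide_le_eq)
      next
        case False
        then have "cmod (z - c) = r" using z zc by (auto simp: S_def dist_norm norm_minus_commute)
        then have "\<eta> * r \<le> cmod (D z)" using D2[OF zc(1)] by simp
        moreover have "M \<le> \<eta> * r"
        proof -
          have "M / \<eta> \<le> r" by (simp add: r_def)
          then show ?thesis using \<eta> by (simp add: divide_le_eq mult.commute)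
        qed
        ultimately have "cmod (F z) \<le> cmod (D z)" using bd[OF zp] by linarith
        then have "cmod (F z / D z) \<le> 1" using D0[OF zc(1)] by (simp add: norm_divide divide_le_eq)
        then show ?thesis using mult_nonneg_nonneg[OF K, of \<epsilon>] \<epsilon> by linarith
      qed
    qed
    then show ?thesis using D0[of z0] \<epsilon>
      by (simp add: norm_divide divide_le_eq D_def c_def)
  qed
  have main2: "cmod (F z0) \<le> 1 + K * \<epsilon>" if \<epsilon>: "0 < \<epsilon>" "\<epsilon> < Im z0" for \<epsilon>
  proof (rule tendsto_lowerbound)
    show "((\<lambda>\<eta>. (1 + K * \<epsilon>) * cmod (1 - \<i> * of_real \<eta> * (z0 - \<i> * of_real \<epsilon>))) \<longlongrightarrow> 1 + K * \<epsilon>) (at_right 0)"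
      by (rule tendsto_eq_intros refl | simp)+
    show "\<forall>\<^sub>F \<eta> in at_right 0. cmod (F z0) \<le> (1 + K * \<epsilon>) * cmod (1 - \<i> * of_real \<eta> * (z0 - \<i> * of_real \<epsilon>))"
      using eventually_at_right_less by eventually_elim (rule main[OF \<epsilon>])
  qed simp
  show ?thesis
  proof (rule tendsto_lowerbound)
    show "((\<lambda>\<epsilon>. 1 + K * \<epsilon>) \<longlongrightarrow> 1) (at_right 0)"
      by (rule tendsto_eq_intros refl | simp)+
    have "\<forall>\<^sub>F \<epsilon> in at_right 0. 0 < \<epsilon> \<and> \<epsilon> < Im z0"
      using z0 by (auto simp: eventually_at_right_field)
    then show "\<forall>\<^sub>F \<epsilon> in at_right 0. cmod (F z0) \<le> 1 + K * \<epsilon>"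
      by eventually_elim (use main2 in auto)
  qed simp
qed

text \<open>Averaging \<open>F\<close> over horizontal segments of length \<open>\<delta>\<close> yields a Lipschitz function, whose boundary values are
  at most \<open>1\<close> everywhere by dominated convergence; then \<open>\<delta> \<rightarrow> 0\<close>.\<close>

theorem norm_le_one_upper_AE:
  assumes hol: "F holomorphic_on {z. 0 < Im z}"
    and bd: "\<And>z. 0 < Im z \<Longrightarrow> cmod (F z) \<le> M"
    and ae: "AE x in lebesgue. ((\<lambda>\<epsilon>. max 1 (cmod (F (Complex x \<epsilon>)))) \<longlongrightarrow> 1) (at_right 0)"
    and z0: "0 < Im z0"
  shows "cmod (F z0) \<le> 1"
proof -
  let ?H = "{z. 0 < Im z}"
  obtain P where P0: "\<And>z. z \<in> ?H \<Longrightarrow> (P has_field_derivative F z) (at z within ?H)"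
    using holomorphic_convex_primitive'[OF convex_upper open_upper hol] by blast
  then have P: "(P has_field_derivative F z) (at z)" if "0 < Im z" for z
    using that at_within_open[OF _ open_upper] by force
  have M: "0 \<le> M" using bd[OF z0] norm_ge_zero order_trans by blast
  have Plip: "cmod (P z - P w) \<le> M * cmod (z - w)" if "0 < Im z" "0 < Im w" for z w
    by (rule field_differentiable_bound[OF convex_upper P0]) (use bd that in auto)
  \<comment> \<open>The horizontal average, written as a difference quotient of a primitive; the
    bound on \<open>F\<close> makes \<open>P\<close> Lipschitz and hence \<open>A\<close> bounded by
    \<open>M\<close>.\<close>
  define A where "A \<delta> z = (P (z + of_real \<delta>) - P z) / of_real \<delta>" for \<delta> :: real and z
  have cont: "continuous_on ?H F" by (rule holomorphic_on_imp_continuous_on[OF hol])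
  have A_le: "cmod (A \<delta> z0) \<le> 1" if \<delta>: "0 < \<delta>" for \<delta>
  proof (rule norm_le_one_upper_Lipschitz[OF _ _ _ _ z0])
    have dA: "(A \<delta> has_field_derivative (F (z + of_real \<delta>) - F z) / of_real \<delta>) (at z)" if "0 < Im z" for z
      unfolding A_def using that \<delta>
      by (auto intro!: derivative_eq_intros P DERIV_chain2[OF P])
    show "A \<delta> holomorphic_on ?H"
      unfolding holomorphic_on_def field_differentiable_def
      using dA has_field_derivative_at_within by blast
    show "cmod (A \<delta> z) \<le> M" if "0 < Im z" for z
    proof -
      have "cmod (P (z + of_real \<delta>) - P z) \<le> M * \<delta>"
        using Plip[of "z + of_real \<delta>" z] that \<delta> by simp
      then show ?thesis using \<delta> by (simp add: A_def norm_divide divide_le_eq)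
    qed
    show "cmod (A \<delta> z - A \<delta> w) \<le> (2 * M / \<delta>) * cmod (z - w)" if "0 < Im z" "0 < Im w" for z w
    proof (rule field_differentiable_bound[OF convex_upper])
      show "(A \<delta> has_field_derivative (F (u + of_real \<delta>) - F u) / of_real \<delta>) (at u within ?H)" if "u \<in> ?H" for u
        using dA that has_field_derivative_at_within by blast
      show "cmod ((F (u + of_real \<delta>) - F u) / of_real \<delta>) \<le> 2 * M / \<delta>" if "u \<in> ?H" for u
      proof -
        have "cmod (F (u + of_real \<delta>) - F u) \<le> M + M"
          using that by (intro norm_triangle_le_diff add_mono bd) auto
        then show ?thesis using \<delta> by (simp add: norm_divide divide_right_mono)
      qed
    qed (use that in auto)
    fix x e :: real assume e: "0 < e"
    define b where "b = x + \<delta>"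
    have xb: "x < b" using \<delta> by (simp add: b_def)
    \<comment> \<open>The hypothesis is in effect a bound on the upper limit of the modulus; the
      maximum with 1 turns it into the convergence that dominated convergence asks for.\<close>
    let ?f = "\<lambda>n t. max 1 (cmod (F (Complex t (1 / real (Suc n)))))"
    have contF: "continuous_on {x..b} (\<lambda>t. F (Complex t \<epsilon>))" if "0 < \<epsilon>" for \<epsilon>
      by (rule continuous_on_compose2[OF cont])
         (auto simp: that Complex_eq intro!: continuous_intros)
    have contf: "continuous_on {x..b} (?f n)" for n
      by (intro continuous_intros contF) simp
    have bound: "cmod (A \<delta> (Complex x (1 / real (Suc n)))) \<le> (LINT t:{x..b}|lborel. ?f n t) / \<delta>" for n
    proof -
      let ?\<epsilon> = "1 / real (Suc n)"
      have "((\<lambda>t. F (Complex t ?\<epsilon>)) has_integral P (Complex b ?\<epsilon>) - P (Complex x ?\<epsilon>)) {x..b}"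
      proof (rule fundamental_theorem_of_calculus)
        fix t assume "t \<in> {x..b}"
        have "((\<lambda>t. Complex t ?\<epsilon>) has_vector_derivative 1) (at t within {x..b})"
          unfolding Complex_eq by (auto intro!: derivative_eq_intros simp: scaleR_conv_of_real)
        from field_vector_diff_chain_within[OF this has_field_derivative_at_within[OF P]]
        show "((\<lambda>t. P (Complex t ?\<epsilon>)) has_vector_derivative F (Complex t ?\<epsilon>)) (at t within {x..b})"
          by (simp add: o_def)
      qed (use xb in simp)
      then have "P (Complex b ?\<epsilon>) - P (Complex x ?\<epsilon>) = integral {x..b} (\<lambda>t. F (Complex t ?\<epsilon>))"
        by (simp add: integral_unique)
      also have "cmod \<dots> \<le> integral {x..b} (?f n)"
        by (rule integral_norm_bound_integral[OF integrable_continuous_real[OF contF] integrable_continuous_real[OF contf]])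
           auto
      also have "\<dots> = (LINT t:{x..b}|lborel. ?f n t)"
        by (rule set_borel_integral_eq_integral(2)[symmetric]) (rule borel_integrable_atLeastAtMost'[OF contf])
      finally show ?thesis using \<delta>
        by (simp add: A_def norm_divide divide_right_mono b_def Complex_eq algebra_simps)
    qed
    have "(\<lambda>n. (LINT t:{x..b}|lborel. ?f n t)) \<longlonglongrightarrow> (LINT t:{x..b}|lborel. 1)"
      unfolding set_lebesgue_integral_def
    proof (rule integral_dominated_convergence)
      show "(\<lambda>t. indicat_real {x..b} t *\<^sub>R ?f n t) \<in> borel_measurable lborel" for n
        using borel_integrable_atLeastAtMost'[OF contf, of n]
        unfolding set_integrable_def by (rule borel_measurable_integrable)
      show "integrable lborel (\<lambda>t. indicat_real {x..b} t *\<^sub>R max 1 M)"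
        using borel_integrable_atLeastAtMost'[of x b "\<lambda>_. max 1 M"] by (simp add: set_integrable_def)
      show "AE t in lborel. norm (indicat_real {x..b} t *\<^sub>R ?f n t) \<le> indicat_real {x..b} t *\<^sub>R max 1 M" for n
      proof (rule AE_I2)
        fix t
        have "cmod (F (Complex t (1 / real (Suc n)))) \<le> M" by (rule bd) simp
        then show "norm (indicat_real {x..b} t *\<^sub>R ?f n t) \<le> indicat_real {x..b} t *\<^sub>R max 1 M"
          by (auto simp: indicator_def)
      qed
      have "AE t in lborel. ((\<lambda>\<epsilon>. max 1 (cmod (F (Complex t \<epsilon>)))) \<longlongrightarrow> 1) (at_right 0)"
        using ae by (simp add: AE_completion_iff)
      then show "AE t in lborel. (\<lambda>n. indicat_real {x..b} t *\<^sub>R ?f n t) \<longlonglongrightarrow> indicat_real {x..b} t *\<^sub>R 1"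
      proof eventually_elim
        case (elim t)
        have "filterlim (\<lambda>n. 1 / real (Suc n)) (at_right 0) sequentially"
          unfolding filterlim_at using LIMSEQ_Suc[OF lim_1_over_n[where 'a = real]] by auto
        from filterlim_compose[OF elim this] show ?case by (intro tendsto_scaleR tendsto_const)
      qed
    qed auto
    moreover have "(LINT t:{x..b}|lborel. (1::real)) = \<delta>"
      using xb by (simp add: set_lebesgue_integral_def b_def)
    ultimately have "(\<lambda>n. (LINT t:{x..b}|lborel. ?f n t) / \<delta>) \<longlonglongrightarrow> \<delta> / \<delta>"
      using \<delta> by (intro tendsto_divide tendsto_const) auto
    then have "(\<lambda>n. (LINT t:{x..b}|lborel. ?f n t) / \<delta>) \<longlonglongrightarrow> 1" using \<delta> by simp
    then have "\<forall>\<^sub>F n in sequentially. (LINT t:{x..b}|lborel. ?f n t) / \<delta> < 1 + e"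
      using e by (intro order_tendstoD(2)) auto
    moreover have "(\<lambda>n. 1 / real (Suc n)) \<longlonglongrightarrow> 0"
      by (intro LIMSEQ_Suc lim_1_over_n)
    then have "\<forall>\<^sub>F n in sequentially. 1 / real (Suc n) < e"
      using e by (intro order_tendstoD(2)) auto
    ultimately have "\<forall>\<^sub>F n in sequentially. (LINT t:{x..b}|lborel. ?f n t) / \<delta> < 1 + e \<and> 1 / real (Suc n) < e"
      by (rule eventually_conj)
    then obtain n where n: "(LINT t:{x..b}|lborel. ?f n t) / \<delta> < 1 + e" "1 / real (Suc n) < e"
      using eventually_happens by force
    then show "\<exists>\<epsilon>. 0 < \<epsilon> \<and> \<epsilon> < e \<and> cmod (A \<delta> (Complex x \<epsilon>)) \<le> 1 + e"
      using bound[of n] by (intro exI[of _ "1 / real (Suc n)"]) auto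
  qed
  have "((\<lambda>h. (P (z0 + h) - P z0) / h) \<longlongrightarrow> F z0) (at 0)"
    using P[OF z0] by (simp add: DERIV_def)
  moreover have "filterlim complex_of_real (at 0) (at_right 0)"
    unfolding filterlim_at by (auto intro!: tendsto_eq_intros eventually_at_right_less simp: eventually_at_right_field intro: exI[of _ 1])
  ultimately have "((\<lambda>\<delta>. A \<delta> z0) \<longlongrightarrow> F z0) (at_right 0)"
    unfolding A_def by (rule filterlim_compose)
  then show ?thesis
  proof (rule Lim_norm_ubound[rotated])
    show "\<forall>\<^sub>F \<delta> in at_right 0. cmod (A \<delta> z0) \<le> 1"
      using eventually_at_right_less by eventually_elim (rule A_le)
  qed simp
qed

section \<open>Reflectionless Herglotz functions\<close>

text \<open>A nonzero real value is rotated onto the imaginary axis, away from the branch cut, so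
  the argument is continuous there.\<close>

lemma Im_Ln_tendsto_real:
  assumes "(f \<longlongrightarrow> complex_of_real c) F" "c \<noteq> 0"
  shows "((\<lambda>x. Im (Ln (- \<i> * f x))) \<longlongrightarrow> - (pi / 2) * sgn c) F"
proof -
  have "((\<lambda>x. - \<i> * f x) \<longlongrightarrow> - \<i> * complex_of_real c) F"
    by (intro tendsto_intros assms)
  then have "((\<lambda>x. Im (Ln (- \<i> * f x))) \<longlongrightarrow> Im (Ln (- \<i> * complex_of_real c))) F"
    by (intro tendsto_Im tendsto_Ln) (use assms(2) in \<open>auto simp: complex_nonpos_Reals_iff\<close>)
  moreover have "Im (Ln (- \<i> * complex_of_real c)) = - (pi / 2) * sgn c"
  proof (cases "c > 0")
    case True
    then show ?thesis using Ln_times_of_real[of c "- \<i>"] by (simp add: mult.commute)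
  next
    case False
    then have "- \<i> * complex_of_real c = of_real (- c) * \<i>" by simp
    then show ?thesis using False assms(2) Ln_times_of_real[of "- c" \<i>] Ln_of_real[of "- c"]
      by (simp add: mult.commute)
  qed
  ultimately show ?thesis by simp
qed

lemma vertical_tendsto: "((\<lambda>\<epsilon>. Complex x \<epsilon>) \<longlongrightarrow> complex_of_real x) (at_right 0)"
  unfolding Complex_eq by (rule tendsto_eq_intros refl | simp)+

text \<open>The properties of a diagonal Green function that the argument uses. The sign in
  \<open>asym\<close> belongs to the resolvent of \<open>H - z\<close>, whose diagonal entries
  behave like \<open>-1 / z\<close>.\<close>

locale herglotz_off =
  fixes E :: "real set" and G :: "complex \<Rightarrow> complex"
  assumes compact_E: "compact E"
    and hol: "G holomorphic_on - (complex_of_real ` E)"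
    and Im_pos: "\<And>z. 0 < Im z \<Longrightarrow> 0 < Im (G z)"
    and real_off: "\<And>x. x \<notin> E \<Longrightarrow> Im (G (of_real x)) = 0"
    and asym: "((\<lambda>z. z * G z) \<longlongrightarrow> -1) at_infinity"
begin

lemma open_off: "open (- (complex_of_real ` E))"
  by (intro open_Compl compact_imp_closed compact_continuous_image continuous_intros compact_E)

lemma upper_off: "{z. 0 < Im z} \<subseteq> - (complex_of_real ` E)"
  by auto

lemma hol_upper: "G holomorphic_on {z. 0 < Im z}"
  by (rule holomorphic_on_subset[OF hol upper_off])

lemma has_deriv:
  assumes "x \<notin> E"
  shows "(G has_field_derivative deriv G (of_real x)) (at (of_real x))"
  using assms by (intro holomorphic_derivI[OF hol open_off]) auto

lemma G_of_real: "x \<notin> E \<Longrightarrow> G (of_real x) = of_real (Re (G (of_real x)))"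
  using real_off by (simp add: complex_eq_iff)

lemma boundary_tendsto:
  assumes "x \<notin> E"
  shows "((\<lambda>\<epsilon>. G (Complex x \<epsilon>)) \<longlongrightarrow> G (of_real x)) (at_right 0)"
proof -
  have "isCont G (of_real x)" using has_deriv[OF assms] DERIV_isCont by blast
  from isCont_tendsto_compose[OF this vertical_tendsto] show ?thesis .
qed

text \<open>The derivative may be computed along the vertical direction, where \<open>G\<close>
  gains positive imaginary part from a real value; dividing by \<open>\<i> * \<epsilon>\<close>
  makes the real part of the quotient positive.\<close>

lemma real_deriv:
  assumes "x \<notin> E"
  shows "\<exists>y. ((\<lambda>x. Re (G (of_real x))) has_real_derivative y) (at x) \<and> 0 \<le> y"
proof (intro exI conjI)
  let ?D = "deriv G (of_real x)"
  have "((\<lambda>x. G (of_real x)) has_vector_derivative ?D) (at x)"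
    by (rule has_vector_derivative_real_field[OF has_deriv[OF assms]])
  then show "((\<lambda>x. Re (G (of_real x))) has_real_derivative Re ?D) (at x)"
    unfolding has_real_derivative_iff_has_vector_derivative
    by (rule bounded_linear.has_vector_derivative[OF bounded_linear_Re])
  have "((\<lambda>h. (G (of_real x + h) - G (of_real x)) / h) \<longlongrightarrow> ?D) (at 0)"
    using has_deriv[OF assms] by (simp add: DERIV_def)
  moreover have "filterlim (\<lambda>\<epsilon>. \<i> * complex_of_real \<epsilon>) (at 0) (at_right 0)"
    unfolding filterlim_at
    by (auto intro!: tendsto_eq_intros simp: eventually_at_right_field intro: exI[of _ 1])
  ultimately have "((\<lambda>\<epsilon>. (G (of_real x + \<i> * of_real \<epsilon>) - G (of_real x)) / (\<i> * of_real \<epsilon>)) \<longlongrightarrow> ?D) (at_right 0)"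
    by (rule filterlim_compose)
  then have "((\<lambda>\<epsilon>. Re ((G (of_real x + \<i> * of_real \<epsilon>) - G (of_real x)) / (\<i> * of_real \<epsilon>))) \<longlongrightarrow> Re ?D) (at_right 0)"
    by (rule tendsto_Re)
  then show "0 \<le> Re ?D"
  proof (rule tendsto_lowerbound)
    show "\<forall>\<^sub>F \<epsilon> in at_right 0. 0 \<le> Re ((G (of_real x + \<i> * of_real \<epsilon>) - G (of_real x)) / (\<i> * of_real \<epsilon>))"
      using eventually_at_right_less
    proof eventually_elim
      case (elim \<epsilon>)
      define w where "w = G (of_real x + \<i> * of_real \<epsilon>) - G (of_real x)"
      have "0 < Im w" unfolding w_def using Im_pos[of "of_real x + \<i> * of_real \<epsilon>"] real_off[OF assms] elim by simp
      moreover have "w / (\<i> * of_real \<epsilon>) = (- \<i> * w) / of_real \<epsilon>" using elim by (simp add: field_simps)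
      ultimately have "0 \<le> Re (w / (\<i> * of_real \<epsilon>))" using elim by simp
      then show ?case by (simp add: w_def)
    qed
  qed simp
qed

lemma nondecreasing:
  assumes "{a..b} \<inter> E = {}" "a \<le> b"
  shows "Re (G (of_real a)) \<le> Re (G (of_real b))"
proof (rule DERIV_nonneg_imp_nondecreasing[OF assms(2)])
  fix x assume "a \<le> x" "x \<le> b"
  then have "x \<notin> E" using assms(1) by (auto simp: disjoint_iff)
  then show "\<exists>y. ((\<lambda>x. Re (G (of_real x))) has_real_derivative y) (at x) \<and> 0 \<le> y"
    by (rule real_deriv)
qed

text \<open>By the identity theorem \<open>G\<close> would vanish on a disc around a point of the
  interval, which meets the upper half plane.\<close>

lemma not_zero_interval:
  assumes ab: "a < b" "{a..b} \<inter> E = {}" and z: "\<And>x. a \<le> x \<Longrightarrow> x \<le> b \<Longrightarrow> Re (G (of_real x)) = 0"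
  shows False
proof -
  define c where "c = (a + b) / 2"
  have c: "a < c" "c < b" using ab by (auto simp: c_def)
  then have "c \<notin> E" using ab(2) by (auto simp: disjoint_iff)
  then have "complex_of_real c \<in> - (complex_of_real ` E)" by auto
  then obtain r where r: "0 < r" "ball (complex_of_real c) r \<subseteq> - (complex_of_real ` E)"
    using open_off openE by blast
  let ?B = "ball (complex_of_real c) r"
  define w where "w = complex_of_real c + \<i> * of_real (r / 2)"
  have lim: "complex_of_real c islimpt (complex_of_real ` {a<..<b} \<inter> ?B)"
  proof -
    have "c islimpt {a<..<b}" using c by (intro open_imp_islimpt) auto
    then have "complex_of_real c islimpt (complex_of_real ` {a<..<b})"
      unfolding islimpt_approachable
    proof (intro allI impI)
      fix d :: real assume d: "0 < d" "\<forall>d>0. \<exists>x'\<in>{a<..<b}. x' \<noteq> c \<and> dist x' c < d"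
      then obtain x where "x \<in> {a<..<b}" "x \<noteq> c" "dist x c < d" by blast
      then show "\<exists>x'\<in>complex_of_real ` {a<..<b}. x' \<noteq> complex_of_real c \<and> dist x' (complex_of_real c) < d"
        by (intro bexI[of _ "complex_of_real x"]) (auto simp: dist_norm norm_of_real simp flip: of_real_diff)
    qed
    then show ?thesis using r by (intro islimpt_Int_eventually eventually_at_in_open') auto
  qed
  have "G w = 0"
  proof (rule analytic_continuation[of G ?B, OF holomorphic_on_subset[OF hol r(2)] _ _ _ _ lim])
    show "w \<in> ?B" using r by (simp add: w_def dist_norm norm_mult)
    fix z assume "z \<in> complex_of_real ` {a<..<b} \<inter> ?B"
    then obtain x where x: "z = of_real x" "a < x" "x < b" by auto
    then have "x \<notin> E" using ab(2) by (auto simp: disjoint_iff)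
    then show "G z = 0" using x z[of x] G_of_real[of x] by simp
  qed (use r in auto)
  then show False using Im_pos[of w] r by (simp add: w_def)
qed

lemma sign_change:
  assumes "a < b" and gap: "{a<..<b} \<inter> E = {}"
  shows "\<exists>\<mu>. a \<le> \<mu> \<and> \<mu> \<le> b \<and> (\<forall>x. a < x \<and> x < b \<and> x \<noteq> \<mu> \<longrightarrow> sgn (Re (G (of_real x))) = sgn (x - \<mu>))"
proof -
  let ?f = "\<lambda>x. Re (G (of_real x))"
  \<comment> \<open>Inserting \<open>a\<close> keeps the supremum meaningful when no negative value
    occurs; the zero then sits at the left end of the gap.\<close>
  define S where "S = insert a {x. a < x \<and> x < b \<and> ?f x < 0}"
  define \<mu> where "\<mu> = Sup S"
  have bdd: "bdd_above S" by (rule bdd_aboveI[of _ b]) (use assms in \<open>auto simp: S_def\<close>)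
  have mono: "?f x \<le> ?f y" if "a < x" "x \<le> y" "y < b" for x y
    by (rule nondecreasing) (use that gap in \<open>auto simp: disjoint_iff\<close>)
  have "a \<le> \<mu>" unfolding \<mu>_def by (rule cSup_upper[OF _ bdd]) (simp add: S_def)
  moreover have "\<mu> \<le> b" unfolding \<mu>_def by (rule cSup_least) (use assms in \<open>auto simp: S_def\<close>)
  moreover have "sgn (?f x) = sgn (x - \<mu>)" if x: "a < x" "x < b" "x \<noteq> \<mu>" for x
  proof (cases "x < \<mu>")
    case True
    then obtain y where "y \<in> S" "x < y" unfolding \<mu>_def using less_cSup_iff[OF _ bdd] by (auto simp: S_def)
    then have "?f x < 0" using mono[of x y] x by (auto simp: S_def)
    then show ?thesis using True by simp
  next
    case False
    then have gt: "\<mu> < x" using x by simp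
    have nn: "0 \<le> ?f y" if "\<mu> < y" "y < b" for y
    proof (rule ccontr)
      assume "\<not> 0 \<le> ?f y"
      then have "y \<in> S" using that \<open>a \<le> \<mu>\<close> by (simp add: S_def)
      then have "y \<le> \<mu>" unfolding \<mu>_def by (rule cSup_upper[OF _ bdd])
      then show False using that by simp
    qed
    have "?f x \<noteq> 0"
    proof
      assume z: "?f x = 0"
      define p where "p = (\<mu> + x) / 2"
      have p: "\<mu> < p" "p < x" using gt by (auto simp: p_def)
      show False
      proof (rule not_zero_interval[OF p(2)])
        show "{p..x} \<inter> E = {}" using gap p x \<open>a \<le> \<mu>\<close> by (auto simp: disjoint_iff)
        fix t assume "p \<le> t" "t \<le> x"
        then show "?f t = 0" using nn[of t] mono[of t x] z p x \<open>a \<le> \<mu>\<close> by auto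
      qed
    qed
    then show ?thesis using nn[OF gt x(2)] gt by simp
  qed
  ultimately show ?thesis by blast
qed

lemma asym_real:
  assumes "filterlim f at_infinity F"
  shows "((\<lambda>x. f x * Re (G (of_real (f x)))) \<longlongrightarrow> -1) F"
proof -
  have "filterlim (\<lambda>x. complex_of_real (f x)) at_infinity F"
    using assms by (simp add: filterlim_at_infinity_conv_norm_at_top)
  from tendsto_Re[OF filterlim_compose[OF asym this]] show ?thesis by simp
qed

text \<open>Far to the left the sign is that of \<open>-1 / x\<close>, and \<open>G\<close> is
  nondecreasing up to \<open>x\<close>.\<close>

lemma sign_left:
  assumes "\<And>y. y \<in> E \<Longrightarrow> x < y"
  shows "0 < Re (G (of_real x))"
proof -
  have "((\<lambda>x. x * Re (G (of_real x))) \<longlongrightarrow> -1) at_bot"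
    by (rule asym_real) (rule filterlim_at_bot_imp_at_infinity[OF filterlim_ident])
  then have "\<forall>\<^sub>F t in at_bot. t * Re (G (of_real t)) < 0" by (rule order_tendstoD) simp
  moreover have "\<forall>\<^sub>F t in at_bot. t < min x 0" by (rule eventually_gt_at_bot)
  ultimately have "\<forall>\<^sub>F t in at_bot. t * Re (G (of_real t)) < 0 \<and> t < min x 0" by (rule eventually_conj)
  then obtain t where t: "t * Re (G (of_real t)) < 0" "t < min x 0"
    using eventually_happens by force
  have "Re (G (of_real t)) \<le> Re (G (of_real x))"
    by (rule nondecreasing) (use assms t in \<open>fastforce simp: disjoint_iff\<close>)+
  moreover have "0 < Re (G (of_real t))" using t by (auto simp: mult_less_0_iff)
  ultimately show ?thesis by linarith
qed

lemma sign_right: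
  assumes "\<And>y. y \<in> E \<Longrightarrow> y < x"
  shows "Re (G (of_real x)) < 0"
proof -
  have "((\<lambda>x. x * Re (G (of_real x))) \<longlongrightarrow> -1) at_top"
    by (rule asym_real) (rule filterlim_at_top_imp_at_infinity[OF filterlim_ident])
  then have "\<forall>\<^sub>F t in at_top. t * Re (G (of_real t)) < 0" by (rule order_tendstoD) simp
  moreover have "\<forall>\<^sub>F t in at_top. max x 0 < t" by (rule eventually_gt_at_top)
  ultimately have "\<forall>\<^sub>F t in at_top. t * Re (G (of_real t)) < 0 \<and> max x 0 < t" by (rule eventually_conj)
  then obtain t where t: "t * Re (G (of_real t)) < 0" "max x 0 < t"
    using eventually_happens by force
  have "Re (G (of_real x)) \<le> Re (G (of_real t))"
    by (rule nondecreasing) (use assms t in \<open>fastforce simp: disjoint_iff\<close>)+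
  moreover have "Re (G (of_real t)) < 0" using t by (auto simp: mult_less_0_iff)
  ultimately show ?thesis by linarith
qed

end

section \<open>Edges, bands and gaps\<close>

locale finite_gap_set =
  fixes g :: nat and e :: "nat \<Rightarrow> real"
  assumes e_step: "\<And>k. k < 2*g+1 \<Longrightarrow> e k < e (Suc k)"
begin

definition bands :: "real set" where
  "bands = (\<Union>i\<le>g. {e (2*i)..e (2*i+1)})"

lemma e_mono: "i < j \<Longrightarrow> j \<le> 2*g+1 \<Longrightarrow> e i < e j"
proof (induction j)
  case (Suc j)
  then have "e j < e (Suc j)" by (intro e_step) auto
  then show ?case using Suc by (cases "i = j") auto
qed auto

lemma e_mono_le: "i \<le> j \<Longrightarrow> j \<le> 2*g+1 \<Longrightarrow> e i \<le> e j"
  using e_mono[of i j] by (cases "i = j") auto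

lemma compact_bands: "compact bands"
  unfolding bands_def by (intro compact_UN) auto

lemma locate:
  assumes "e 0 < x" "x < e (2*g+1)" "\<And>k. k \<le> 2*g+1 \<Longrightarrow> x \<noteq> e k"
  obtains k where "k < 2*g+1" "e k < x" "x < e (Suc k)"
proof -
  define k where "k = (GREATEST k. k \<le> 2*g+1 \<and> e k < x)"
  have P: "k \<le> 2*g+1 \<and> e k < x"
    unfolding k_def by (rule GreatestI_nat[where k = 0 and b = "2*g+1"]) (use assms in auto)
  then have k: "k < 2*g+1" using assms(2) by (cases "k = 2*g+1") auto
  have "\<not> e (Suc k) < x"
  proof
    assume "e (Suc k) < x"
    then have "Suc k \<le> k" unfolding k_def[symmetric]
      using Greatest_le_nat[where P = "\<lambda>k. k \<le> 2*g+1 \<and> e k < x" and k = "Suc k" and b = "2*g+1"] k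
      by (simp add: k_def)
    then show False by simp
  qed
  moreover have "x \<noteq> e (Suc k)" using assms(3) k by simp
  ultimately show thesis using that[of k] P k by simp
qed

lemma gap_disjoint:
  assumes "i < g" shows "{e (2*i+1)<..<e (2*i+2)} \<inter> bands = {}"
proof -
  have False if "x \<in> bands" "e (2*i+1) < x" "x < e (2*i+2)" for x
  proof -
    from that(1) obtain j where j: "j \<le> g" "e (2*j) \<le> x" "x \<le> e (2*j+1)" by (auto simp: bands_def)
    show False
    proof (cases "j \<le> i")
      case True
      then have "e (2*j+1) \<le> e (2*i+1)" using assms by (intro e_mono_le) auto
      then show False using j that by simp
    next
      case False
      then have "e (2*i+2) \<le> e (2*j)" using j by (intro e_mono_le) auto
      then show False using j that by simp
    qed
  qed
  then show ?thesis by (auto simp: disjoint_iff)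
qed

lemma bands_ge: "y \<in> bands \<Longrightarrow> e 0 \<le> y"
  and bands_le: "y \<in> bands \<Longrightarrow> y \<le> e (2*g+1)"
proof -
  assume "y \<in> bands"
  then obtain j where j: "j \<le> g" "e (2*j) \<le> y" "y \<le> e (2*j+1)" by (auto simp: bands_def)
  show "e 0 \<le> y" using e_mono_le[of 0 "2*j"] j by simp
  show "y \<le> e (2*g+1)" using e_mono_le[of "2*j+1" "2*g+1"] j by simp
qed

lemma sum_edges:
  fixes h :: "nat \<Rightarrow> real"
  shows "(\<Sum>k<2*m+2. h k) = h 0 + h (2*m+1) + (\<Sum>i<m. h (2*i+1) + h (2*i+2))"
  by (induction m) (auto simp: algebra_simps numeral_2_eq_2)

end

section \<open>Closed form of a reflectionless Herglotz function\<close>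

locale reflectionless_herglotz = finite_gap_set g e + herglotz_off "finite_gap_set.bands g e" G
  for g e G +
  assumes reflectionless: "AE x in lebesgue. x \<in> bands \<longrightarrow>
     (\<exists>r. ((\<lambda>\<epsilon>. G (Complex x \<epsilon>)) \<longlongrightarrow> r) (at_right 0) \<and> Re r = 0)"
begin

lemma gap_zeros_exist:
  "\<exists>\<mu>. \<forall>i<g. e (2*i+1) \<le> \<mu> i \<and> \<mu> i \<le> e (2*i+2) \<and>
     (\<forall>x. e (2*i+1) < x \<and> x < e (2*i+2) \<and> x \<noteq> \<mu> i \<longrightarrow> sgn (Re (G (of_real x))) = sgn (x - \<mu> i))"
proof -
  have "\<forall>i\<in>{..<g}. \<exists>\<mu>. e (2*i+1) \<le> \<mu> \<and> \<mu> \<le> e (2*i+2) \<and>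
     (\<forall>x. e (2*i+1) < x \<and> x < e (2*i+2) \<and> x \<noteq> \<mu> \<longrightarrow> sgn (Re (G (of_real x))) = sgn (x - \<mu>))"
    by (intro ballI sign_change gap_disjoint) (auto intro: e_mono)
  from bchoice[OF this] show ?thesis by auto
qed

text \<open>The Dirichlet data: one sign change of the Green function in each closed gap, possibly
  at a gap edge.\<close>

definition \<mu> :: "nat \<Rightarrow> real" where
  "\<mu> = (SOME \<mu>. \<forall>i<g. e (2*i+1) \<le> \<mu> i \<and> \<mu> i \<le> e (2*i+2) \<and>
     (\<forall>x. e (2*i+1) < x \<and> x < e (2*i+2) \<and> x \<noteq> \<mu> i \<longrightarrow> sgn (Re (G (of_real x))) = sgn (x - \<mu> i)))"

lemma \<mu>:
  assumes "i < g"
  shows "e (2*i+1) \<le> \<mu> i" "\<mu> i \<le> e (2*i+2)"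
    "\<And>x. e (2*i+1) < x \<Longrightarrow> x < e (2*i+2) \<Longrightarrow> x \<noteq> \<mu> i \<Longrightarrow> sgn (Re (G (of_real x))) = sgn (x - \<mu> i)"
  using someI_ex[OF gap_zeros_exist] assms unfolding \<mu>_def[symmetric] by blast+

text \<open>The logarithm of \<open>-\<i> G\<close> divided by the expected closed form; the factors \<open>-\<i>\<close> rotate the upper
  half plane to the right one, on which the principal branch is continuous up to the boundary.\<close>

definition \<Lambda> :: "complex \<Rightarrow> complex" where
  "\<Lambda> z = Ln (- \<i> * G z) - (\<Sum>j<g. Ln (- \<i> * (z - of_real (\<mu> j))))
       + (\<Sum>k<2*g+2. Ln (- \<i> * (z - of_real (e k)))) / 2"

text \<open>The logarithm of \<open>w / (1 + w)\<close> for \<open>w = - \<i> * G z\<close>, a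
  quotient of modulus at most 1 because \<open>w\<close> has positive real part.\<close>

definition \<beta> :: "complex \<Rightarrow> complex" where
  "\<beta> z = Ln (- \<i> * G z) - Ln (1 - \<i> * G z)"

lemma \<Lambda>_holomorphic: "\<Lambda> holomorphic_on {z. 0 < Im z}"
  unfolding \<Lambda>_def
  by (intro holomorphic_intros hol_upper) (auto simp: complex_nonneg_Reals_iff dest: Im_pos)

lemma \<beta>_holomorphic: "\<beta> holomorphic_on {z. 0 < Im z}"
  unfolding \<beta>_def
  by (intro holomorphic_intros hol_upper) (auto simp: complex_nonneg_Reals_iff complex_nonpos_Reals_iff dest: Im_pos)

text \<open>Counts the arguments in \<Lambda>, each at most \<open>pi\<close>: one for
  \<open>G\<close>, \<open>g\<close> for the zeros and half of \<open>2 * g + 2\<close> for the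
  edges, with one to spare.\<close>

definition bnd :: real where "bnd = pi * (2 * real g + 3)"

lemma Im_\<Lambda>_bound:
  assumes "0 < Im z" shows "\<bar>Im (\<Lambda> z)\<bar> \<le> bnd"
proof -
  have L: "\<bar>Im (Ln (- \<i> * w))\<bar> \<le> pi" if "0 < Im w" for w :: complex
    using Re_Ln_pos_lt_imp[of "- \<i> * w"] that pi_gt_zero by simp
  have "\<bar>Im (\<Lambda> z)\<bar> \<le> \<bar>Im (Ln (- \<i> * G z))\<bar> + \<bar>\<Sum>j<g. Im (Ln (- \<i> * (z - of_real (\<mu> j))))\<bar>
      + \<bar>\<Sum>k<2*g+2. Im (Ln (- \<i> * (z - of_real (e k))))\<bar> / 2"
    unfolding \<Lambda>_def minus_complex.sel plus_complex.sel Im_divide_numeral Im_sum by arith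
  also have "\<dots> \<le> pi + (\<Sum>j<g. pi) + (\<Sum>k<2*g+2. pi) / 2"
    by (intro add_mono divide_right_mono order_trans[OF sum_abs] sum_mono L Im_pos) (use assms in auto)
  also have "\<dots> \<le> bnd" by (simp add: bnd_def algebra_simps)
  finally show ?thesis .
qed

lemma Re_\<beta>:
  assumes "0 < Im z"
  shows "Re (\<beta> z) = ln (cmod (G z)) - ln (cmod (1 - \<i> * G z))"
    and "1 \<le> cmod (1 - \<i> * G z)" and "cmod (G z) \<le> cmod (1 - \<i> * G z)" and "Re (\<beta> z) \<le> 0"
proof -
  have p: "0 < Im (G z)" by (rule Im_pos[OF assms])
  have 1: "(cmod (1 - \<i> * G z))\<^sup>2 = (1 + Im (G z))\<^sup>2 + (Re (G z))\<^sup>2" by (simp add: cmod_power2)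
  show g1: "1 \<le> cmod (1 - \<i> * G z)"
  proof (rule power2_le_imp_le)
    have "1\<^sup>2 \<le> (1 + Im (G z))\<^sup>2" using p by (intro power_mono) auto
    then show "1\<^sup>2 \<le> (cmod (1 - \<i> * G z))\<^sup>2" unfolding 1 by (simp add: add_increasing2)
  qed simp
  show g2: "cmod (G z) \<le> cmod (1 - \<i> * G z)"
  proof (rule power2_le_imp_le)
    have "(Im (G z))\<^sup>2 \<le> (1 + Im (G z))\<^sup>2" using p by (intro power_mono) auto
    then show "(cmod (G z))\<^sup>2 \<le> (cmod (1 - \<i> * G z))\<^sup>2" unfolding 1 by (simp add: cmod_power2)
  qed simp
  have nz: "G z \<noteq> 0" using p by auto
  moreover have nz': "1 - \<i> * G z \<noteq> 0" using g1 by auto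
  ultimately show e: "Re (\<beta> z) = ln (cmod (G z)) - ln (cmod (1 - \<i> * G z))"
    by (simp add: \<beta>_def norm_mult)
  show "Re (\<beta> z) \<le> 0" unfolding e using g2 nz nz' by (simp add: ln_le_cancel_iff)
qed

text \<open>The two edges of a gap cancel against its zero unless \<open>x\<close> lies in that gap;
  what is left comes from the outermost edges and at most one gap.\<close>

lemma sum_signs:
  assumes "\<And>k. k \<le> 2*g+1 \<Longrightarrow> x \<noteq> e k" "\<And>i. i < g \<Longrightarrow> x \<noteq> \<mu> i"
  defines "D \<equiv> (\<Sum>k<2*g+2. sgn (x - e k)) / 2 - (\<Sum>j<g. sgn (x - \<mu> j))"
  shows "x < e 0 \<Longrightarrow> D = -1" and "e (2*g+1) < x \<Longrightarrow> D = 1"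
    and "j \<le> g \<Longrightarrow> e (2*j) < x \<Longrightarrow> x < e (2*j+1) \<Longrightarrow> D = 0"
    and "j < g \<Longrightarrow> e (2*j+1) < x \<Longrightarrow> x < e (2*j+2) \<Longrightarrow> D = - sgn (x - \<mu> j)"
proof -
  let ?t = "\<lambda>i. (sgn (x - e (2*i+1)) + sgn (x - e (2*i+2))) / 2 - sgn (x - \<mu> i)"
  have D: "D = (sgn (x - e 0) + sgn (x - e (2*g+1))) / 2 + (\<Sum>i<g. ?t i)"
    unfolding D_def sum_edges by (simp add: sum.distrib sum_subtractf sum_divide_distrib add_divide_distrib)
  have t: "?t i = 0" if "i < g" "x < e (2*i+1) \<or> e (2*i+2) < x" for i
    using that \<mu>(1,2)[OF that(1)] e_mono[of "2*i+1" "2*i+2"] by auto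
  have hull: "e 0 < e (2*g+1)" by (rule e_mono) auto
  show "D = -1" if "x < e 0"
  proof -
    have "?t i = 0" if "i < g" for i
      by (rule t[OF that]) (use \<open>x < e 0\<close> e_mono[of 0 "2*i+1"] that in auto)
    then show ?thesis unfolding D using that hull by simp
  qed
  show "D = 1" if "e (2*g+1) < x"
  proof -
    have "?t i = 0" if "i < g" for i
      by (rule t[OF that]) (use \<open>e (2*g+1) < x\<close> e_mono[of "2*i+2" "2*g+1"] that in auto)
    then show ?thesis unfolding D using that hull by simp
  qed
  show "D = 0" if j: "j \<le> g" "e (2*j) < x" "x < e (2*j+1)"
  proof -
    have "?t i = 0" if "i < g" for i
    proof (rule t[OF that])
      show "x < e (2*i+1) \<or> e (2*i+2) < x"
      proof (cases "j \<le> i")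
        case True
        then show ?thesis using e_mono_le[of "2*j+1" "2*i+1"] j that by auto
      next
        case False
        then show ?thesis using e_mono_le[of "2*i+2" "2*j"] j that by auto
      qed
    qed
    moreover have "e 0 < x" "x < e (2*g+1)"
      using e_mono_le[of 0 "2*j"] e_mono_le[of "2*j+1" "2*g+1"] j by auto
    ultimately show ?thesis unfolding D by simp
  qed
  show "D = - sgn (x - \<mu> j)" if j: "j < g" "e (2*j+1) < x" "x < e (2*j+2)"
  proof -
    have t0: "?t i = 0" if "i < g" "i \<noteq> j" for i
    proof (rule t[OF that(1)])
      show "x < e (2*i+1) \<or> e (2*i+2) < x"
      proof (cases "j \<le> i")
        case True
        then show ?thesis using e_mono_le[of "2*j+2" "2*i+1"] j that by auto
      next
        case False
        then show ?thesis using e_mono_le[of "2*i+2" "2*j+1"] j that by auto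
      qed
    qed
    have "(\<Sum>i<g. ?t i) = ?t j + (\<Sum>i\<in>{..<g}-{j}. ?t i)"
      using j by (intro sum.remove) auto
    also have "(\<Sum>i\<in>{..<g}-{j}. ?t i) = 0" using t0 by (intro sum.neutral) auto
    also have "?t j = - sgn (x - \<mu> j)" using j by simp
    finally have "(\<Sum>i<g. ?t i) = - sgn (x - \<mu> j)" by simp
    moreover have "e 0 < x" "x < e (2*g+1)"
      using e_mono_le[of 0 "2*j+1"] e_mono_le[of "2*j+2" "2*g+1"] j by auto
    ultimately show ?thesis unfolding D by simp
  qed
qed

text \<open>\<open>s\<close> is the limiting argument of \<open>- \<i> * G\<close> in units of
  \<open>- pi / 2\<close>: the sign of \<open>G\<close> off the bands, and 0 at points of the bands
  where \<open>- \<i> * G\<close> has a positive limit.\<close>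

lemma Im_\<Lambda>_tendsto:
  assumes x: "\<And>k. k \<le> 2*g+1 \<Longrightarrow> x \<noteq> e k" "\<And>i. i < g \<Longrightarrow> x \<noteq> \<mu> i"
    and G: "((\<lambda>\<epsilon>. Im (Ln (- \<i> * G (Complex x \<epsilon>)))) \<longlongrightarrow> - (pi / 2) * s) (at_right 0)"
    and s: "s + ((\<Sum>k<2*g+2. sgn (x - e k)) / 2 - (\<Sum>j<g. sgn (x - \<mu> j))) = 0"
  shows "((\<lambda>\<epsilon>. Im (\<Lambda> (Complex x \<epsilon>))) \<longlongrightarrow> 0) (at_right 0)"
proof -
  have lin: "((\<lambda>\<epsilon>. Im (Ln (- \<i> * (Complex x \<epsilon> - of_real c)))) \<longlongrightarrow> - (pi / 2) * sgn (x - c)) (at_right 0)"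
    if "x \<noteq> c" for c
  proof (rule Im_Ln_tendsto_real)
    show "((\<lambda>\<epsilon>. Complex x \<epsilon> - of_real c) \<longlongrightarrow> of_real (x - c)) (at_right 0)"
      unfolding of_real_diff by (intro tendsto_intros vertical_tendsto)
  qed (use that in simp)
  have "((\<lambda>\<epsilon>. Im (Ln (- \<i> * G (Complex x \<epsilon>))) - (\<Sum>j<g. Im (Ln (- \<i> * (Complex x \<epsilon> - of_real (\<mu> j)))))
       + (\<Sum>k<2*g+2. Im (Ln (- \<i> * (Complex x \<epsilon> - of_real (e k))))) / 2) \<longlongrightarrow>
       - (pi / 2) * s - (\<Sum>j<g. - (pi / 2) * sgn (x - \<mu> j)) + (\<Sum>k<2*g+2. - (pi / 2) * sgn (x - e k)) / 2) (at_right 0)"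
    by (intro tendsto_add tendsto_diff tendsto_sum tendsto_divide tendsto_const G lin) (use x in auto)
  also have "- (pi / 2) * s - (\<Sum>j<g. - (pi / 2) * sgn (x - \<mu> j)) + (\<Sum>k<2*g+2. - (pi / 2) * sgn (x - e k)) / 2
      = - (pi / 2) * (s + ((\<Sum>k<2*g+2. sgn (x - e k)) / 2 - (\<Sum>j<g. sgn (x - \<mu> j))))"
    unfolding sum_distrib_left[symmetric] by (simp add: algebra_simps)
  finally show ?thesis unfolding s \<Lambda>_def by (simp add: Im_sum)
qed

text \<open>\<open>Re \<beta>\<close> is nonpositive and tends to \<open>-\<infinity>\<close> where the boundary value of \<open>G\<close> is \<open>0\<close>, so the factor \<open>exp (\<delta> \<beta>)\<close>
  disposes of the points at which the argument of \<open>G\<close> need not converge.\<close>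

definition barrier :: "real \<Rightarrow> real \<Rightarrow> complex \<Rightarrow> complex" where
  "barrier s \<delta> z = exp (of_real s * \<i> * \<Lambda> z + of_real \<delta> * \<beta> z)"

lemma cmod_barrier: "cmod (barrier s \<delta> z) = exp (- s * Im (\<Lambda> z) + \<delta> * Re (\<beta> z))"
  by (simp add: barrier_def)

lemma barrier_boundary:
  assumes s: "\<bar>s\<bar> = 1" and \<delta>: "0 < \<delta>"
    and x: "\<And>k. k \<le> 2*g+1 \<Longrightarrow> x \<noteq> e k" "\<And>i. i < g \<Longrightarrow> x \<noteq> \<mu> i"
    and refl: "x \<in> bands \<Longrightarrow> \<exists>r. ((\<lambda>\<epsilon>. G (Complex x \<epsilon>)) \<longlongrightarrow> r) (at_right 0) \<and> Re r = 0"
  shows "((\<lambda>\<epsilon>. max 1 (cmod (barrier s \<delta> (Complex x \<epsilon>)))) \<longlongrightarrow> 1) (at_right 0)"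
proof -
  have pos: "\<forall>\<^sub>F \<epsilon> in at_right 0. (0::real) < \<epsilon>" by (rule eventually_at_right_less)
  have A: ?thesis if "((\<lambda>\<epsilon>. Im (\<Lambda> (Complex x \<epsilon>))) \<longlongrightarrow> 0) (at_right 0)"
  proof (rule tendsto_sandwich)
    show "((\<lambda>_. 1::real) \<longlongrightarrow> 1) (at_right 0)" by simp
    show "((\<lambda>\<epsilon>. exp \<bar>Im (\<Lambda> (Complex x \<epsilon>))\<bar>) \<longlongrightarrow> 1) (at_right 0)"
      using tendsto_exp[OF tendsto_rabs[OF that]] by simp
    show "\<forall>\<^sub>F \<epsilon> in at_right 0. 1 \<le> max 1 (cmod (barrier s \<delta> (Complex x \<epsilon>)))" by simp
    show "\<forall>\<^sub>F \<epsilon> in at_right 0. max 1 (cmod (barrier s \<delta> (Complex x \<epsilon>))) \<le> exp \<bar>Im (\<Lambda> (Complex x \<epsilon>))\<bar>"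
      using pos
    proof eventually_elim
      case (elim \<epsilon>)
      have "\<delta> * Re (\<beta> (Complex x \<epsilon>)) \<le> 0"
        using Re_\<beta>(4)[of "Complex x \<epsilon>"] \<delta> elim by (simp add: mult_nonneg_nonpos)
      moreover have "- s * Im (\<Lambda> (Complex x \<epsilon>)) \<le> \<bar>Im (\<Lambda> (Complex x \<epsilon>))\<bar>"
        using s by (auto simp: abs_if split: if_splits)
      ultimately show ?case unfolding cmod_barrier by simp
    qed
  qed
  have off: ?thesis if nb: "x \<notin> bands" and
      sg: "sgn (Re (G (of_real x))) + ((\<Sum>k<2*g+2. sgn (x - e k)) / 2 - (\<Sum>j<g. sgn (x - \<mu> j))) = 0"
      "Re (G (of_real x)) \<noteq> 0"
  proof (rule A, rule Im_\<Lambda>_tendsto[OF x _ sg(1)])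
    have "((\<lambda>\<epsilon>. G (Complex x \<epsilon>)) \<longlongrightarrow> of_real (Re (G (of_real x)))) (at_right 0)"
      using boundary_tendsto[OF nb] G_of_real[OF nb] by simp
    from Im_Ln_tendsto_real[OF this sg(2)]
    show "((\<lambda>\<epsilon>. Im (Ln (- \<i> * G (Complex x \<epsilon>)))) \<longlongrightarrow> - (pi / 2) * sgn (Re (G (of_real x)))) (at_right 0)" .
  qed
  consider (left) "x < e 0" | (right) "e (2*g+1) < x" | (mid) "e 0 < x" "x < e (2*g+1)"
    using x(1)[of 0] x(1)[of "2*g+1"] by linarith
  then show ?thesis
  proof cases
    case left
    have "0 < Re (G (of_real x))" by (rule sign_left) (use bands_ge left in fastforce)
    then show ?thesis using sum_signs(1)[OF x left] bands_ge left by (intro off) fastforce+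
  next
    case right
    have "Re (G (of_real x)) < 0" by (rule sign_right) (use bands_le right in fastforce)
    then show ?thesis using sum_signs(2)[OF x right] bands_le right by (intro off) fastforce+
  next
    case mid
    from locate[OF mid x(1)] obtain k where k: "k < 2*g+1" "e k < x" "x < e (Suc k)" by blast
    show ?thesis
    proof (cases "even k")
      case False
      then obtain i where i: "k = 2*i+1" by (elim oddE)
      have ig: "i < g" using i k by simp
      have nb: "x \<notin> bands" using gap_disjoint[OF ig] k i by (auto simp: disjoint_iff)
      have sg: "sgn (Re (G (of_real x))) = sgn (x - \<mu> i)"
        by (rule \<mu>(3)[OF ig]) (use k i x(2)[OF ig] in auto)
      have "(\<Sum>k<2*g+2. sgn (x - e k)) / 2 - (\<Sum>j<g. sgn (x - \<mu> j)) = - sgn (x - \<mu> i)"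
        by (rule sum_signs(4)[OF x ig]) (use k i in auto)
      moreover have "Re (G (of_real x)) \<noteq> 0" using sg x(2)[OF ig] by (auto simp: sgn_if split: if_splits)
      ultimately show ?thesis using sg by (intro off nb) auto
    next
      case True
      then obtain i where i: "k = 2*i" by (elim evenE)
      have ig: "i \<le> g" using i k by simp
      have "x \<in> bands" unfolding bands_def using k i ig by (intro UN_I[of i]) auto
      from refl[OF this] obtain r where r: "((\<lambda>\<epsilon>. G (Complex x \<epsilon>)) \<longlongrightarrow> r) (at_right 0)" "Re r = 0" by blast
      have D: "(\<Sum>k<2*g+2. sgn (x - e k)) / 2 - (\<Sum>j<g. sgn (x - \<mu> j)) = 0"
        by (rule sum_signs(3)[OF x ig]) (use k i in auto)
      show ?thesis
      proof (cases "r = 0")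
        case False
        have "0 \<le> Im r"
        proof (rule tendsto_lowerbound[OF tendsto_Im[OF r(1)]])
          show "\<forall>\<^sub>F \<epsilon> in at_right 0. 0 \<le> Im (G (Complex x \<epsilon>))"
            using pos by eventually_elim (rule less_imp_le, rule Im_pos, simp)
        qed simp
        with False r(2) have rp: "0 < Im r" by (auto simp: complex_eq_iff)
        have ri: "- \<i> * r = of_real (Im r)" using r(2) by (simp add: complex_eq_iff)
        have "((\<lambda>\<epsilon>. Im (Ln (- \<i> * G (Complex x \<epsilon>)))) \<longlongrightarrow> Im (Ln (- \<i> * r))) (at_right 0)"
          by (intro tendsto_Im tendsto_Ln tendsto_mult tendsto_const r(1)) (use rp in \<open>simp add: complex_nonneg_Reals_iff\<close>)
        also have "Im (Ln (- \<i> * r)) = - (pi / 2) * 0" unfolding ri using rp by (simp add: Ln_of_real)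
        finally show ?thesis by (intro A Im_\<Lambda>_tendsto[OF x]) (use D in auto)
      next
        case True
        have "((\<lambda>\<epsilon>. cmod (G (Complex x \<epsilon>))) \<longlongrightarrow> 0) (at_right 0)"
          using tendsto_norm[OF r(1)] True by simp
        \<comment> \<open>Below this threshold \<open>\<delta> * Re (\<beta> ?z)\<close> is at most
          \<open>- bnd\<close> and outweighs the bounded term with \<Lambda>, whatever the argument
          of \<open>G\<close> does.\<close>
        then have "\<forall>\<^sub>F \<epsilon> in at_right 0. cmod (G (Complex x \<epsilon>)) < exp (- bnd / \<delta>)"
          by (rule order_tendstoD) simp
        then have "\<forall>\<^sub>F \<epsilon> in at_right 0. max 1 (cmod (barrier s \<delta> (Complex x \<epsilon>))) = 1"
          using pos
        proof eventually_elim
          case (elim \<epsilon>)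
          let ?z = "Complex x \<epsilon>"
          have z: "0 < Im ?z" using elim by simp
          have nz: "G ?z \<noteq> 0" using Im_pos[OF z] by auto
          have "ln (cmod (G ?z)) \<le> ln (exp (- bnd / \<delta>))"
            using elim nz by (subst ln_le_cancel_iff) auto
          then have "ln (cmod (G ?z)) \<le> - bnd / \<delta>" by (simp only: ln_exp)
          moreover have "0 \<le> ln (cmod (1 - \<i> * G ?z))" using Re_\<beta>(2)[OF z] by simp
          ultimately have "Re (\<beta> ?z) \<le> - bnd / \<delta>" unfolding Re_\<beta>(1)[OF z] by linarith
          then have "\<delta> * Re (\<beta> ?z) \<le> - bnd" using \<delta> by (simp add: field_simps)
          moreover have "- s * Im (\<Lambda> ?z) \<le> bnd"
            using s Im_\<Lambda>_bound[OF z] by (auto simp: abs_if split: if_splits)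
          ultimately show ?case unfolding cmod_barrier by simp
        qed
        then show ?thesis by (rule tendsto_eventually)
      qed
    qed
  qed
qed

lemma cmod_barrier_le_1:
  assumes s: "\<bar>s\<bar> = 1" and \<delta>: "0 < \<delta>" and z: "0 < Im z"
  shows "cmod (barrier s \<delta> z) \<le> 1"
proof (rule norm_le_one_upper_AE[OF _ _ _ z])
  show "barrier s \<delta> holomorphic_on {z. 0 < Im z}"
    unfolding barrier_def by (intro holomorphic_intros \<Lambda>_holomorphic \<beta>_holomorphic)
  show "cmod (barrier s \<delta> z) \<le> exp bnd" if "0 < Im z" for z
  proof -
    have "\<delta> * Re (\<beta> z) \<le> 0" using Re_\<beta>(4)[OF that] \<delta> by (simp add: mult_nonneg_nonpos)
    moreover have "- s * Im (\<Lambda> z) \<le> bnd"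
      using s Im_\<Lambda>_bound[OF that] by (auto simp: abs_if split: if_splits)
    ultimately show ?thesis unfolding cmod_barrier by simp
  qed
  have "finite (e ` {..2*g+1} \<union> \<mu> ` {..<g})" by auto
  then have "negligible (e ` {..2*g+1} \<union> \<mu> ` {..<g})" by (rule negligible_finite)
  then have "AE x in lebesgue. x \<notin> e ` {..2*g+1} \<union> \<mu> ` {..<g}"
    unfolding negligible_iff_null_sets by (rule AE_not_in)
  with reflectionless
  show "AE x in lebesgue. ((\<lambda>\<epsilon>. max 1 (cmod (barrier s \<delta> (Complex x \<epsilon>)))) \<longlongrightarrow> 1) (at_right 0)"
  proof eventually_elim
    case (elim x)
    then show ?case by (intro barrier_boundary[OF s \<delta>]) auto
  qed
qed

text \<open>Letting \<delta> tend to 0 removes the barrier; the two signs of \<open>s\<close> bound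
  the imaginary part from both sides.\<close>

lemma Im_\<Lambda>_eq_0:
  assumes z: "0 < Im z" shows "Im (\<Lambda> z) = 0"
proof -
  have "- s * Im (\<Lambda> z) \<le> 0" if s: "\<bar>s\<bar> = 1" for s
  proof (rule tendsto_upperbound)
    show "((\<lambda>\<delta>. - s * Im (\<Lambda> z) + \<delta> * Re (\<beta> z)) \<longlongrightarrow> - s * Im (\<Lambda> z)) (at_right 0)"
      by (rule tendsto_eq_intros refl | simp)+
    show "\<forall>\<^sub>F \<delta> in at_right 0. - s * Im (\<Lambda> z) + \<delta> * Re (\<beta> z) \<le> 0"
      using eventually_at_right_less
    proof eventually_elim
      case (elim \<delta>)
      then show ?case using cmod_barrier_le_1[OF s _ z, of \<delta>] by (simp add: cmod_barrier)
    qed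
  qed simp
  from this[of 1] this[of "-1"] show ?thesis by simp
qed

text \<open>Since \<Lambda> is real-valued, \<open>exp (\<i> * \<Lambda> w)\<close> has modulus 1
  throughout the half plane, and the maximum modulus principle makes it constant.\<close>

lemma \<Lambda>_constant: "\<exists>c. \<forall>z. 0 < Im z \<longrightarrow> \<Lambda> z = c"
proof -
  let ?H = "{z. 0 < Im z}"
  have "\<exists>c. \<forall>z\<in>?H. \<Lambda> z = c"
  proof (rule has_field_derivative_zero_constant[OF convex_upper])
    fix z assume z: "z \<in> ?H"
    have D: "(\<Lambda> has_field_derivative deriv \<Lambda> z) (at z)"
      by (rule holomorphic_derivI[OF \<Lambda>_holomorphic open_upper z])
    have "(\<lambda>w. exp (\<i> * \<Lambda> w)) constant_on ?H"
    proof (rule maximum_modulus_principle[OF _ open_upper _ open_upper _ z])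
      show "(\<lambda>w. exp (\<i> * \<Lambda> w)) holomorphic_on ?H"
        by (intro holomorphic_intros \<Lambda>_holomorphic)
      show "connected ?H" by (rule convex_connected[OF convex_upper])
    qed (use Im_\<Lambda>_eq_0 z in auto)
    then obtain c where c: "\<And>w. w \<in> ?H \<Longrightarrow> exp (\<i> * \<Lambda> w) = c" unfolding constant_on_def by blast
    have "((\<lambda>w. exp (\<i> * \<Lambda> w)) has_field_derivative exp (\<i> * \<Lambda> z) * (\<i> * deriv \<Lambda> z)) (at z)"
      by (auto intro!: derivative_eq_intros D)
    moreover have "((\<lambda>w. exp (\<i> * \<Lambda> w)) has_field_derivative 0) (at z)"
      by (rule has_field_derivative_transform_within_open[OF DERIV_const open_upper z]) (simp add: c)
    ultimately have "exp (\<i> * \<Lambda> z) * (\<i> * deriv \<Lambda> z) = 0" by (rule DERIV_unique)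
    then have "deriv \<Lambda> z = 0" by simp
    then show "(\<Lambda> has_field_derivative 0) (at z within ?H)"
      using D has_field_derivative_at_within by metis
  qed
  then show ?thesis by simp
qed

text \<open>Squaring turns the half-logarithms of the edges into whole ones and so avoids choosing a
  branch of the square root.\<close>

theorem green_square_proportional:
  "\<exists>K. \<forall>z. 0 < Im z \<longrightarrow> (G z)\<^sup>2 * (\<Prod>k<2*g+2. z - of_real (e k)) = K * (\<Prod>j<g. z - of_real (\<mu> j))\<^sup>2"
proof -
  obtain c where c: "\<And>z. 0 < Im z \<Longrightarrow> \<Lambda> z = c" using \<Lambda>_constant by blast
  have "(G z)\<^sup>2 * (\<Prod>k<2*g+2. z - of_real (e k)) = exp (2 * c) * (\<Prod>j<g. z - of_real (\<mu> j))\<^sup>2"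
    if z: "0 < Im z" for z
  proof -
    have nz: "G z \<noteq> 0" "z - of_real t \<noteq> 0" for t using Im_pos[OF z] z by auto
    define m where "m = (\<Sum>j<g. Ln (- \<i> * (z - of_real (\<mu> j))))"
    define s where "s = (\<Sum>k<2*g+2. Ln (- \<i> * (z - of_real (e k))))"
    have eL: "exp (Ln (- \<i> * (z - of_real t))) = - \<i> * (z - of_real t)" for t
      using nz by (intro exp_Ln) simp
    have em: "exp m = (- \<i>) ^ g * (\<Prod>j<g. z - of_real (\<mu> j))"
      unfolding m_def exp_sum[OF finite_lessThan] eL prod.distrib by simp
    have es: "exp s = (- \<i>) ^ (2*g+2) * (\<Prod>k<2*g+2. z - of_real (e k))"
      unfolding s_def exp_sum[OF finite_lessThan] eL prod.distrib by (simp del: prod.lessThan_Suc)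
    have "2 * c + 2 * m = 2 * Ln (- \<i> * G z) + s"
      using c[OF z] unfolding \<Lambda>_def m_def[symmetric] s_def[symmetric] by (simp add: field_simps)
    then have "exp (2 * c) * (exp m)\<^sup>2 = (exp (Ln (- \<i> * G z)))\<^sup>2 * exp s"
      unfolding exp_double[symmetric] exp_add[symmetric] by simp
    also have "exp (Ln (- \<i> * G z)) = - \<i> * G z" using nz by (intro exp_Ln) simp
    finally have "exp (2 * c) * ((- \<i>) ^ g * (\<Prod>j<g. z - of_real (\<mu> j)))\<^sup>2
        = (- \<i> * G z)\<^sup>2 * ((- \<i>) ^ (2*g+2) * (\<Prod>k<2*g+2. z - of_real (e k)))"
      unfolding em es .
    moreover have "((- \<i>) ^ g)\<^sup>2 = ((- \<i>)\<^sup>2) ^ g" by (simp add: power_mult[symmetric] mult.commute)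
    moreover have "(- \<i>) ^ (2*g+2) = ((- \<i>)\<^sup>2) ^ g * (- \<i>)\<^sup>2" by (simp add: power_add power_mult)
    ultimately have "(-1) ^ g * (exp (2 * c) * (\<Prod>j<g. z - of_real (\<mu> j))\<^sup>2)
        = (-1) ^ g * ((G z)\<^sup>2 * (\<Prod>k<2*g+2. z - of_real (e k)))"
      by (simp add: power_mult_distrib mult_ac del: prod.lessThan_Suc)
    then show ?thesis by (simp del: prod.lessThan_Suc)
  qed
  then show ?thesis by blast
qed

end

section \<open>Expansion at infinity\<close>

unbundle fps_syntax
unbundle no vec_syntax

lemma fps_prod_linear_nth:
  fixes a :: "nat \<Rightarrow> 'a::comm_ring_1"
  shows "m < j \<Longrightarrow> (\<Prod>k<m. 1 - fps_const (a k) * fps_X) $ j = 0"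
proof (induction m arbitrary: j)
  case (Suc m)
  then show ?case by (cases j) (auto simp: right_diff_distrib mult.assoc[symmetric] fps_X_mult_right_nth)
qed auto

lemma fps_prod_linear_root:
  fixes a :: "nat \<Rightarrow> 'a::comm_ring_1"
  shows "(\<Sum>j\<le>m. (\<Prod>k<m. 1 - fps_const (a k) * fps_X) $ j * t ^ (m - j)) = (\<Prod>k<m. t - a k)"
proof (induction m)
  case (Suc m)
  let ?p = "\<Prod>k<m. 1 - fps_const (a k) * fps_X"
  have nth: "(\<Prod>k<Suc m. 1 - fps_const (a k) * fps_X) $ j = ?p $ j - (if j = 0 then 0 else ?p $ (j - 1) * a m)" for j
    by (cases j) (auto simp: right_diff_distrib mult.assoc[symmetric] fps_X_mult_right_nth)
  have "(\<Sum>j\<le>Suc m. (\<Prod>k<Suc m. 1 - fps_const (a k) * fps_X) $ j * t ^ (Suc m - j))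
      = (\<Sum>j\<le>Suc m. ?p $ j * t ^ (Suc m - j)) - (\<Sum>j\<le>Suc m. (if j = 0 then 0 else ?p $ (j - 1) * a m) * t ^ (Suc m - j))"
    unfolding nth by (simp only: left_diff_distrib sum_subtractf)
  also have "(\<Sum>j\<le>Suc m. ?p $ j * t ^ (Suc m - j)) = t * (\<Sum>j\<le>m. ?p $ j * t ^ (m - j))"
    using fps_prod_linear_nth[of m "Suc m" a]
    by (simp add: sum_distrib_left Suc_diff_le mult_ac)
  also have "(\<Sum>j\<le>Suc m. (if j = 0 then 0 else ?p $ (j - 1) * a m) * t ^ (Suc m - j))
      = a m * (\<Sum>j\<le>m. ?p $ j * t ^ (m - j))"
    unfolding sum.atMost_Suc_shift by (simp add: sum_distrib_left mult_ac)
  finally show ?case unfolding Suc.IH by (simp add: algebra_simps)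
qed simp

definition fps_complex :: "real fps \<Rightarrow> complex fps" where
  "fps_complex f = Abs_fps (\<lambda>n. of_real (f $ n))"

lemma fps_complex_mult: "fps_complex (f * h) = fps_complex f * fps_complex h"
  by (simp add: fps_complex_def fps_eq_iff fps_mult_nth)

lemma fps_complex_1: "fps_complex 1 = 1"
  by (simp add: fps_complex_def fps_eq_iff)

lemma fps_complex_prod: "fps_complex (\<Prod>k\<in>A. f k) = (\<Prod>k\<in>A. fps_complex (f k))"
  by (induction A rule: infinite_finite_induct) (auto simp: fps_complex_mult fps_complex_1)

lemma fps_complex_linear:
  "fps_complex (1 - fps_const c * fps_X) = 1 - fps_const (of_real c) * fps_X"
  by (simp add: fps_complex_def fps_eq_iff fps_X_def)

lemma fps_complex_inject: "fps_complex f = fps_complex h \<longleftrightarrow> f = h"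
  by (simp add: fps_complex_def fps_eq_iff)

context reflectionless_herglotz
begin

text \<open>In the variable \<open>X = 1 / z\<close> both sides are analytic near 0, so an identity
  on half a disc extends to the disc and to power series. The constant coefficient then shows
  \<open>K = 1\<close>.\<close>

lemma moment_identity:
  fixes w :: "nat \<Rightarrow> real"
  assumes w0: "w 0 = 1" and M: "0 < M"
    and sums: "\<And>z. M < cmod z \<Longrightarrow> (\<lambda>j. of_real (w j) / z ^ (j + 1)) sums (- G z)"
  shows "(Abs_fps w)\<^sup>2 * (\<Prod>k<2*g+2. 1 - fps_const (e k) * fps_X)
       = (\<Prod>j<g. 1 - fps_const (\<mu> j) * fps_X)\<^sup>2"
proof -
  define W where "W = fps_complex (Abs_fps w)"
  have s: "(\<lambda>j. of_real (w j) * X ^ (j + 1)) sums (- G (inverse X))" if "X \<noteq> 0" "cmod X < inverse M" for X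
  proof -
    have "M < inverse (cmod X)" using that M by (metis inverse_inverse_eq inverse_less_imp_less less_imp_inverse_less zero_less_norm_iff)
    then have "M < cmod (inverse X)" by (simp add: norm_inverse)
    from sums[OF this] show ?thesis by (simp add: power_inverse divide_inverse)
  qed
  define r where "r = inverse M / 2"
  have r: "0 < r" "r < inverse M" using M by (auto simp: r_def)
  have "summable (\<lambda>j. W $ j * of_real r ^ j)"
  proof -
    have "summable (\<lambda>j. of_real (w j) * of_real r ^ (j + 1) :: complex)"
      using s[of "of_real r"] r by (auto simp: sums_iff)
    then have "summable (\<lambda>j. inverse (of_real r) * (of_real (w j) * of_real r ^ (j + 1)) :: complex)"
      by (rule summable_mult)
    then show ?thesis using r by (simp add: W_def fps_complex_def mult_ac field_simps)
  qed
  then have "ereal (norm (complex_of_real r)) \<le> fps_conv_radius W"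
    unfolding fps_conv_radius_def by (rule conv_radius_geI)
  then have conv: "ereal r \<le> fps_conv_radius W" using r by simp
  have Wexp: "eval_fps W has_fps_expansion W"
    using conv r by (auto simp: has_fps_expansion_def intro: less_le_trans[of _ "ereal r"])
  have eval: "X * eval_fps W X = - G (inverse X)" if "X \<noteq> 0" "cmod X < r" for X
  proof -
    have "(\<lambda>j. W $ j * X ^ j) sums eval_fps W X"
      by (rule sums_eval_fps) (use that conv in \<open>auto intro: less_le_trans[of _ "ereal r"]\<close>)
    then have "(\<lambda>j. X * (W $ j * X ^ j)) sums (X * eval_fps W X)" by (rule sums_mult)
    then have "(\<lambda>j. of_real (w j) * X ^ (j + 1)) sums (X * eval_fps W X)"
      by (simp add: W_def fps_complex_def mult_ac)
    with s[of X] that r show ?thesis using sums_unique2 by force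
  qed
  obtain K where K: "\<And>z. 0 < Im z \<Longrightarrow>
      (G z)\<^sup>2 * (\<Prod>k<2*g+2. z - of_real (e k)) = K * (\<Prod>j<g. z - of_real (\<mu> j))\<^sup>2"
    using green_square_proportional by blast
  define f where "f X = (eval_fps W X)\<^sup>2 * (\<Prod>k<2*g+2. 1 - of_real (e k) * X)" for X
  define h where "h X = K * (\<Prod>j<g. 1 - of_real (\<mu> j) * X)\<^sup>2" for X :: complex
  have shift: "X ^ m * (\<Prod>k<m. inverse X - of_real (a k)) = (\<Prod>k<m. 1 - of_real (a k) * X)"
    if "X \<noteq> 0" for X :: complex and a :: "nat \<Rightarrow> real" and m
    using that by (induction m) (auto simp: field_simps)
  have eq_lower: "f X = h X" if X: "Im X < 0" "cmod X < r" for X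
  proof -
    have X0: "X \<noteq> 0" using X by auto
    \<comment> \<open>Inversion exchanges the half planes, so the upper one for \<open>z\<close> is
      the lower one for \<open>X\<close>.\<close>
    have "0 < Im (inverse X)" using X by (auto intro!: divide_neg_pos add_nonneg_pos)
    from K[OF this] have "(X * eval_fps W X)\<^sup>2 * (\<Prod>k<2*g+2. inverse X - of_real (e k))
        = K * (\<Prod>j<g. inverse X - of_real (\<mu> j))\<^sup>2"
      using eval[OF X0 X(2)] by simp
    \<comment> \<open>Together with the square of the factor \<open>X\<close>, this supplies one
      power of \<open>X\<close> per edge on the left and two per zero on the right.\<close>
    then have "X ^ (2*g) * ((X * eval_fps W X)\<^sup>2 * (\<Prod>k<2*g+2. inverse X - of_real (e k)))
        = X ^ (2*g) * (K * (\<Prod>j<g. inverse X - of_real (\<mu> j))\<^sup>2)" by simp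
    moreover have "X ^ (2*g) * ((X * eval_fps W X)\<^sup>2 * (\<Prod>k<2*g+2. inverse X - of_real (e k)))
        = (eval_fps W X)\<^sup>2 * (X ^ (2*g+2) * (\<Prod>k<2*g+2. inverse X - of_real (e k)))"
      by (simp add: power_mult_distrib power_add power2_eq_square mult_ac del: prod.lessThan_Suc)
    moreover have "X ^ (2*g) * (K * (\<Prod>j<g. inverse X - of_real (\<mu> j))\<^sup>2)
        = K * (X ^ g * (\<Prod>j<g. inverse X - of_real (\<mu> j)))\<^sup>2"
      by (simp add: power_mult_distrib power_mult[symmetric] mult_ac)
    ultimately show ?thesis unfolding f_def h_def shift[OF X0] by simp
  qed
  have eq: "f X - h X = 0" if "X \<in> ball 0 r" for X
  proof (rule analytic_continuation[of "\<lambda>X. f X - h X" "ball 0 r" "ball 0 r \<inter> {X. Im X < 0}" 0])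
    have "ball 0 r \<subseteq> eball 0 (fps_conv_radius W)"
      using conv by (auto simp: eball_def intro: less_le_trans[of _ "ereal r"])
    then show "(\<lambda>X. f X - h X) holomorphic_on ball 0 r"
      unfolding f_def h_def by (intro holomorphic_intros) auto
    show "0 islimpt ball 0 r \<inter> {X. Im X < 0}"
      unfolding islimpt_approachable
    proof (intro allI impI)
      fix d :: real assume "0 < d"
      then show "\<exists>x\<in>ball 0 r \<inter> {X. Im X < 0}. x \<noteq> 0 \<and> dist x 0 < d"
        using r by (intro bexI[of _ "Complex 0 (- min r d / 2)"]) (auto simp: cmod_def complex_eq_iff)
    qed
  qed (use eq_lower r that in auto)
  have fexp: "f has_fps_expansion W\<^sup>2 * (\<Prod>k<2*g+2. 1 - fps_const (of_real (e k)) * fps_X)"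
    unfolding f_def
    by (intro fps_expansion_intros Wexp)
  have hexp: "h has_fps_expansion fps_const K * (\<Prod>j<g. 1 - fps_const (of_real (\<mu> j)) * fps_X)\<^sup>2"
    unfolding h_def by (intro fps_expansion_intros)
  have "eventually (\<lambda>X. X \<in> ball 0 r) (nhds (0::complex))"
    using r by (intro eventually_nhds_in_open) auto
  then have "eventually (\<lambda>X. f X = h X) (nhds 0)"
    by eventually_elim (use eq in auto)
  then have "f has_fps_expansion fps_const K * (\<Prod>j<g. 1 - fps_const (of_real (\<mu> j)) * fps_X)\<^sup>2"
    using hexp has_fps_expansion_cong[of f h] by blast
  with fexp have id: "W\<^sup>2 * (\<Prod>k<2*g+2. 1 - fps_const (of_real (e k)) * fps_X)
      = fps_const K * (\<Prod>j<g. 1 - fps_const (of_real (\<mu> j)) * fps_X)\<^sup>2"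
    using fps_expansion_unique_complex by blast
  have z: "(\<Prod>k<m. 1 - fps_const (a k) * fps_X) $ 0 = 1" for m and a :: "nat \<Rightarrow> complex"
    by (induction m) auto
  have "(W\<^sup>2 * (\<Prod>k<2*g+2. 1 - fps_const (of_real (e k)) * fps_X)) $ 0 = 1"
    unfolding fps_mult_nth_0 z using w0 by (simp add: power2_eq_square W_def fps_complex_def)
  moreover have "(fps_const K * (\<Prod>j<g. 1 - fps_const (of_real (\<mu> j)) * fps_X)\<^sup>2) $ 0 = K"
    by (simp add: power2_eq_square z)
  ultimately have "K = 1" unfolding id by (simp only:)
  have "fps_complex ((Abs_fps w)\<^sup>2 * (\<Prod>k<2*g+2. 1 - fps_const (e k) * fps_X))
      = fps_complex ((\<Prod>j<g. 1 - fps_const (\<mu> j) * fps_X)\<^sup>2)"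
    using id \<open>K = 1\<close> unfolding power2_eq_square fps_complex_mult fps_complex_prod fps_complex_linear W_def
    by simp
  then show ?thesis by (simp only: fps_complex_inject)
qed

text \<open>Power series over the reals form an integral domain, so equal squares differ by a sign,
  which the constant terms fix. The right side that remains is a polynomial of degree at most
  \<open>g\<close>.\<close>

lemma moments_vanish:
  fixes w :: "nat \<Rightarrow> real" and C :: "real fps"
  assumes w: "w 0 = 1" "0 < M"
      "\<And>z. M < cmod z \<Longrightarrow> (\<lambda>j. of_real (w j) / z ^ (j + 1)) sums (- G z)"
    and C: "C\<^sup>2 = (\<Prod>k<2*g+2. 1 - fps_const (e k) * fps_X)" "C $ 0 = 1"
    and j: "g < j"
  shows "(\<Sum>i\<le>j. C $ i * w (j - i)) = 0"
proof -
  let ?P = "\<Prod>j<g. 1 - fps_const (\<mu> j) * fps_X"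
  have "(C * Abs_fps w)\<^sup>2 = ?P\<^sup>2"
    using moment_identity[OF w] C(1) by (simp only: power_mult_distrib mult.commute)
  then have "C * Abs_fps w = ?P \<or> C * Abs_fps w = - ?P" by (simp only: power2_eq_iff)
  moreover have "?P $ 0 = 1"
  proof -
    have "(\<Prod>k<m. 1 - fps_const (a k) * fps_X) $ 0 = 1" for m and a :: "nat \<Rightarrow> real"
      by (induction m) auto
    then show ?thesis .
  qed
  moreover have "(C * Abs_fps w) $ 0 = 1" using C(2) w(1) by simp
  ultimately have "C * Abs_fps w = ?P"
    by (metis fps_neg_nth one_neq_neg_one)
  then have "(C * Abs_fps w) $ j = 0" using fps_prod_linear_nth[OF j] by simp
  then show ?thesis by (simp add: fps_mult_nth atLeast0AtMost)
qed

end

lemma finite_gap_dataI: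
  assumes C: "C\<^sup>2 = (\<Prod>k<2*g+2. 1 - fps_const (e k) * fps_X)" "C $ 0 = 1"
    and w: "\<And>n j. g < j \<Longrightarrow> (\<Sum>i\<le>j. C $ i * walk V (j - i) n n) = 0"
  shows "Spectral_data l V (\<lambda>i. C $ i) e \<in> finite_gap_data g"
proof -
  have "(\<Sum>j\<le>2*g+2. (\<Sum>i\<le>j. C $ i * C $ (j - i)) * e k ^ (2*g+2-j)) = 0" if "k < 2*g+2" for k
  proof -
    have "(\<Sum>j\<le>2*g+2. (\<Sum>i\<le>j. C $ i * C $ (j - i)) * e k ^ (2*g+2-j))
        = (\<Sum>j\<le>2*g+2. (\<Prod>k<2*g+2. 1 - fps_const (e k) * fps_X) $ j * e k ^ (2*g+2-j))"
      unfolding C(1)[symmetric] power2_eq_square fps_mult_nth atLeast0AtMost ..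
    also have "\<dots> = (\<Prod>i<2*g+2. e k - e i)" by (rule fps_prod_linear_root)
    also have "\<dots> = 0" using that by (intro prod_zero) auto
    finally show ?thesis .
  qed
  with C(2) w show ?thesis by (auto simp: finite_gap_data_def)
qed

lemma fps_sqrt_exists:
  fixes a :: "real fps"
  assumes "a $ 0 = 1"
  obtains C where "C\<^sup>2 = a" "C $ 0 = 1"
proof
  let ?C = "fps_radical (\<lambda>_ _. 1) 2 a"
  show "?C\<^sup>2 = a" using power_radical[of a "\<lambda>_ _. 1" 1] assms by (simp add: numeral_2_eq_2)
  show "?C $ 0 = 1" by (simp add: numeral_2_eq_2)
qed

section \<open>Green functions of Schroedinger operators\<close>

lemma summable_on_domination:
  fixes f h :: "'a \<Rightarrow> real"
  assumes "h summable_on A" "\<And>k. k \<in> A \<Longrightarrow> \<bar>f k\<bar> \<le> h k"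
  shows "f summable_on A"
  by (rule abs_summable_summable, rule summable_on_comparison_test[OF assms(1)]) (use assms(2) in auto)

section \<open>Square-summable sequences\<close>

definition sqnorm :: "(int \<Rightarrow> complex) \<Rightarrow> real" where
  "sqnorm u = (\<Sum>\<^sub>\<infinity>k. (cmod (u k))\<^sup>2)"

lemma sqnorm_nonneg: "0 \<le> sqnorm u"
  unfolding sqnorm_def by (intro infsum_nonneg) auto

lemma l2_norm_sq: "(l2_norm u)\<^sup>2 = sqnorm u"
  using sqnorm_nonneg[of u] by (simp add: l2_norm_def sqnorm_def)

lemma l2_summable: "u \<in> l2 \<Longrightarrow> (\<lambda>k. (cmod (u k))\<^sup>2) summable_on UNIV"
  by (simp add: l2_def)

lemma coord_le_sqnorm: "u \<in> l2 \<Longrightarrow> (cmod (u k))\<^sup>2 \<le> sqnorm u"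
  unfolding sqnorm_def
  using finite_sum_le_infsum[OF l2_summable, of u "{k}"] by simp

lemma sq_sum_le: "(cmod (a + b))\<^sup>2 \<le> 2 * (cmod a)\<^sup>2 + 2 * (cmod b)\<^sup>2"
proof -
  have "(cmod (a + b))\<^sup>2 \<le> (cmod a + cmod b)\<^sup>2"
    by (intro power_mono norm_triangle_ineq) auto
  also have "\<dots> \<le> 2 * (cmod a)\<^sup>2 + 2 * (cmod b)\<^sup>2"
    using sum_squares_bound[of "cmod a" "cmod b"] by (simp add: power2_sum)
  finally show ?thesis .
qed

lemma l2_add:
  assumes "u \<in> l2" "v \<in> l2"
  shows "(\<lambda>k. u k + v k) \<in> l2" and "sqnorm (\<lambda>k. u k + v k) \<le> 2 * sqnorm u + 2 * sqnorm v"
proof -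
  have s: "(\<lambda>k. 2 * (cmod (u k))\<^sup>2 + 2 * (cmod (v k))\<^sup>2) summable_on UNIV"
    by (intro summable_on_add summable_on_cmult_right l2_summable assms)
  have s': "(\<lambda>k. (cmod (u k + v k))\<^sup>2) summable_on UNIV"
    by (rule summable_on_domination[OF s]) (auto simp: sq_sum_le)
  then show "(\<lambda>k. u k + v k) \<in> l2" by (simp add: l2_def)
  have "sqnorm (\<lambda>k. u k + v k) \<le> (\<Sum>\<^sub>\<infinity>k. 2 * (cmod (u k))\<^sup>2 + 2 * (cmod (v k))\<^sup>2)"
    unfolding sqnorm_def by (rule infsum_mono[OF s' s]) (rule sq_sum_le)
  also have "\<dots> = 2 * sqnorm u + 2 * sqnorm v"
    unfolding sqnorm_def using assms
    by (subst infsum_add) (auto intro!: summable_on_cmult_right l2_summable simp: infsum_cmult_right')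
  finally show "sqnorm (\<lambda>k. u k + v k) \<le> 2 * sqnorm u + 2 * sqnorm v" .
qed

lemma l2_bounded_mult:
  assumes "u \<in> l2" "\<And>k. cmod (c k) \<le> B"
  shows "(\<lambda>k. c k * u k) \<in> l2"
proof -
  have "(\<lambda>k. B\<^sup>2 * (cmod (u k))\<^sup>2) summable_on UNIV"
    by (intro summable_on_cmult_right l2_summable assms)
  then have "(\<lambda>k. (cmod (c k * u k))\<^sup>2) summable_on UNIV"
    by (rule summable_on_domination)
       (auto simp: norm_mult power_mult_distrib intro!: mult_right_mono power_mono assms)
  then show ?thesis by (simp add: l2_def)
qed

lemma l2_scale: "u \<in> l2 \<Longrightarrow> (\<lambda>k. c * u k) \<in> l2"
  by (rule l2_bounded_mult[of _ _ "cmod c"]) auto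

lemma sqnorm_scale: "sqnorm (\<lambda>k. c * u k) = (cmod c)\<^sup>2 * sqnorm u"
  by (simp add: sqnorm_def norm_mult power_mult_distrib infsum_cmult_right')

lemma bij_add_int: "bij (\<lambda>k. k + (c::int))"
  by (rule bij_betw_byWitness[of _ "\<lambda>k. k - c"]) auto

lemma l2_shift: "u \<in> l2 \<Longrightarrow> (\<lambda>k. u (k + c)) \<in> l2"
  unfolding l2_def
  using summable_on_reindex_bij_betw[OF bij_add_int[of c], of "\<lambda>k. (cmod (u k))\<^sup>2"] by simp

lemma delta_in_l2: "delta n \<in> l2"
proof -
  have "(\<lambda>k. (cmod (delta n k))\<^sup>2) summable_on UNIV"
    by (subst summable_on_cong_neutral[where T = "{n}" and g = "\<lambda>_. 1"]) (auto simp: delta_def)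
  then show ?thesis by (simp add: l2_def)
qed

lemma l2_inner_delta: "l2_inner (delta n) v = v n"
proof -
  have "l2_inner (delta n) v = (\<Sum>\<^sub>\<infinity>k\<in>{n}. cnj (delta n k) * v k)"
    unfolding l2_inner_def by (rule infsum_cong_neutral) (auto simp: delta_def)
  then show ?thesis by (simp add: delta_def)
qed

section \<open>Resolvent and Green function of a bounded Schroedinger operator\<close>

locale bounded_dso =
  fixes V :: "int \<Rightarrow> real" and B :: real
  assumes V_bound: "\<And>n. \<bar>V n\<bar> \<le> B"
begin

abbreviation H :: l2_op where "H \<equiv> jacobi_op (\<lambda>_. 1) V"

lemma H_apply: "H u m = u (m - 1) + of_real (V m) * u m + u (m + 1)"
  by (simp add: jacobi_op_def)

lemma B_nonneg: "0 \<le> B"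
  using V_bound[of 0] by linarith

lemma H_iterate_delta: "(H ^^ j) (delta n) m = of_real (walk V j n m)"
  by (induction j arbitrary: m) (auto simp: delta_def H_apply)

text \<open>A supremum-norm estimate; it controls the resolvent for large \<open>z\<close> and the
  remainder of the Neumann series.\<close>

lemma H_iterate_bound:
  assumes "\<And>k. cmod (u k) \<le> D"
  shows "cmod ((H ^^ j) u k) \<le> (2 + B) ^ j * D"
proof (induction j arbitrary: k)
  case (Suc j)
  let ?v = "(H ^^ j) u" and ?c = "(2 + B) ^ j * D"
  have "cmod ((H ^^ Suc j) u k) \<le> cmod (?v (k - 1)) + cmod (of_real (V k) * ?v k) + cmod (?v (k + 1))"
    by (auto simp: H_apply intro!: norm_triangle_le)
  also have "cmod (of_real (V k) * ?v k) \<le> B * ?c"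
    unfolding norm_mult norm_of_real using V_bound B_nonneg Suc.IH by (intro mult_mono) auto
  finally show ?case using Suc.IH[of "k - 1"] Suc.IH[of "k + 1"] by (simp add: algebra_simps)
qed (simp add: assms)

lemma H_linear: "H (\<lambda>k. c * (u k - v k)) = (\<lambda>k. c * (H u k - H v k))"
  by (simp add: H_apply fun_eq_iff algebra_simps)

lemma H_iterate_linear:
  "(H ^^ j) (\<lambda>k. c * (u k - v k)) = (\<lambda>k. c * ((H ^^ j) u k - (H ^^ j) v k))"
proof (induction j)
  case (Suc j)
  show ?case unfolding funpow.simps o_apply Suc.IH H_linear ..
qed simp

text \<open>Symmetry of \<open>H\<close> in summed form: the real potential drops out, and the
  hopping terms combine to \<open>t k - t (k - 1)\<close>, whose two sums are equal because
  \<open>t\<close> is summable.\<close>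

lemma energy_identity:
  assumes u: "u \<in> l2"
  shows "(\<Sum>\<^sub>\<infinity>k. Im (cnj (u k) * op_minus_scalar H z u k)) = - Im z * sqnorm u"
proof -
  define t where "t k = Im (cnj (u k) * u (k + 1))" for k
  have "(\<lambda>k. (cmod (u k))\<^sup>2 + (cmod (u (k + 1)))\<^sup>2) summable_on UNIV"
    using u l2_shift[OF u, of 1] by (intro summable_on_add l2_summable)
  then have t: "t summable_on UNIV"
  proof (rule summable_on_domination)
    fix k
    have "\<bar>t k\<bar> \<le> cmod (u k) * cmod (u (k + 1))"
      unfolding t_def using abs_Im_le_cmod[of "cnj (u k) * u (k + 1)"] by (simp add: norm_mult)
    also have "\<dots> \<le> (cmod (u k))\<^sup>2 + (cmod (u (k + 1)))\<^sup>2"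
    proof -
      have "2 * (cmod (u k) * cmod (u (k + 1))) \<le> (cmod (u k))\<^sup>2 + (cmod (u (k + 1)))\<^sup>2"
        using sum_squares_bound[of "cmod (u k)" "cmod (u (k + 1))"] by (simp only: mult.assoc)
      moreover have "0 \<le> cmod (u k) * cmod (u (k + 1))" by simp
      ultimately show ?thesis by linarith
    qed
    finally show "\<bar>t k\<bar> \<le> (cmod (u k))\<^sup>2 + (cmod (u (k + 1)))\<^sup>2" .
  qed
  have t': "(\<lambda>k. t (k - 1)) summable_on UNIV" "(\<Sum>\<^sub>\<infinity>k. t (k - 1)) = infsum t UNIV"
    using summable_on_reindex_bij_betw[OF bij_add_int[of "-1"], of t]
      infsum_reindex_bij_betw[OF bij_add_int[of "-1"], of t] t by simp_all
  have eq: "Im (cnj (u k) * op_minus_scalar H z u k) = (t k + (- t (k - 1))) + (- Im z) * (cmod (u k))\<^sup>2" for k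
    unfolding op_minus_scalar_def H_apply t_def cmod_power2
    by (simp add: algebra_simps power2_eq_square)
  have "(\<Sum>\<^sub>\<infinity>k. Im (cnj (u k) * op_minus_scalar H z u k))
      = (infsum t UNIV + (- infsum t UNIV)) + (- Im z) * sqnorm u"
    unfolding eq sqnorm_def using t t' u
    by (subst infsum_add infsum_add | (intro summable_on_add summable_on_cmult_right l2_summable)
       | simp add: infsum_uminus summable_on_uminus infsum_cmult_right')+
  then show ?thesis by simp
qed

context
  fixes E :: "real set"
  assumes E: "compact E" and spec: "spectrum H \<subseteq> complex_of_real ` E"
begin

lemma in_resolvent_set: "z \<notin> complex_of_real ` E \<Longrightarrow> z \<in> resolvent_set H"
  using spec by (auto simp: spectrum_def)

lemma resolvent_l2:
  assumes "z \<notin> complex_of_real ` E" "f \<in> l2"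
  shows "resolvent H z f \<in> l2" "op_minus_scalar H z (resolvent H z f) = f"
  using in_resolvent_set[OF assms(1)] assms(2)
  by (auto simp: resolvent_set_def resolvent_def bij_betw_def inv_into_into f_inv_into_f)

lemma resolvent_unique:
  assumes "z \<notin> complex_of_real ` E" "u \<in> l2" "op_minus_scalar H z u = f"
  shows "resolvent H z f = u"
  using in_resolvent_set[OF assms(1)] assms(2,3)
  by (auto simp: resolvent_set_def resolvent_def bij_betw_def inv_into_f_f)

lemma resolvent_identity:
  assumes z: "z \<notin> complex_of_real ` E" and z0: "z0 \<notin> complex_of_real ` E" and f: "f \<in> l2"
  shows "resolvent H z f k = resolvent H z0 f k + (z - z0) * resolvent H z (resolvent H z0 f) k"
proof -
  let ?v = "resolvent H z0 f"
  let ?w = "resolvent H z ?v"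
  note v = resolvent_l2[OF z0 f]
  note w = resolvent_l2[OF z v(1)]
  have "resolvent H z f = (\<lambda>k. ?v k + (z - z0) * ?w k)"
  proof (rule resolvent_unique[OF z])
    show "(\<lambda>k. ?v k + (z - z0) * ?w k) \<in> l2" by (intro l2_add l2_scale v w)
    have "op_minus_scalar H z (\<lambda>k. ?v k + (z - z0) * ?w k) k
        = op_minus_scalar H z0 ?v k - (z - z0) * ?v k + (z - z0) * op_minus_scalar H z ?w k" for k
      by (simp add: op_minus_scalar_def H_apply algebra_simps)
    then show "op_minus_scalar H z (\<lambda>k. ?v k + (z - z0) * ?w k) = f"
      unfolding v(2) w(2) by auto
  qed
  then show ?thesis by simp
qed

text \<open>The resolvent set provides a bound at each point separately; perturbing the one at
  \<open>z0\<close> makes it uniform nearby, which continuity of the resolvent requires.\<close>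

lemma resolvent_locally_bounded:
  assumes z0: "z0 \<notin> complex_of_real ` E"
  shows "\<exists>d>0. \<exists>K. \<forall>z f. cmod (z - z0) < d \<and> z \<notin> complex_of_real ` E \<and> f \<in> l2
      \<longrightarrow> sqnorm (resolvent H z f) \<le> K * sqnorm f"
proof -
  obtain C0 where C0: "\<And>u. u \<in> l2 \<Longrightarrow> l2_norm u \<le> C0 * l2_norm (op_minus_scalar H z0 u)"
    using in_resolvent_set[OF z0] by (auto simp: resolvent_set_def)
  define C where "C = max 1 C0"
  have C: "sqnorm u \<le> C\<^sup>2 * sqnorm (op_minus_scalar H z0 u)" if "u \<in> l2" for u
  proof -
    have nn: "0 \<le> l2_norm v" for v
      using sqnorm_nonneg[of v] by (simp add: l2_norm_def sqnorm_def)
    have "l2_norm u \<le> C * l2_norm (op_minus_scalar H z0 u)"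
      using C0[OF that] mult_right_mono[OF _ nn, of C0 C "op_minus_scalar H z0 u"] by (simp add: C_def)
    then have "(l2_norm u)\<^sup>2 \<le> (C * l2_norm (op_minus_scalar H z0 u))\<^sup>2" by (intro power_mono nn)
    then show ?thesis by (simp add: power_mult_distrib l2_norm_sq)
  qed
  show ?thesis
  proof (intro exI conjI allI impI)
    \<comment> \<open>At this radius the perturbation costs at most half of
      \<open>sqnorm ?u\<close>; absorbing it on the left gives the constant
      \<open>4 * C\<^sup>2\<close>.\<close>
    show "0 < 1 / (2 * C)" by (simp add: C_def)
    fix z f assume a: "cmod (z - z0) < 1 / (2 * C) \<and> z \<notin> complex_of_real ` E \<and> f \<in> l2"
    let ?u = "resolvent H z f"
    have u: "?u \<in> l2" "op_minus_scalar H z ?u = f" using resolvent_l2 a by auto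
    have "op_minus_scalar H z0 ?u = (\<lambda>k. f k + (z - z0) * ?u k)"
    proof
      fix k
      have "H ?u k - z * ?u k = f k"
        using fun_cong[OF u(2), of k] by (simp only: op_minus_scalar_def)
      then have "H ?u k = f k + z * ?u k" by (simp only: diff_eq_eq)
      then show "op_minus_scalar H z0 ?u k = f k + (z - z0) * ?u k"
        unfolding op_minus_scalar_def by (simp only: left_diff_distrib add_diff_eq)
    qed
    then have "sqnorm (op_minus_scalar H z0 ?u) \<le> 2 * sqnorm f + 2 * ((cmod (z - z0))\<^sup>2 * sqnorm ?u)"
      using l2_add(2)[of f "\<lambda>k. (z - z0) * ?u k"] a l2_scale[OF u(1)] by (simp add: sqnorm_scale)
    then have "C\<^sup>2 * sqnorm (op_minus_scalar H z0 ?u) \<le> C\<^sup>2 * (2 * sqnorm f + 2 * ((cmod (z - z0))\<^sup>2 * sqnorm ?u))"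
      by (intro mult_left_mono) auto
    then have "sqnorm ?u \<le> 2 * C\<^sup>2 * sqnorm f + 2 * ((C * cmod (z - z0))\<^sup>2 * sqnorm ?u)"
      using C[OF u(1)] by (simp add: algebra_simps power_mult_distrib)
    moreover have "(C * cmod (z - z0))\<^sup>2 * sqnorm ?u \<le> (1/2)\<^sup>2 * sqnorm ?u"
    proof (intro mult_right_mono power_mono sqnorm_nonneg)
      have "0 < C" by (simp add: C_def)
      then show "C * cmod (z - z0) \<le> 1 / 2" using a by (simp add: field_simps)
    qed (auto simp: C_def)
    ultimately show "sqnorm ?u \<le> (4 * C\<^sup>2) * sqnorm f" by (simp add: power2_eq_square)
  qed
qed

lemma open_off_E: "open (- (complex_of_real ` E))"
  by (intro open_Compl compact_imp_closed compact_continuous_image continuous_intros E)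

lemma resolvent_coord_continuous:
  assumes z0: "z0 \<notin> complex_of_real ` E" and f: "f \<in> l2"
  shows "((\<lambda>z. resolvent H z f n) \<longlongrightarrow> resolvent H z0 f n) (at z0)"
proof -
  let ?v = "resolvent H z0 f"
  note v = resolvent_l2[OF z0 f]
  obtain d K where d: "0 < d" and K: "\<And>z f. cmod (z - z0) < d \<Longrightarrow> z \<notin> complex_of_real ` E \<Longrightarrow> f \<in> l2
      \<Longrightarrow> sqnorm (resolvent H z f) \<le> K * sqnorm f"
    using resolvent_locally_bounded[OF z0] by blast
  have near: "\<forall>\<^sub>F z in at z0. cmod (z - z0) < d \<and> z \<notin> complex_of_real ` E"
  proof (rule eventually_conj)
    show "\<forall>\<^sub>F z in at z0. cmod (z - z0) < d"
      using d unfolding eventually_at by (auto simp: dist_norm)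
    show "\<forall>\<^sub>F z in at z0. z \<notin> complex_of_real ` E"
      using eventually_at_in_open'[OF open_off_E, of z0] z0 by simp
  qed
  have "((\<lambda>z. resolvent H z f n - resolvent H z0 f n) \<longlongrightarrow> 0) (at z0)"
  proof (rule Lim_null_comparison)
    show "((\<lambda>z. cmod (z - z0) * sqrt (K * sqnorm ?v)) \<longlongrightarrow> 0) (at z0)"
      by (rule tendsto_eq_intros refl | simp)+
    show "\<forall>\<^sub>F z in at z0. cmod (resolvent H z f n - resolvent H z0 f n) \<le> cmod (z - z0) * sqrt (K * sqnorm ?v)"
      using near
    proof eventually_elim
      case (elim z)
      let ?w = "resolvent H z ?v"
      have "?w \<in> l2" using resolvent_l2 elim v(1) by auto
      then have "(cmod (?w n))\<^sup>2 \<le> K * sqnorm ?v"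
        using coord_le_sqnorm[of ?w n] K[of z ?v] elim v(1) by linarith
      then have "cmod (?w n) \<le> sqrt (K * sqnorm ?v)" by (rule real_le_rsqrt)
      moreover have "resolvent H z f n - resolvent H z0 f n = (z - z0) * ?w n"
        using resolvent_identity[OF _ z0 f, of z n] elim by simp
      ultimately show ?case by (simp add: norm_mult mult_left_mono)
    qed
  qed
  then show ?thesis by (simp add: LIM_zero_iff)
qed

lemma green_eq: "green n z H = resolvent H z (delta n) n"
  by (simp add: green_def l2_inner_delta)

text \<open>By the resolvent identity the difference quotient is a coordinate of
  \<open>resolvent H z ?v\<close>, whose continuity at \<open>z0\<close> is known.\<close>

lemma green_holomorphic: "(\<lambda>z. green n z H) holomorphic_on - (complex_of_real ` E)"
  unfolding holomorphic_on_def
proof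
  fix z0 assume "z0 \<in> - (complex_of_real ` E)"
  then have z0: "z0 \<notin> complex_of_real ` E" by simp
  let ?v = "resolvent H z0 (delta n)"
  have v: "?v \<in> l2" by (rule resolvent_l2[OF z0 delta_in_l2])
  have "((\<lambda>z. (green n z H - green n z0 H) / (z - z0)) \<longlongrightarrow> resolvent H z0 ?v n) (at z0)"
  proof (rule Lim_transform_eventually[OF resolvent_coord_continuous[OF z0 v, of n]])
    have "\<forall>\<^sub>F z in at z0. z \<notin> complex_of_real ` E \<and> z \<noteq> z0"
      using eventually_at_in_open[OF open_off_E, of z0] z0 by simp
    then show "\<forall>\<^sub>F z in at z0. resolvent H z ?v n = (green n z H - green n z0 H) / (z - z0)"
      by eventually_elim (use resolvent_identity[OF _ z0 delta_in_l2, of _ n n] in \<open>auto simp: green_eq\<close>)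
  qed
  then have "((\<lambda>z. green n z H) has_field_derivative resolvent H z0 ?v n) (at z0)"
    by (simp add: has_field_derivative_iff)
  then show "(\<lambda>z. green n z H) field_differentiable at z0 within - (complex_of_real ` E)"
    using field_differentiable_def field_differentiable_at_within by blast
qed

text \<open>The energy identity for \<open>u = resolvent H z (delta n)\<close>: since
  \<open>op_minus_scalar H z u\<close> is \<open>delta n\<close>, its left side reduces to
  \<open>- Im (u n)\<close>.\<close>

lemma Im_green:
  assumes z: "z \<notin> complex_of_real ` E"
  shows "Im (green n z H) = Im z * sqnorm (resolvent H z (delta n))"
    and "0 < sqnorm (resolvent H z (delta n))"
proof -
  let ?u = "resolvent H z (delta n)"
  note u = resolvent_l2[OF z delta_in_l2, of n]
  have "(\<Sum>\<^sub>\<infinity>k. Im (cnj (?u k) * delta n k)) = (\<Sum>\<^sub>\<infinity>k\<in>{n}. Im (cnj (?u k) * delta n k))"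
    by (rule infsum_cong_neutral) (auto simp: delta_def)
  also have "\<dots> = - Im (?u n)" by (simp add: delta_def)
  finally show "Im (green n z H) = Im z * sqnorm ?u"
    using energy_identity[OF u(1), of z] unfolding u(2) green_eq by simp
  show "0 < sqnorm ?u"
  proof (rule ccontr)
    assume "\<not> 0 < sqnorm ?u"
    then have "(cmod (?u k))\<^sup>2 \<le> 0" for k using coord_le_sqnorm[OF u(1), of k] by linarith
    then have "?u k = 0" for k by simp
    then have "op_minus_scalar H z ?u n = 0" by (simp add: op_minus_scalar_def H_apply)
    then show False unfolding u(2) by (simp add: delta_def)
  qed
qed

text \<open>The equation \<open>z * u = H u - delta n\<close> gives
  \<open>S * cmod z \<le> (2 + B) * S + 1\<close> for the supremum \<open>S\<close>. Membership in
  \<open>l2\<close> makes \<open>S\<close> finite, so the inequality can be solved for it.\<close>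

lemma resolvent_sup_bound:
  assumes z: "z \<notin> complex_of_real ` E" "2 + B < cmod z"
  shows "cmod (resolvent H z (delta n) k) \<le> 1 / (cmod z - (2 + B))"
proof -
  let ?u = "resolvent H z (delta n)"
  note u = resolvent_l2[OF z(1) delta_in_l2, of n]
  have bdd: "bdd_above (range (\<lambda>k. cmod (?u k)))"
  proof (rule bdd_aboveI2)
    show "cmod (?u k) \<le> sqrt (sqnorm ?u)" for k
      by (rule real_le_rsqrt[OF coord_le_sqnorm[OF u(1)]])
  qed
  define S where "S = (SUP k. cmod (?u k))"
  have le: "cmod (?u k) \<le> S" for k unfolding S_def by (rule cSUP_upper[OF _ bdd]) simp
  have coord: "cmod (?u k) \<le> ((2 + B) * S + 1) / cmod z" for k
  proof -
    have "z * ?u k = H ?u k - delta n k"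
      using fun_cong[OF u(2), of k] by (simp add: op_minus_scalar_def algebra_simps)
    then have "cmod z * cmod (?u k) \<le> cmod (H ?u k) + cmod (delta n k)"
      by (metis norm_mult norm_triangle_ineq4)
    also have "\<dots> \<le> (2 + B) * S + 1"
      using H_iterate_bound[of ?u S 1 k] le by (intro add_mono) (auto simp: delta_def)
    finally show ?thesis using z(2) B_nonneg by (subst pos_le_divide_eq) (auto simp: mult.commute)
  qed
  have "S \<le> ((2 + B) * S + 1) / cmod z"
    unfolding S_def by (rule cSUP_least) (use coord in \<open>simp_all add: S_def\<close>)
  moreover have "0 < cmod z" using z(2) B_nonneg by linarith
  ultimately have "S * cmod z \<le> (2 + B) * S + 1" by (simp only: pos_le_divide_eq)
  then have "S * (cmod z - (2 + B)) \<le> 1" by (simp add: algebra_simps)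
  then have "S \<le> 1 / (cmod z - (2 + B))" using z(2) by (simp add: field_simps)
  with le[of k] show ?thesis by linarith
qed

text \<open>The Neumann series of the resolvent, obtained by iterating \<open>ueq\<close>; the
  remainder decays geometrically because \<open>cmod z\<close> exceeds \<open>2 + B\<close>.\<close>

lemma green_expansion:
  assumes z: "z \<notin> complex_of_real ` E" "2 + B < cmod z"
  shows "(\<lambda>j. of_real (walk V j n n) / z ^ (j + 1)) sums (- green n z H)"
proof -
  let ?u = "resolvent H z (delta n)"
  note u = resolvent_l2[OF z(1) delta_in_l2, of n]
  have z0: "z \<noteq> 0" using z(2) B_nonneg by auto
  have ueq: "?u = (\<lambda>k. inverse z * (H ?u k - delta n k))"
  proof
    fix k
    have "z * ?u k = H ?u k - delta n k"
      using fun_cong[OF u(2), of k] by (simp add: op_minus_scalar_def algebra_simps)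
    then show "?u k = inverse z * (H ?u k - delta n k)" using z0 by (simp add: field_simps)
  qed
  have part: "(\<Sum>j<N. of_real (walk V j n n) / z ^ (j + 1)) = - ?u n + (H ^^ N) ?u n / z ^ N" for N
  proof (induction N)
    case (Suc N)
    have "(H ^^ N) ?u n = (H ^^ N) (\<lambda>k. inverse z * (H ?u k - delta n k)) n"
      using ueq by (rule arg_cong[where f = "\<lambda>w. (H ^^ N) w n"])
    also have "\<dots> = inverse z * ((H ^^ N) (H ?u) n - of_real (walk V N n n))"
      by (simp only: H_iterate_linear H_iterate_delta)
    also have "(H ^^ N) (H ?u) = (H ^^ Suc N) ?u" by (simp only: funpow_Suc_right o_apply)
    finally have "(H ^^ N) ?u n = inverse z * ((H ^^ Suc N) ?u n - of_real (walk V N n n))" .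
    then show ?case unfolding sum.lessThan_Suc Suc.IH using z0 by (simp add: field_simps del: funpow.simps)
  qed simp
  define D where "D = 1 / (cmod z - (2 + B))"
  have "(\<lambda>N. (H ^^ N) ?u n / z ^ N) \<longlonglongrightarrow> 0"
  proof (rule Lim_null_comparison)
    have "cmod ((H ^^ N) ?u n) \<le> (2 + B) ^ N * D" for N
      by (rule H_iterate_bound) (use resolvent_sup_bound[OF z] in \<open>simp add: D_def\<close>)
    then show "\<forall>\<^sub>F N in sequentially. cmod ((H ^^ N) ?u n / z ^ N) \<le> ((2 + B) / cmod z) ^ N * D"
      by (intro always_eventually allI) (simp add: norm_divide norm_power power_divide divide_right_mono)
    have "(\<lambda>N. ((2 + B) / cmod z) ^ N) \<longlonglongrightarrow> 0"
      using z(2) B_nonneg by (intro LIMSEQ_power_zero) (simp add: divide_less_eq)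
    then show "(\<lambda>N. ((2 + B) / cmod z) ^ N * D) \<longlonglongrightarrow> 0" by (rule tendsto_mult_left_zero)
  qed
  then have "(\<lambda>N. - ?u n + (H ^^ N) ?u n / z ^ N) \<longlonglongrightarrow> - ?u n + 0" by (intro tendsto_intros)
  then show ?thesis unfolding sums_def part green_eq by simp
qed

lemma off_E_of_large: "\<exists>M>2+B. \<forall>z. M < cmod z \<longrightarrow> z \<notin> complex_of_real ` E"
proof -
  obtain b where b: "\<And>x. x \<in> E \<Longrightarrow> \<bar>x\<bar> \<le> b" using compact_imp_bounded[OF E] by (auto simp: bounded_iff)
  show ?thesis
    by (intro exI[of _ "max b (2 + B) + 1"]) (use b in \<open>fastforce simp: norm_of_real\<close>)
qed

lemma green_asymptotics: "((\<lambda>z. z * green n z H) \<longlongrightarrow> -1) at_infinity"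
proof -
  obtain M where M: "2 + B < M" "\<And>z. M < cmod z \<Longrightarrow> z \<notin> complex_of_real ` E"
    using off_E_of_large by blast
  have "((\<lambda>z. z * green n z H + 1) \<longlongrightarrow> 0) at_infinity"
  proof (rule Lim_null_comparison)
    have "filterlim (\<lambda>z::complex. - (2 + B) + cmod z) at_top at_infinity"
      by (rule filterlim_tendsto_add_at_top[OF tendsto_const filterlim_norm_at_top])
    then have "((\<lambda>z::complex. (2 + B) / (- (2 + B) + cmod z)) \<longlongrightarrow> 0) at_infinity"
      by (intro real_tendsto_divide_at_top[OF tendsto_const])
    moreover have "- (2 + B) + cmod z = cmod z - (2 + B)" for z by simp
    ultimately show "((\<lambda>z::complex. (2 + B) / (cmod z - (2 + B))) \<longlongrightarrow> 0) at_infinity" by (simp only:)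
    have "\<forall>\<^sub>F z::complex in at_infinity. M < cmod z"
      by (rule filterlim_at_top_dense[THEN iffD1, rule_format, OF filterlim_norm_at_top])
    then show "\<forall>\<^sub>F z in at_infinity. cmod (z * green n z H + 1) \<le> (2 + B) / (cmod z - (2 + B))"
    proof eventually_elim
      case (elim z)
      have z: "z \<notin> complex_of_real ` E" "2 + B < cmod z" using M elim by auto
      let ?u = "resolvent H z (delta n)"
      have "z * ?u n + 1 = H ?u n"
        using fun_cong[OF resolvent_l2(2)[OF z(1) delta_in_l2, of n], of n]
        by (simp add: op_minus_scalar_def delta_def algebra_simps)
      moreover have "cmod (H ?u n) \<le> (2 + B) * (1 / (cmod z - (2 + B)))"
        using H_iterate_bound[of ?u "1 / (cmod z - (2 + B))" 1 n] resolvent_sup_bound[OF z] by simp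
      ultimately show ?case by (simp add: green_eq)
    qed
  qed
  then have "((\<lambda>z. (z * green n z H + 1) - 1) \<longlongrightarrow> 0 - 1) at_infinity" by (intro tendsto_intros)
  then show ?thesis by simp
qed

lemma herglotz_off_green: "herglotz_off E (\<lambda>z. green n z H)"
proof
  show "compact E" by (rule E)
  show "(\<lambda>z. green n z H) holomorphic_on - (complex_of_real ` E)" by (rule green_holomorphic)
  show "0 < Im (green n z H)" if "0 < Im z" for z
  proof -
    have "z \<notin> complex_of_real ` E" using that by auto
    from Im_green[OF this, of n] that show ?thesis by simp
  qed
  show "Im (green n (of_real x) H) = 0" if "x \<notin> E" for x
    using Im_green(1)[of "of_real x" n] that by (auto simp: image_iff)
  show "((\<lambda>z. z * green n z H) \<longlongrightarrow> -1) at_infinity" by (rule green_asymptotics)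
qed

end

end

text \<open>The series \<open>C\<close> depends on the edges alone, so one sequence serves every
  site \<open>n\<close> although the zeros of the Green function move with \<open>n\<close>. No
  relation involves the scale, so \<open>l\<close> is free.\<close>

theorem (in finite_gap_set) dso_finite_gap_data:
  assumes H: "is_dso H" "H \<in> isospectral_torus bands"
  shows "\<exists>V c. \<forall>l. Spectral_data l V c e \<in> finite_gap_data g"
proof -
  obtain V where V: "bounded (range V)" "H = jacobi_op (\<lambda>_. 1) V" using H(1) by (auto simp: is_dso_def)
  then obtain B where "\<And>n. \<bar>V n\<bar> \<le> B" by (auto simp: bounded_iff)
  then interpret bounded_dso V B by unfold_locales
  have spec: "spectrum (jacobi_op (\<lambda>_. 1) V) \<subseteq> complex_of_real ` bands"
    and refl: "reflectionless (jacobi_op (\<lambda>_. 1) V) bands"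
    using H(2) V(2) by (auto simp: isospectral_torus_def)
  obtain M where M: "2 + B < M" "\<And>z. M < cmod z \<Longrightarrow> z \<notin> complex_of_real ` bands"
    using off_E_of_large[OF compact_bands spec] by blast
  have "0 < M" using M B_nonneg by simp
  obtain C :: "real fps" where C: "C\<^sup>2 = (\<Prod>k<2*g+2. 1 - fps_const (e k) * fps_X)" "fps_nth C 0 = 1"
  proof (rule fps_sqrt_exists)
    have "fps_nth (\<Prod>k<m. 1 - fps_const (a k) * fps_X) 0 = 1" for m and a :: "nat \<Rightarrow> real"
      by (induction m) auto
    then show "fps_nth (\<Prod>k<2*g+2. 1 - fps_const (e k) * fps_X) 0 = 1" .
  qed
  have "(\<Sum>i\<le>j. fps_nth C i * walk V (j - i) n n) = 0" if j: "g < j" for n j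
  proof -
    interpret herglotz_off bands "\<lambda>z. green n z (jacobi_op (\<lambda>_. 1) V)"
      by (rule herglotz_off_green[OF compact_bands spec])
    interpret reflectionless_herglotz g e "\<lambda>z. green n z (jacobi_op (\<lambda>_. 1) V)"
      by unfold_locales (use refl in \<open>auto simp: reflectionless_def\<close>)
    show ?thesis
    proof (rule moments_vanish[OF _ \<open>0 < M\<close> _ C j])
      show "walk V 0 n n = 1" by simp
      show "(\<lambda>j. of_real (walk V j n n) / z ^ (j + 1)) sums (- green n z (jacobi_op (\<lambda>_. 1) V))"
        if "M < cmod z" for z
        by (rule green_expansion[OF compact_bands spec]) (use M that in auto)
    qed
  qed
  then have "Spectral_data l V (\<lambda>i. fps_nth C i) e \<in> finite_gap_data g" for l
    by (intro finite_gap_dataI C)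
  then show ?thesis by blast
qed

section \<open>Capacity under expanding maps\<close>

lemma log_kernel_measurable [measurable]:
  "(\<lambda>p. log_kernel (fst p) (snd p)) \<in> borel_measurable (borel \<Otimes>\<^sub>M borel)"
  unfolding log_kernel_def by measurable

definition carried_by :: "real set \<Rightarrow> real measure \<Rightarrow> bool" where
  "carried_by E \<mu> \<longleftrightarrow> prob_space \<mu> \<and> sets \<mu> = sets borel \<and> emeasure \<mu> (- E) = 0"

definition pos_energy :: "real measure \<Rightarrow> ennreal" where
  "pos_energy \<mu> = (\<integral>\<^sup>+x. (\<integral>\<^sup>+y. e2ennreal (log_kernel x y) \<partial>\<mu>) \<partial>\<mu>)"

definition neg_energy :: "real measure \<Rightarrow> ennreal" where
  "neg_energy \<mu> = (\<integral>\<^sup>+x. (\<integral>\<^sup>+y. e2ennreal (- log_kernel x y) \<partial>\<mu>) \<partial>\<mu>)"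

context
  fixes E :: "real set" and \<mu> :: "real measure"
  assumes E: "compact E" and \<mu>: "carried_by E \<mu>"
begin

lemma carried_prob: "prob_space \<mu>" and carried_sets [measurable_cong]: "sets \<mu> = sets borel"
  using \<mu> by (auto simp: carried_by_def)

lemma carried_AE: "AE x in \<mu>. x \<in> E"
proof (rule AE_I')
  show "- E \<in> null_sets \<mu>"
    using \<mu> compact_imp_closed[OF E] by (intro null_setsI) (auto simp: carried_by_def)
qed (use sets_eq_imp_space_eq[OF carried_sets] in auto)

lemma carried_nn_integral: "(\<integral>\<^sup>+x\<in>E. f x \<partial>\<mu>) = (\<integral>\<^sup>+x. f x \<partial>\<mu>)"
  by (rule nn_integral_cong_AE) (use carried_AE in \<open>auto elim!: eventually_mono\<close>)

lemma log_energy_eq: "log_energy E \<mu> = enn2ereal (pos_energy \<mu>) - enn2ereal (neg_energy \<mu>)"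
  unfolding log_energy_def pos_energy_def neg_energy_def carried_nn_integral ..

lemma neg_energy_le:
  assumes D: "1 \<le> D" "\<And>x y. x \<in> E \<Longrightarrow> y \<in> E \<Longrightarrow> \<bar>x - y\<bar> \<le> D"
  shows "neg_energy \<mu> \<le> ennreal (ln D)"
proof -
  interpret prob_space \<mu> by (rule carried_prob)
  have "neg_energy \<mu> \<le> (\<integral>\<^sup>+x. (\<integral>\<^sup>+y. ennreal (ln D) \<partial>\<mu>) \<partial>\<mu>)"
    unfolding neg_energy_def
  proof (rule nn_integral_mono_AE)
    show "AE x in \<mu>. (\<integral>\<^sup>+y. e2ennreal (- log_kernel x y) \<partial>\<mu>) \<le> (\<integral>\<^sup>+y. ennreal (ln D) \<partial>\<mu>)"
      using carried_AE
    proof eventually_elim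
      case (elim x)
      show ?case
      proof (rule nn_integral_mono_AE)
        show "AE y in \<mu>. e2ennreal (- log_kernel x y) \<le> ennreal (ln D)"
          using carried_AE
        proof eventually_elim
          case (elim y)
          show ?case
          proof (cases "x = y")
            case False
            then have "ln \<bar>x - y\<bar> \<le> ln D" using D \<open>x \<in> E\<close> elim by simp
            then have "- log_kernel x y \<le> ereal (ln D)"
              using False by (simp add: log_kernel_def ln_div)
            then have "e2ennreal (- log_kernel x y) \<le> e2ennreal (ereal (ln D))" by (rule e2ennreal_mono)
            then show ?thesis by (simp add: e2ennreal_ereal)
          qed (simp add: log_kernel_def e2ennreal_neg)
        qed
      qed
    qed
  qed
  also have "\<dots> = ennreal (ln D)" by (simp add: emeasure_space_1)
  finally show ?thesis .
qed

end

lemma compact_diameter: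
  fixes E :: "real set"
  assumes "compact E"
  obtains D where "1 \<le> D" "\<And>x y. x \<in> E \<Longrightarrow> y \<in> E \<Longrightarrow> \<bar>x - y\<bar> \<le> D"
proof -
  obtain b where b: "\<And>x. x \<in> E \<Longrightarrow> \<bar>x\<bar> \<le> b" using compact_imp_bounded[OF assms] by (auto simp: bounded_iff)
  show thesis
  proof (rule that[of "max 1 (2 * b)"])
    show "\<bar>x - y\<bar> \<le> max 1 (2 * b)" if "x \<in> E" "y \<in> E" for x y
      using b[OF that(1)] b[OF that(2)] by linarith
  qed simp
qed

lemma neg_energy_finite:
  assumes "compact E" "carried_by E \<mu>"
  shows "neg_energy \<mu> < top"
proof -
  obtain D where D: "1 \<le> D" "\<And>x y. x \<in> E \<Longrightarrow> y \<in> E \<Longrightarrow> \<bar>x - y\<bar> \<le> D" using compact_diameter[OF assms(1)] by blast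
  have "neg_energy \<mu> \<le> ennreal (ln D)" by (rule neg_energy_le[OF assms]) (use D in auto)
  also have "\<dots> < top" by (rule ennreal_less_top)
  finally show ?thesis .
qed

lemma capacity_eq: "capacity E = Sup ((\<lambda>\<mu>. exp_minus (log_energy E \<mu>)) ` {\<mu>. carried_by E \<mu>})"
  unfolding capacity_def carried_by_def by (rule arg_cong[of _ _ Sup]) auto

text \<open>A real supremum is informative only for bounded sets. Distances in \<open>E\<close> are
  at most \<open>D\<close>, so energies are at least \<open>- ln D\<close>.\<close>

lemma exp_minus_energy_bdd:
  assumes "compact E"
  shows "bdd_above ((\<lambda>\<mu>. exp_minus (log_energy E \<mu>)) ` {\<mu>. carried_by E \<mu>})"
proof -
  obtain D where D: "1 \<le> D" "\<And>x y. x \<in> E \<Longrightarrow> y \<in> E \<Longrightarrow> \<bar>x - y\<bar> \<le> D" using compact_diameter[OF assms] by blast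
  show ?thesis
  proof (rule bdd_aboveI2)
    fix \<mu> assume "\<mu> \<in> {\<mu>. carried_by E \<mu>}"
    then have \<mu>: "carried_by E \<mu>" by simp
    have nf: "neg_energy \<mu> < top" by (rule neg_energy_finite[OF assms \<mu>])
    obtain n where n: "neg_energy \<mu> = ennreal n" "0 \<le> n" using nf by (cases "neg_energy \<mu>") auto
    have nD: "n \<le> ln D" using neg_energy_le[OF assms \<mu> D] n D(1) by (simp add: ennreal_le_iff)
    show "exp_minus (log_energy E \<mu>) \<le> D"
    proof (cases "pos_energy \<mu>")
      case (real p)
      then have "log_energy E \<mu> = ereal (p - n)"
        using n by (simp add: log_energy_eq[OF assms \<mu>] enn2ereal_ennreal)
      then have "exp_minus (log_energy E \<mu>) = exp (n - p)" by (simp add: exp_minus_def)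
      also have "\<dots> \<le> exp (ln D)" using nD real by simp
      finally show ?thesis using D(1) by simp
    next
      case top
      then have "log_energy E \<mu> = \<infinity>"
        using n by (simp add: log_energy_eq[OF assms \<mu>] enn2ereal_ennreal)
      then show ?thesis using D(1) by (simp add: exp_minus_def)
    qed
  qed
qed

lemma carried_by_return: "closed E \<Longrightarrow> x \<in> E \<Longrightarrow> carried_by E (return borel x)"
  unfolding carried_by_def by (auto simp: prob_space_return)

lemma capacity_nonneg:
  assumes "compact E" "E \<noteq> {}"
  shows "0 \<le> capacity E"
proof -
  obtain x where "x \<in> E" using assms by auto
  then have "carried_by E (return borel x)" using compact_imp_closed[OF assms(1)] by (intro carried_by_return)
  then have "exp_minus (log_energy E (return borel x)) \<le> capacity E"
    unfolding capacity_eq by (intro cSup_upper exp_minus_energy_bdd assms) auto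
  moreover have "0 \<le> exp_minus t" for t by (simp add: exp_minus_def)
  ultimately show ?thesis using order_trans by blast
qed

lemma carried_by_distr:
  assumes E: "closed E" and \<mu>: "carried_by E' \<mu>" and E': "closed E'"
    and \<psi>: "\<psi> \<in> borel_measurable borel" "\<And>x. x \<in> E' \<Longrightarrow> \<psi> x \<in> E"
  shows "carried_by E (distr \<mu> borel \<psi>)"
  unfolding carried_by_def
proof (intro conjI)
  have s: "sets \<mu> = sets borel" using \<mu> by (simp add: carried_by_def)
  have m: "\<psi> \<in> measurable \<mu> borel" using \<psi>(1) measurable_cong_sets[OF s refl] by blast
  show "prob_space (distr \<mu> borel \<psi>)"
    using \<mu> m by (intro prob_space.prob_space_distr) (auto simp: carried_by_def)
  have "emeasure (distr \<mu> borel \<psi>) (- E) = emeasure \<mu> (\<psi> -` (- E) \<inter> space \<mu>)"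
    using E by (intro emeasure_distr m) auto
  also have "\<dots> \<le> emeasure \<mu> (- E')"
    using \<psi>(2) E' s by (intro emeasure_mono) auto
  also have "\<dots> = 0" using \<mu> by (simp add: carried_by_def)
  finally show "emeasure (distr \<mu> borel \<psi>) (- E) = 0" by simp
qed simp

text \<open>The inequality \<open>a \<le> b + ereal c\<close> with negative parts moved to the
  opposite side: all terms become nonnegative and can be integrated without a difference of
  infinities.\<close>

lemma ereal_pos_neg_parts:
  fixes a b :: ereal
  assumes "b \<noteq> -\<infinity>" "a \<noteq> -\<infinity>" "a \<le> b + ereal c"
  shows "e2ennreal a + e2ennreal (- b) + ennreal (- c) \<le> e2ennreal b + e2ennreal (- a) + ennreal c"
proof (cases b)
  case (real b')
  with assms obtain a' where a: "a = ereal a'" by (cases a) auto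
  have split: "ennreal x + ennreal y + ennreal z = ennreal (max 0 x + max 0 y + max 0 z)" for x y z
    by (simp add: ennreal_max_0)
  show ?thesis unfolding real a uminus_ereal.simps e2ennreal_ereal split
    by (rule ennreal_leI) (use assms(3) real a in auto)
qed (use assms in \<open>auto simp: e2ennreal_infty\<close>)

text \<open>Transporting measures along a map that contracts distances by at most the factor \<open>1/L\<close> raises the energy by at
  most \<open>ln L\<close>.\<close>

theorem capacity_le_expanding:
  assumes E: "compact E" and E': "compact E'" "E' \<noteq> {}" and L: "0 < L"
    and \<psi>: "\<psi> \<in> borel_measurable borel" "\<And>x. x \<in> E' \<Longrightarrow> \<psi> x \<in> E"
    and dist: "\<And>x y. x \<in> E' \<Longrightarrow> y \<in> E' \<Longrightarrow> \<bar>x - y\<bar> \<le> L * \<bar>\<psi> x - \<psi> y\<bar>"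
  shows "capacity E' \<le> L * capacity E"
  unfolding capacity_eq[of E']
proof (rule cSup_least)
  obtain x where "x \<in> E'" using E'(2) by auto
  then have "carried_by E' (return borel x)" using compact_imp_closed[OF E'(1)] by (intro carried_by_return)
  then show "(\<lambda>\<mu>. exp_minus (log_energy E' \<mu>)) ` {\<mu>. carried_by E' \<mu>} \<noteq> {}" by auto
next
  fix t assume "t \<in> (\<lambda>\<mu>. exp_minus (log_energy E' \<mu>)) ` {\<mu>. carried_by E' \<mu>}"
  then obtain \<mu> where \<mu>: "carried_by E' \<mu>" and t: "t = exp_minus (log_energy E' \<mu>)" by auto
  interpret prob_space \<mu> by (rule carried_prob[OF E'(1) \<mu>])
  have s [measurable_cong]: "sets \<mu> = sets borel" by (rule carried_sets[OF E'(1) \<mu>])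
  define \<nu> where "\<nu> = distr \<mu> borel \<psi>"
  have \<nu>: "carried_by E \<nu>"
    unfolding \<nu>_def by (rule carried_by_distr[OF compact_imp_closed[OF E] \<mu> compact_imp_closed[OF E'(1)] \<psi>])
  note [measurable] = \<psi>(1)
  have pm: "measurable (borel \<Otimes>\<^sub>M \<mu>) N = measurable (borel \<Otimes>\<^sub>M borel) N" for N :: "ennreal measure"
    by (intro measurable_cong_sets sets_pair_measure_cong) (auto simp: s)
  have \<psi>m: "\<psi> \<in> measurable \<mu> borel"
    by (subst measurable_cong_sets[OF s refl]) (rule \<psi>(1))
  have tr: "(\<integral>\<^sup>+x. (\<integral>\<^sup>+y. h (x, y) \<partial>\<nu>) \<partial>\<nu>) = (\<integral>\<^sup>+x. (\<integral>\<^sup>+y. h (\<psi> x, \<psi> y) \<partial>\<mu>) \<partial>\<mu>)"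
    if [measurable]: "h \<in> borel_measurable (borel \<Otimes>\<^sub>M borel)" for h :: "real \<times> real \<Rightarrow> ennreal"
  proof -
    have hx: "(\<lambda>y. h (x, y)) \<in> borel_measurable borel" for x by measurable
    have "(\<lambda>(x, y). h (x, \<psi> y)) \<in> borel_measurable (borel \<Otimes>\<^sub>M borel)" by measurable
    then have hm: "(\<lambda>x. \<integral>\<^sup>+y. h (x, \<psi> y) \<partial>\<mu>) \<in> borel_measurable borel"
      by (intro borel_measurable_nn_integral) (simp add: pm)
    have inner: "(\<integral>\<^sup>+y. h (x, y) \<partial>\<nu>) = (\<integral>\<^sup>+y. h (x, \<psi> y) \<partial>\<mu>)" for x
      unfolding \<nu>_def by (rule nn_integral_distr[of \<psi> \<mu> borel "\<lambda>y. h (x, y)"]) (use \<psi>m hx in simp_all)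
    have "(\<integral>\<^sup>+x. (\<integral>\<^sup>+y. h (x, \<psi> y) \<partial>\<mu>) \<partial>\<nu>) = (\<integral>\<^sup>+x. (\<integral>\<^sup>+y. h (\<psi> x, \<psi> y) \<partial>\<mu>) \<partial>\<mu>)"
      unfolding \<nu>_def by (rule nn_integral_distr[of \<psi> \<mu> borel "\<lambda>x. \<integral>\<^sup>+y. h (x, \<psi> y) \<partial>\<mu>"]) (use \<psi>m hm in simp_all)
    then show ?thesis unfolding inner .
  qed
  let ?k = "\<lambda>x y. log_kernel x y" and ?l = "\<lambda>x y. log_kernel (\<psi> x) (\<psi> y)"
  have P: "pos_energy \<nu> = (\<integral>\<^sup>+x. (\<integral>\<^sup>+y. e2ennreal (?l x y) \<partial>\<mu>) \<partial>\<mu>)"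
    unfolding pos_energy_def using tr[of "\<lambda>p. e2ennreal (log_kernel (fst p) (snd p))"] by simp
  have N: "neg_energy \<nu> = (\<integral>\<^sup>+x. (\<integral>\<^sup>+y. e2ennreal (- ?l x y) \<partial>\<mu>) \<partial>\<mu>)"
    unfolding neg_energy_def using tr[of "\<lambda>p. e2ennreal (- log_kernel (fst p) (snd p))"] by simp
  \<comment> \<open>\<open>L\<close> may be below 1, so \<open>c\<close> has either sign; of
    \<open>ennreal c\<close> and \<open>ennreal (- c)\<close> at most one is nonzero.\<close>
  define c where "c = ln L"
  have pt: "e2ennreal (?l x y) + e2ennreal (- ?k x y) + ennreal (- c) \<le> e2ennreal (?k x y) + e2ennreal (- ?l x y) + ennreal c"
    if xy: "x \<in> E'" "y \<in> E'" for x y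
  proof (rule ereal_pos_neg_parts)
    show "?l x y \<le> ?k x y + ereal c"
    proof (cases "x = y")
      case False
      then have ne: "\<psi> x \<noteq> \<psi> y" using dist[OF xy] by auto
      have "ln \<bar>x - y\<bar> \<le> ln (L * \<bar>\<psi> x - \<psi> y\<bar>)" using dist[OF xy] False by simp
      also have "\<dots> = c + ln \<bar>\<psi> x - \<psi> y\<bar>" unfolding c_def using L ne by (intro ln_mult_pos) auto
      finally show ?thesis using False ne by (simp add: log_kernel_def ln_div)
    qed (simp add: log_kernel_def)
  qed (auto simp: log_kernel_def)
  have pair: "(\<lambda>x. \<integral>\<^sup>+y. h (x, y) \<partial>\<mu>) \<in> borel_measurable \<mu>"
    if h: "h \<in> borel_measurable (borel \<Otimes>\<^sub>M borel)" for h :: "real \<times> real \<Rightarrow> ennreal"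
  proof -
    have "(\<lambda>(x, y). h (x, y)) \<in> borel_measurable (borel \<Otimes>\<^sub>M \<mu>)" using h by (simp add: pm)
    then have "(\<lambda>x. \<integral>\<^sup>+y. h (x, y) \<partial>\<mu>) \<in> borel_measurable borel"
      by (intro borel_measurable_nn_integral) simp
    then show ?thesis by (subst measurable_cong_sets[OF s refl])
  qed
  have m1 [measurable]: "(\<lambda>p. log_kernel (\<psi> (fst p)) (\<psi> (snd p))) \<in> borel_measurable (borel \<Otimes>\<^sub>M borel)"
    using measurable_compose[of "\<lambda>p. (\<psi> (fst p), \<psi> (snd p))" "borel \<Otimes>\<^sub>M borel" "borel \<Otimes>\<^sub>M borel",
        OF _ log_kernel_measurable] by simp
  have meas: "(\<lambda>y. e2ennreal (?k x y)) \<in> borel_measurable \<mu>" "(\<lambda>y. e2ennreal (- ?k x y)) \<in> borel_measurable \<mu>"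
    "(\<lambda>y. e2ennreal (?l x y)) \<in> borel_measurable \<mu>" "(\<lambda>y. e2ennreal (- ?l x y)) \<in> borel_measurable \<mu>" for x
    unfolding log_kernel_def measurable_cong_sets[OF s refl] by measurable
  have meas2: "(\<lambda>x. \<integral>\<^sup>+y. e2ennreal (?k x y) \<partial>\<mu>) \<in> borel_measurable \<mu>"
    "(\<lambda>x. \<integral>\<^sup>+y. e2ennreal (- ?k x y) \<partial>\<mu>) \<in> borel_measurable \<mu>"
    "(\<lambda>x. \<integral>\<^sup>+y. e2ennreal (?l x y) \<partial>\<mu>) \<in> borel_measurable \<mu>"
    "(\<lambda>x. \<integral>\<^sup>+y. e2ennreal (- ?l x y) \<partial>\<mu>) \<in> borel_measurable \<mu>"
    using pair[of "\<lambda>p. e2ennreal (log_kernel (fst p) (snd p))"] pair[of "\<lambda>p. e2ennreal (- log_kernel (fst p) (snd p))"]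
      pair[of "\<lambda>p. e2ennreal (log_kernel (\<psi> (fst p)) (\<psi> (snd p)))"]
      pair[of "\<lambda>p. e2ennreal (- log_kernel (\<psi> (fst p)) (\<psi> (snd p)))"] by simp_all
  have c1: "(\<integral>\<^sup>+x. (a::ennreal) \<partial>\<mu>) = a" for a by (simp add: emeasure_space_1)
  have add3: "(\<integral>\<^sup>+x. f x + h x + a \<partial>\<mu>) = (\<integral>\<^sup>+x. f x \<partial>\<mu>) + (\<integral>\<^sup>+x. h x \<partial>\<mu>) + a"
    if [measurable]: "f \<in> borel_measurable \<mu>" "h \<in> borel_measurable \<mu>" for f h and a :: ennreal
    using nn_integral_add[of "\<lambda>x. f x + h x" \<mu> "\<lambda>_. a"] nn_integral_add[of f \<mu> h] that
    by (simp add: emeasure_space_1)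
  have ineq: "pos_energy \<nu> + neg_energy \<mu> + ennreal (- c) \<le> pos_energy \<mu> + neg_energy \<nu> + ennreal c"
  proof -
    have "pos_energy \<nu> + neg_energy \<mu> + ennreal (- c)
        = (\<integral>\<^sup>+x. (\<integral>\<^sup>+y. e2ennreal (?l x y) + e2ennreal (- ?k x y) + ennreal (- c) \<partial>\<mu>) \<partial>\<mu>)"
      unfolding P neg_energy_def[of \<mu>] by (simp only: add3 meas meas2)
    also have "\<dots> \<le> (\<integral>\<^sup>+x. (\<integral>\<^sup>+y. e2ennreal (?k x y) + e2ennreal (- ?l x y) + ennreal c \<partial>\<mu>) \<partial>\<mu>)"
    proof (rule nn_integral_mono_AE)
      show "AE x in \<mu>. (\<integral>\<^sup>+y. e2ennreal (?l x y) + e2ennreal (- ?k x y) + ennreal (- c) \<partial>\<mu>)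
          \<le> (\<integral>\<^sup>+y. e2ennreal (?k x y) + e2ennreal (- ?l x y) + ennreal c \<partial>\<mu>)"
        using carried_AE[OF E'(1) \<mu>]
      proof eventually_elim
        case (elim x)
        show ?case
          by (rule nn_integral_mono_AE) (use carried_AE[OF E'(1) \<mu>] pt elim in \<open>auto elim!: eventually_mono\<close>)
      qed
    qed
    also have "\<dots> = pos_energy \<mu> + neg_energy \<nu> + ennreal c"
      unfolding N pos_energy_def[of \<mu>] by (simp only: add3 meas meas2)
    finally show ?thesis .
  qed
  have "t \<le> L * exp_minus (log_energy E \<nu>)"
  proof (cases "pos_energy \<mu>")
    case (real p)
    obtain n where n: "neg_energy \<mu> = ennreal n" "0 \<le> n"
      using neg_energy_finite[OF E'(1) \<mu>] by (cases "neg_energy \<mu>") auto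
    obtain n' where n': "neg_energy \<nu> = ennreal n'" "0 \<le> n'"
      using neg_energy_finite[OF E \<nu>] by (cases "neg_energy \<nu>") auto
    \<comment> \<open>The integrated inequality transfers finiteness of the energy from \<mu> to its
      image \<nu>.\<close>
    obtain p' where p': "pos_energy \<nu> = ennreal p'" "0 \<le> p'"
      using ineq unfolding real n n' by (cases "pos_energy \<nu>") (auto simp: top_unique ennreal_plus[symmetric] simp del: ennreal_plus)
    have p: "0 \<le> p" "pos_energy \<mu> = ennreal p" using real by auto
    have "ennreal (p' + n + max 0 (- c)) \<le> ennreal (p + n' + max 0 c)"
      using ineq p'(2) n(2) n'(2) p(1) unfolding p(2) n(1) n'(1) p'(1)
      by (simp add: ennreal_max_0)
    then have "p' + n + max 0 (- c) \<le> p + n' + max 0 c"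
      using p(1) n'(2) by (subst (asm) ennreal_le_iff) auto
    then have "p' - n' \<le> p - n + c" by linarith
    moreover have "t = exp (- (p - n))"
      using real n by (simp add: t exp_minus_def log_energy_eq[OF E'(1) \<mu>] enn2ereal_ennreal)
    moreover have "exp_minus (log_energy E \<nu>) = exp (- (p' - n'))"
      using p' n' by (simp add: exp_minus_def log_energy_eq[OF E \<nu>] enn2ereal_ennreal)
    moreover have "L * exp (- (p' - n')) = exp (c - (p' - n'))"
    proof -
      have "L = exp c" using L by (simp add: c_def)
      then have "L * exp (- (p' - n')) = exp c * exp (- (p' - n'))" by simp
      then show ?thesis by (simp only: mult_exp_exp) simp
    qed
    ultimately show ?thesis by simp
  next
    case top
    obtain n where n: "neg_energy \<mu> = ennreal n" "0 \<le> n"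
      using neg_energy_finite[OF E'(1) \<mu>] by (cases "neg_energy \<mu>") auto
    then have "t = 0" using top by (simp add: t exp_minus_def log_energy_eq[OF E'(1) \<mu>] enn2ereal_ennreal)
    then show ?thesis using L by (simp add: exp_minus_def)
  qed
  also have "exp_minus (log_energy E \<nu>) \<le> capacity E"
    unfolding capacity_eq by (rule cSup_upper[OF _ exp_minus_energy_bdd[OF E]]) (use \<nu> in auto)
  finally show "t \<le> L * capacity E" using L by simp
qed

section \<open>Edges of finite-gap compacts\<close>

context finite_gap_set
begin

lemma bands_in_gap_compacts: "bands \<in> gap_compacts g"
proof -
  define I where "I i = {e (2*i)..e (2*i+1)}" for i
  have lt: "e (2*i) < e (2*i+1)" if "i \<le> g" for i using that by (intro e_mono) auto
  have disj: "I i \<inter> I j = {}" if "i < j" "j \<le> g" for i j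
    using e_mono[of "2*i+1" "2*j"] that by (auto simp: I_def)
  have inj: "inj_on I {..g}"
  proof (rule inj_onI)
    fix i j assume ij: "i \<in> {..g}" "j \<in> {..g}" "I i = I j"
    have "I i \<noteq> {}" using lt[of i] ij by (auto simp: I_def)
    then show "i = j" using disj[of i j] disj[of j i] ij by (cases i j rule: linorder_cases) auto
  qed
  have "disjoint (I ` {..g})"
    unfolding disjoint_def
  proof (intro ballI impI)
    fix A B assume "A \<in> I ` {..g}" "B \<in> I ` {..g}" "A \<noteq> B"
    then obtain i j where ij: "i \<le> g" "j \<le> g" "A = I i" "B = I j" "i \<noteq> j" by auto
    then show "A \<inter> B = {}" using disj[of i j] disj[of j i] by (cases "i < j") auto
  qed
  moreover have "card (I ` {..g}) = g + 1" using card_image[OF inj] by simp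
  moreover have "\<forall>J\<in>I ` {..g}. \<exists>c d. c < d \<and> J = {c..d}" using lt by (auto simp: I_def)
  moreover have "bands = \<Union> (I ` {..g})" by (auto simp: bands_def I_def)
  ultimately show ?thesis unfolding gap_compacts_def by (intro CollectI exI[of _ "I ` {..g}"]) auto
qed

lemma edge_in_bands: "k \<le> 2*g+1 \<Longrightarrow> e k \<in> bands"
proof -
  assume k: "k \<le> 2*g+1"
  show ?thesis
  proof (cases "even k")
    case True
    then obtain i where i: "k = 2*i" by (elim evenE)
    then show ?thesis using k e_mono[of "2*i" "2*i+1"] unfolding bands_def by (intro UN_I[of i]) auto
  next
    case False
    then obtain i where i: "k = 2*i+1" by (elim oddE)
    then show ?thesis using k e_mono[of "2*i" "2*i+1"] unfolding bands_def by (intro UN_I[of i]) auto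
  qed
qed

lemma frontier_bands: "frontier bands = e ` {..<2*g+2}"
proof
  show "frontier bands \<subseteq> e ` {..<2*g+2}"
  proof
    fix x assume "x \<in> frontier bands"
    then have x: "x \<in> bands" "x \<notin> interior bands"
      using compact_imp_closed[OF compact_bands] by (auto simp: frontier_def closure_closed)
    then obtain i where i: "i \<le> g" "e (2*i) \<le> x" "x \<le> e (2*i+1)" by (auto simp: bands_def)
    have "{e (2*i)<..<e (2*i+1)} \<subseteq> interior bands"
      by (rule interior_maximal) (use i in \<open>force simp: bands_def\<close>)+
    with x i have "x = e (2*i) \<or> x = e (2*i+1)" by force
    then show "x \<in> e ` {..<2*g+2}" using i by auto
  qed
  show "e ` {..<2*g+2} \<subseteq> frontier bands"
  proof safe
    fix k assume "k < 2*g+2"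
    then have k: "k \<le> 2*g+1" by simp
    have "e k \<notin> interior bands"
    proof
      assume "e k \<in> interior bands"
      then obtain r where r: "0 < r" "ball (e k) r \<subseteq> bands" by (auto simp: mem_interior)
      show False
      proof (cases "even k")
        case True
        then obtain i where i: "k = 2*i" by (elim evenE)
        show False
        proof (cases i)
          case 0
          have "e 0 - r / 2 \<in> bands" using r i 0 by (auto simp: dist_real_def)
          then show False using bands_ge[of "e 0 - r / 2"] r by simp
        next
          case (Suc j)
          \<comment> \<open>A point of the gap ending at \<open>e k\<close>, within distance
            \<open>r / 2\<close> of \<open>e k\<close>: the closer of two candidates.\<close>
          define y where "y = max (e k - r / 2) ((e (2*j+1) + e k) / 2)"
          have lt: "e (2*j+1) < e k" using k i Suc by (intro e_mono) auto
          have y: "e k - r / 2 \<le> y" "y < e k" "e (2*j+1) < y"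
            using lt r(1) unfolding y_def by (auto simp: less_max_iff_disj)
          then have "y \<in> ball (e k) r" using r(1) by (auto simp: dist_real_def)
          then have "y \<in> bands" using r by auto
          moreover have "e (2*j+1) < y" "y < e (2*j+2)" using y i Suc by auto
          ultimately show False using gap_disjoint[of j] i Suc k by (auto simp: disjoint_iff)
        qed
      next
        case False
        then obtain i where i: "k = 2*i+1" by (elim oddE)
        show False
        proof (cases "i = g")
          case True
          have "e k + r / 2 \<in> bands" using r by (auto simp: dist_real_def)
          then show False using bands_le[of "e k + r / 2"] r i True by simp
        next
          case False
          define y where "y = min (e k + r / 2) ((e k + e (2*i+2)) / 2)"
          have lt: "e k < e (2*i+2)" using k i False by (intro e_mono) auto
          have y: "y \<le> e k + r / 2" "e k < y" "y < e (2*i+2)"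
            using lt r(1) unfolding y_def by (auto simp: min_less_iff_disj)
          then have "y \<in> ball (e k) r" using r(1) by (auto simp: dist_real_def)
          then have "y \<in> bands" using r by auto
          moreover have "e (2*i+1) < y" "y < e (2*i+2)" using y i by auto
          ultimately show False using gap_disjoint[of i] i False k by (auto simp: disjoint_iff)
        qed
      qed
    qed
    then show "e k \<in> frontier bands"
      using edge_in_bands[OF k] compact_imp_closed[OF compact_bands] by (simp add: frontier_def closure_closed)
  qed
qed

lemma endpoints_bands: "endpoints g bands = restrict e {..<2*g+2}"
proof -
  have "sorted_wrt (<) (map e [0..<2*g+2])"
    unfolding sorted_wrt_map by (rule sorted_wrt_mono_rel[OF _ sorted_wrt_upt]) (auto intro: e_mono)
  then have s: "sorted (map e [0..<2*g+2])" "distinct (map e [0..<2*g+2])"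
    by (auto simp: strict_sorted_iff)
  have "sorted_list_of_set (frontier bands) = map e [0..<2*g+2]"
  proof -
    have "set (map e [0..<2*g+2]) = e ` {..<2*g+2}" by (simp only: set_map set_upt atLeast0LessThan)
    then show ?thesis
      using sorted_list_of_set.idem_if_sorted_distinct[OF s] unfolding frontier_bands by (simp only:)
  qed
  then show ?thesis unfolding endpoints_def by (auto simp: fun_eq_iff restrict_def simp del: upt_Suc)
qed

end

text \<open>The induction removes the interval with the largest left end; disjointness puts it to
  the right of all others, so its ends become the last two edges.\<close>

lemma gap_compacts_enumerate:
  "finite \<I> \<Longrightarrow> card \<I> = n + 1 \<Longrightarrow> disjoint \<I> \<Longrightarrow> (\<forall>I\<in>\<I>. \<exists>c d. c < d \<and> I = {c..d::real}) \<Longrightarrow>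
   \<exists>e. finite_gap_set n e \<and> \<Union>\<I> = finite_gap_set.bands n e"
proof (induction n arbitrary: \<I>)
  case 0
  then obtain I where "\<I> = {I}" by (auto simp: card_1_singleton_iff)
  with 0 obtain c d where I: "\<I> = {{c..d}}" "c < d" by auto
  have f: "finite_gap_set 0 (\<lambda>k. if k = 0 then c else d)" by unfold_locales (use I in auto)
  then show ?case using I(1)
    by (intro exI[of _ "\<lambda>k. if k = 0 then c else d"]) (auto simp: finite_gap_set.bands_def[OF f])
next
  case (Suc n)
  have ne: "\<I> \<noteq> {}" using Suc.prems by auto
  obtain I where I: "I \<in> \<I>" "\<And>J. J \<in> \<I> \<Longrightarrow> Inf J \<le> Inf I"
  proof -
    have "Max (Inf ` \<I>) \<in> Inf ` \<I>" using Suc.prems ne by (intro Max_in) auto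
    then obtain I where "I \<in> \<I>" "Inf I = Max (Inf ` \<I>)" by auto
    then show thesis using that[of I] Suc.prems by (auto intro: Max_ge)
  qed
  obtain c d where cd: "c < d" "I = {c..d}" using Suc.prems I by blast
  have "\<exists>e. finite_gap_set n e \<and> \<Union>(\<I> - {I}) = finite_gap_set.bands n e"
    by (rule Suc.IH) (use Suc.prems I in \<open>auto simp: pairwise_subset disjoint_def\<close>)
  then obtain e where e: "finite_gap_set n e" "\<Union>(\<I> - {I}) = finite_gap_set.bands n e" by blast
  interpret f: finite_gap_set n e by fact
  have "e (2*n+1) \<in> \<Union>(\<I> - {I})" unfolding e(2) by (rule f.edge_in_bands) simp
  then obtain J where J: "J \<in> \<I>" "J \<noteq> I" "e (2*n+1) \<in> J" by auto
  then obtain c' d' where J': "c' < d'" "J = {c'..d'}" using Suc.prems by blast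
  have "I \<inter> J = {}" using Suc.prems(3) I J by (auto simp: disjoint_def)
  moreover have "c' \<le> c" using I(2)[OF J(1)] cd J' by simp
  ultimately have "d' < c" using cd J' by (auto simp: disjoint_iff)
  then have ec: "e (2*n+1) < c" using J J' by auto
  define e' where "e' k = (if k = 2*n+2 then c else if k = 2*n+3 then d else e k)" for k
  have f': "finite_gap_set (Suc n) e'"
  proof
    fix k assume k: "k < 2 * Suc n + 1"
    have "k < 2*n+1 \<or> k = 2*n+1 \<or> k = 2*n+2" using k by arith
    then consider "k < 2*n+1" | "k = 2*n+1" | "k = 2*n+2" by blast
    then show "e' k < e' (Suc k)"
    proof cases
      case 1
      then show ?thesis using f.e_step[OF 1] by (simp add: e'_def)
    qed (use ec cd in \<open>auto simp: e'_def\<close>)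
  qed
  have "\<Union>\<I> = I \<union> \<Union>(\<I> - {I})" using I by auto
  also have "\<dots> = finite_gap_set.bands (Suc n) e'"
    unfolding e(2) f.bands_def finite_gap_set.bands_def[OF f'] atMost_Suc
    using cd by (auto simp: e'_def)
  finally show ?case using f' by blast
qed

lemma gap_compactsE:
  assumes "E \<in> gap_compacts n"
  obtains e where "finite_gap_set n e" "E = finite_gap_set.bands n e"
  using assms gap_compacts_enumerate[of _ n] unfolding gap_compacts_def by blast

lemma gap_compacts_endpoints:
  assumes "E \<in> gap_compacts n"
  shows "finite_gap_set n (endpoints n E)" and "finite_gap_set.bands n (endpoints n E) = E"
proof -
  obtain e where e: "finite_gap_set n e" "E = finite_gap_set.bands n e" by (rule gap_compactsE[OF assms])
  interpret finite_gap_set n e by fact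
  have r: "endpoints n E = restrict e {..<2*n+2}" unfolding e(2) by (rule endpoints_bands)
  show f: "finite_gap_set n (endpoints n E)"
    unfolding r by unfold_locales (use e_step in auto)
  show "finite_gap_set.bands n (endpoints n E) = E"
  proof -
    have "finite_gap_set.bands n (endpoints n E) = (\<Union>i\<le>n. {endpoints n E (2*i)..endpoints n E (2*i+1)})"
      by (rule finite_gap_set.bands_def[OF f])
    also have "\<dots> = bands" unfolding r bands_def by auto
    finally show ?thesis using e(2) by simp
  qed
qed

text \<open>The number of boundary points determines the number of gaps.\<close>

lemma gap_compacts_disjoint:
  assumes "E \<in> gap_compacts n" "E \<in> gap_compacts m"
  shows "n = m"
proof -
  have card: "card (frontier E) = 2*k+2" if "E \<in> gap_compacts k" for k
  proof -
    interpret finite_gap_set k "endpoints k E" by (rule gap_compacts_endpoints[OF that])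
    have "inj_on (endpoints k E) {..<2*k+2}"
      by (rule linorder_inj_onI) (use e_mono in \<open>force+\<close>)
    then show ?thesis using frontier_bands gap_compacts_endpoints(2)[OF that] by (simp add: card_image)
  qed
  show ?thesis using card[OF assms(1)] card[OF assms(2)] by simp
qed

lemma gap_compacts_scale:
  assumes E: "E \<in> gap_compacts n" and t: "0 < t"
  shows "(\<lambda>x. t * x) ` E \<in> gap_compacts n"
    and "i < 2*n+2 \<Longrightarrow> endpoints n ((\<lambda>x. t * x) ` E) i = t * endpoints n E i"
proof -
  interpret f: finite_gap_set n "endpoints n E" by (rule gap_compacts_endpoints[OF E])
  interpret s: finite_gap_set n "\<lambda>k. t * endpoints n E k"
    by unfold_locales (use f.e_step t in simp)
  have "(\<lambda>x. t * x) ` E = (\<lambda>x. t * x) ` f.bands" using gap_compacts_endpoints(2)[OF E] by simp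
  also have "\<dots> = s.bands" unfolding f.bands_def s.bands_def image_UN using t by simp
  finally have eq: "(\<lambda>x. t * x) ` E = s.bands" .
  show "(\<lambda>x. t * x) ` E \<in> gap_compacts n" unfolding eq by (rule s.bands_in_gap_compacts)
  show "endpoints n ((\<lambda>x. t * x) ` E) i = t * endpoints n E i" if "i < 2*n+2"
    unfolding eq s.endpoints_bands using that by simp
qed

lemma compact_gap: "E \<in> gap_compacts n \<Longrightarrow> compact E" and gap_nonempty: "E \<in> gap_compacts n \<Longrightarrow> E \<noteq> {}"
  using finite_gap_set.compact_bands[OF gap_compacts_endpoints(1)] gap_compacts_endpoints(2)
    finite_gap_set.edge_in_bands[OF gap_compacts_endpoints(1), of E n 0] by auto

text \<open>The map \<open>x \<mapsto> x + \<Sum>\<^sub>k (e'\<^sub>k - e\<^sub>k) h\<^sub>k(x)\<close>, where \<open>h\<^sub>k\<close> is the hat function of width \<open>\<delta>\<close> around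
  \<open>e\<^sub>k\<close>, moves the edges \<open>e\<close> to the edges \<open>e'\<close> and is nearly isometric.\<close>

lemma capacity_bands_le:
  assumes e: "finite_gap_set g e" and e': "finite_gap_set g e'" and \<delta>: "0 < \<delta>"
    and gaps: "\<And>k. k < 2*g+1 \<Longrightarrow> e k + \<delta> \<le> e (Suc k)"
    and close: "\<And>k. k < 2*g+2 \<Longrightarrow> \<bar>e' k - e k\<bar> \<le> \<epsilon>"
    and \<kappa>: "\<kappa> = (2*real g+2) * \<epsilon> / \<delta>" "\<kappa> < 1"
  shows "(1 - \<kappa>) * capacity (finite_gap_set.bands g e) \<le> capacity (finite_gap_set.bands g e')"
proof -
  interpret e: finite_gap_set g e by fact
  interpret e': finite_gap_set g e' by fact
  define h where "h k x = max 0 (1 - \<bar>x - e k\<bar> / \<delta>)" for k x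
  define \<psi> where "\<psi> x = x + (\<Sum>k<2*g+2. (e' k - e k) * h k x)" for x
  have h_lip: "\<bar>h k x - h k y\<bar> \<le> \<bar>x - y\<bar> / \<delta>" for k x y
  proof -
    have "\<bar>\<bar>x - e k\<bar> / \<delta> - \<bar>y - e k\<bar> / \<delta>\<bar> \<le> \<bar>x - y\<bar> / \<delta>"
      unfolding diff_divide_distrib[symmetric] abs_divide using \<delta> by (simp add: divide_right_mono)
    then show ?thesis unfolding h_def by linarith
  qed
  \<comment> \<open>There are \<open>2*g+2\<close> hats, each of slope at most
    \<open>1 / \<delta>\<close> and multiplied by at most \<epsilon>; this is the origin of
    \<kappa>.\<close>
  have \<psi>_lip: "\<bar>(\<psi> x - \<psi> y) - (x - y)\<bar> \<le> \<kappa> * \<bar>x - y\<bar>" for x y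
  proof -
    have "(\<psi> x - \<psi> y) - (x - y) = (\<Sum>k<2*g+2. (e' k - e k) * (h k x - h k y))"
      unfolding \<psi>_def by (simp add: sum_subtractf right_diff_distrib del: sum.lessThan_Suc)
    also have "\<bar>\<dots>\<bar> \<le> (\<Sum>k<2*g+2. \<epsilon> * (\<bar>x - y\<bar> / \<delta>))"
    proof (rule order_trans[OF sum_abs sum_mono])
      fix k assume "k \<in> {..<2*g+2}"
      then have c: "\<bar>e' k - e k\<bar> \<le> \<epsilon>" using close by simp
      then show "\<bar>(e' k - e k) * (h k x - h k y)\<bar> \<le> \<epsilon> * (\<bar>x - y\<bar> / \<delta>)"
        unfolding abs_mult using h_lip by (intro mult_mono) auto
    qed
    also have "\<dots> = \<kappa> * \<bar>x - y\<bar>" by (simp add: \<kappa>(1) field_simps del: sum.lessThan_Suc)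
    finally show ?thesis .
  qed
  have mono: "\<psi> x \<le> \<psi> y" if "x \<le> y" for x y
  proof -
    have "\<kappa> * \<bar>x - y\<bar> \<le> 1 * \<bar>x - y\<bar>" using \<kappa>(2) by (intro mult_right_mono) auto
    then have "\<kappa> * \<bar>x - y\<bar> \<le> y - x" using that by simp
    then show ?thesis using abs_le_D1[OF \<psi>_lip[of x y]] by linarith
  qed
  \<comment> \<open>Edges are at least the hat width apart, so each hat vanishes at every edge but
    its own.\<close>
  have far: "\<delta> \<le> \<bar>e j - e k\<bar>" if "j \<noteq> k" "j < 2*g+2" "k < 2*g+2" for j k
  proof -
    have lt: "e i + \<delta> \<le> e l" if "i < l" "l < 2*g+2" for i l
      using gaps[of i] e.e_mono_le[of "Suc i" l] that by simp
    show ?thesis using lt[of j k] lt[of k j] that by (cases "j < k") auto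
  qed
  have node: "\<psi> (e j) = e' j" if j: "j < 2*g+2" for j
  proof -
    have z: "h k (e j) = (if k = j then 1 else 0)" if "k < 2*g+2" for k
      using far[of j k] that j \<delta> by (auto simp: h_def le_divide_eq)
    have "(\<Sum>k<2*g+2. (e' k - e k) * h k (e j)) = (\<Sum>k<2*g+2. if k = j then e' k - e k else 0)"
      by (rule sum.cong) (auto simp: z)
    then show ?thesis using j by (simp add: \<psi>_def del: sum.lessThan_Suc)
  qed
  have "capacity e.bands \<le> 1 / (1 - \<kappa>) * capacity e'.bands"
  proof (rule capacity_le_expanding[where \<psi> = \<psi>])
    show "compact e.bands" "compact e'.bands" by (rule e.compact_bands e'.compact_bands)+
    show "e.bands \<noteq> {}" using e.edge_in_bands[of 0] by auto
    show "0 < 1 / (1 - \<kappa>)" using \<kappa>(2) by simp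
    show "\<psi> \<in> borel_measurable borel" unfolding \<psi>_def h_def by measurable
    show "\<psi> x \<in> e'.bands" if "x \<in> e.bands" for x
    proof -
      from that obtain i where i: "i \<le> g" "e (2*i) \<le> x" "x \<le> e (2*i+1)" by (auto simp: e.bands_def)
      then show ?thesis using mono[OF i(2)] mono[OF i(3)] node[of "2*i"] node[of "2*i+1"]
        unfolding e'.bands_def by (intro UN_I[of i]) auto
    qed
    show "\<bar>x - y\<bar> \<le> 1 / (1 - \<kappa>) * \<bar>\<psi> x - \<psi> y\<bar>" for x y
    proof -
      have "\<bar>x - y\<bar> * (1 - \<kappa>) \<le> \<bar>\<psi> x - \<psi> y\<bar>" using \<psi>_lip[of x y] by (simp add: algebra_simps)
      then show ?thesis using \<kappa>(2) by (simp add: pos_le_divide_eq)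
    qed
  qed
  then show ?thesis using \<kappa>(2) by (simp add: pos_le_divide_eq mult.commute)
qed

lemma capacity_scale:
  assumes E: "compact E" "E \<noteq> {}" and t: "0 < t"
  shows "capacity ((\<lambda>x. t * x) ` E) = t * capacity E"
proof (rule antisym)
  let ?F = "(\<lambda>x. t * x) ` E"
  have F: "compact ?F" "?F \<noteq> {}" using E by (auto intro!: compact_continuous_image continuous_intros)
  show "capacity ?F \<le> t * capacity E"
    by (rule capacity_le_expanding[where \<psi> = "\<lambda>x. x / t"])
       (use E F t in \<open>auto simp: abs_mult simp flip: right_diff_distrib diff_divide_distrib\<close>)
  have "capacity E \<le> 1 / t * capacity ?F"
    by (rule capacity_le_expanding[where \<psi> = "\<lambda>x. t * x"])
       (use E F t in \<open>auto simp: abs_mult simp flip: right_diff_distrib\<close>)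
  then show "t * capacity E \<le> capacity ?F" using t by (simp add: field_simps)
qed

section \<open>Zero sets of polynomials\<close>

definition exponents :: "nat \<Rightarrow> nat \<Rightarrow> (nat \<Rightarrow> nat) set" where
  "exponents m q = PiE {..<m} (\<lambda>_. {..<q})"

definition polyval :: "nat \<Rightarrow> nat \<Rightarrow> ((nat \<Rightarrow> nat) \<Rightarrow> real) \<Rightarrow> (nat \<Rightarrow> real) \<Rightarrow> real" where
  "polyval m q a x = (\<Sum>\<alpha>\<in>exponents m q. a \<alpha> * (\<Prod>k<m. x k ^ \<alpha> k))"

lemma finite_exponents: "finite (exponents m q)"
  unfolding exponents_def by (intro finite_PiE) auto

lemma exponents_Suc:
  "exponents (Suc m) q = (\<lambda>(j, \<beta>). \<beta>(m := j)) ` ({..<q} \<times> exponents m q)"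
  unfolding exponents_def lessThan_Suc by (rule PiE_insert_eq)

lemma polyval_cong: "(\<And>k. k < m \<Longrightarrow> x k = y k) \<Longrightarrow> polyval m q a x = polyval m q a y"
  unfolding polyval_def by (intro sum.cong refl arg_cong2[of _ _ _ _ "(*)"] prod.cong) auto

lemma polyval_Suc:
  "polyval (Suc m) q a x = (\<Sum>j<q. polyval m q (\<lambda>\<beta>. a (\<beta>(m := j))) x * x m ^ j)"
proof -
  have inj: "inj_on (\<lambda>(j, \<beta>). \<beta>(m := j)) ({..<q} \<times> exponents m q)"
    unfolding exponents_def by (rule inj_combinator) simp
  have "polyval (Suc m) q a x
      = (\<Sum>(j, \<beta>)\<in>{..<q} \<times> exponents m q. a (\<beta>(m := j)) * (\<Prod>k<Suc m. x k ^ (\<beta>(m := j)) k))"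
    unfolding polyval_def exponents_Suc by (subst sum.reindex[OF inj]) (simp add: case_prod_beta o_def)
  also have "\<dots> = (\<Sum>j<q. \<Sum>\<beta>\<in>exponents m q. a (\<beta>(m := j)) * (\<Prod>k<m. x k ^ \<beta> k) * x m ^ j)"
    unfolding sum.cartesian_product[symmetric]
    by (intro sum.cong refl) (auto simp: mult.assoc intro!: prod.cong)
  finally show ?thesis by (simp add: polyval_def sum_distrib_right)
qed

lemma polyval_fun_upd: "polyval m q a (x(m := t)) = polyval m q a x"
  by (rule polyval_cong) auto

lemma polyval_roots_finite:
  assumes "j < q" "polyval m q (\<lambda>\<beta>. a (\<beta>(m := j))) x \<noteq> 0"
  shows "finite {t. polyval (Suc m) q a (x(m := t)) = 0}"
proof -
  define P where "P = (\<Sum>j<q. Polynomial.monom (polyval m q (\<lambda>\<beta>. a (\<beta>(m := j))) x) j)"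
  have "poly P t = polyval (Suc m) q a (x(m := t))" for t
    unfolding polyval_Suc P_def by (simp add: poly_sum poly_monom polyval_fun_upd)
  moreover have "Polynomial.coeff P j = polyval m q (\<lambda>\<beta>. a (\<beta>(m := j))) x"
    using assms(1) by (simp add: P_def Polynomial.coeff_sum)
  then have "P \<noteq> 0" using assms(2) by auto
  ultimately show ?thesis using poly_roots_finite[of P] by simp
qed

lemma exponents_SucE:
  assumes "\<exists>\<alpha>\<in>exponents (Suc m) q. a \<alpha> \<noteq> 0"
  obtains j where "j < q" "\<exists>\<beta>\<in>exponents m q. a (\<beta>(m := j)) \<noteq> 0"
  using assms unfolding exponents_Suc by auto

lemma polyval_nonzero_exists:
  "\<exists>\<alpha>\<in>exponents m q. a \<alpha> \<noteq> 0 \<Longrightarrow> \<exists>x. polyval m q a x \<noteq> 0"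
proof (induction m arbitrary: a)
  case 0
  then show ?case by (simp add: polyval_def exponents_def)
next
  case (Suc m)
  then obtain j where j: "j < q" "\<exists>\<beta>\<in>exponents m q. a (\<beta>(m := j)) \<noteq> 0" by (elim exponents_SucE)
  from Suc.IH[OF j(2)] obtain x where "polyval m q (\<lambda>\<beta>. a (\<beta>(m := j))) x \<noteq> 0" by blast
  from polyval_roots_finite[where a = a and x = x, OF j(1) this] obtain t where "t \<notin> {t. polyval (Suc m) q a (x(m := t)) = 0}"
    using ex_new_if_finite[OF infinite_UNIV_char_0] by blast
  then show ?case by blast
qed

lemma polyval_measurable:
  "polyval m q a \<in> borel_measurable (PiM {..<m} (\<lambda>_. lborel))"
proof -
  have [measurable]: "(\<lambda>x. x k) \<in> borel_measurable (PiM {..<m} (\<lambda>_. lborel))" if "k \<in> {..<m}" for k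
    using measurable_component_singleton[OF that, of "\<lambda>_. lborel"] by simp
  show ?thesis unfolding polyval_def by measurable
qed

text \<open>Fubini in the last variable: for almost all values of the others some coefficient is
  nonzero by induction, and then only finitely many values of the last one are roots.\<close>

lemma polyval_AE_nonzero:
  "\<exists>\<alpha>\<in>exponents m q. a \<alpha> \<noteq> 0 \<Longrightarrow> AE x in PiM {..<m} (\<lambda>_. lborel). polyval m q a x \<noteq> 0"
proof (induction m arbitrary: a)
  case 0
  then show ?case by (simp add: polyval_def exponents_def)
next
  case (Suc m)
  interpret product_sigma_finite "\<lambda>_::nat. lborel :: real measure" by standard
  obtain j where j: "j < q" "\<exists>\<beta>\<in>exponents m q. a (\<beta>(m := j)) \<noteq> 0" using Suc.prems by (elim exponents_SucE)
  let ?M = "PiM {..<Suc m} (\<lambda>_. lborel :: real measure)" and ?M' = "PiM {..<m} (\<lambda>_. lborel :: real measure)"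
  define N where "N = {x \<in> space ?M. polyval (Suc m) q a x = 0}"
  have N: "N \<in> sets ?M" unfolding N_def using polyval_measurable[of "Suc m" q a] by measurable
  have "emeasure ?M N = (\<integral>\<^sup>+x. indicator N x \<partial>?M)" using N by simp
  also have "\<dots> = (\<integral>\<^sup>+x. (\<integral>\<^sup>+t. indicator N (x(m := t)) \<partial>lborel) \<partial>?M')"
    unfolding lessThan_Suc
    by (rule product_nn_integral_insert) (use N in \<open>auto simp: lessThan_Suc\<close>)
  also have "\<dots> = (\<integral>\<^sup>+x. 0 \<partial>?M')"
  proof (rule nn_integral_cong_AE)
    show "AE x in ?M'. (\<integral>\<^sup>+t. indicator N (x(m := t)) \<partial>lborel) = 0"
      using Suc.IH[OF j(2)]
    proof eventually_elim
      case (elim x)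
      let ?Z = "{t. polyval (Suc m) q a (x(m := t)) = 0}"
      have fin: "finite ?Z" by (rule polyval_roots_finite[where a = a and x = x, OF j(1) elim])
      have "(\<integral>\<^sup>+t. indicator N (x(m := t)) \<partial>lborel) \<le> (\<integral>\<^sup>+t. indicator ?Z t \<partial>lborel)"
        by (intro nn_integral_mono) (auto simp: N_def indicator_def)
      also have "\<dots> = emeasure lborel ?Z" by (rule nn_integral_indicator) (simp add: borel_closed finite_imp_closed fin)
      also have "\<dots> = 0" by (rule emeasure_lborel_countable) (use fin in \<open>rule countable_finite\<close>)
      finally show ?case by simp
    qed
  qed
  finally have "N \<in> null_sets ?M" using N by (auto simp: null_sets_def)
  then show ?case by (rule AE_I') (auto simp: N_def)
qed

text \<open>On the line through \<open>x\<close> and \<open>p\<close> the polynomial has one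
  variable and is nonzero at \<open>s = 1\<close>. This allows leaving the zero set by arbitrarily
  small steps.\<close>

lemma polyval_line_finite:
  assumes "polyval m q a p \<noteq> 0"
  shows "finite {s. polyval m q a (\<lambda>k. x k + s * (p k - x k)) = 0}"
proof -
  define P where "P = (\<Sum>\<alpha>\<in>exponents m q. smult (a \<alpha>) (\<Prod>k<m. [:x k, p k - x k:] ^ \<alpha> k))"
  have P: "poly P s = polyval m q a (\<lambda>k. x k + s * (p k - x k))" for s
    unfolding polyval_def P_def by (simp add: poly_sum poly_prod)
  have "poly P 1 \<noteq> 0" using assms by (simp add: P)
  then have "P \<noteq> 0" by auto
  then show ?thesis using poly_roots_finite[of P] by (simp add: P)
qed

lemma polyval_continuous_map:
  "continuous_map (powertop_real {..<m}) euclideanreal (\<lambda>x. polyval m q a (\<lambda>k. l * x k))"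
  unfolding polyval_def
  by (intro continuous_map_sum continuous_map_real_mult continuous_map_prod continuous_map_real_pow
      continuous_map_product_projection finite_exponents) auto

lemma powertop_real_neighbourhood:
  fixes m :: nat
  assumes "openin (powertop_real {..<m}) U" "x \<in> U"
  obtains \<epsilon> where "0 < \<epsilon>"
    "\<And>y. y \<in> extensional {..<m} \<Longrightarrow> (\<And>k. k < m \<Longrightarrow> \<bar>y k - x k\<bar> < \<epsilon>) \<Longrightarrow> y \<in> U"
proof -
  obtain W where W: "\<And>k. k < m \<Longrightarrow> open (W k)" "x \<in> PiE {..<m} W" "PiE {..<m} W \<subseteq> U"
  proof -
    have "\<exists>W. (\<forall>k\<in>{..<m}. open (W k)) \<and> x \<in> PiE {..<m} W \<and> PiE {..<m} W \<subseteq> U"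
    proof -
      from bspec[OF assms(1)[unfolded openin_product_topology_alt] assms(2)]
      obtain W where "\<forall>k\<in>{..<m}. openin euclideanreal (W k)" "x \<in> PiE {..<m} W" "PiE {..<m} W \<subseteq> U"
        by (elim exE conjE)
      then show ?thesis by (intro exI[of _ W]) simp
    qed
    then show thesis using that by auto
  qed
  have "\<forall>k\<in>{..<m}. \<exists>r>0. ball (x k) r \<subseteq> W k"
    using W(1,2) by (auto simp: open_contains_ball PiE_def Pi_def)
  from bchoice[OF this] obtain r where r: "\<forall>k\<in>{..<m}. 0 < r k \<and> ball (x k) (r k) \<subseteq> W k" ..
  define \<epsilon> where "\<epsilon> = Min (insert 1 (r ` {..<m}))"
  show thesis
  proof (rule that[of \<epsilon>])
    show "0 < \<epsilon>" unfolding \<epsilon>_def using r by (subst Min_gr_iff) auto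
    fix y assume y: "y \<in> extensional {..<m}" "\<And>k. k < m \<Longrightarrow> \<bar>y k - x k\<bar> < \<epsilon>"
    have "y k \<in> W k" if "k < m" for k
    proof -
      have "\<epsilon> \<le> r k" unfolding \<epsilon>_def by (rule Min_le) (use that in auto)
      then have "y k \<in> ball (x k) (r k)" using y(2)[OF that] by (simp add: dist_real_def abs_minus_commute)
      moreover have "ball (x k) (r k) \<subseteq> W k" using r that by blast
      ultimately show ?thesis by (rule subsetD[rotated])
    qed
    then have "y \<in> PiE {..<m} W" using y(1) by (auto simp: PiE_def)
    then show "y \<in> U" using W(3) by blast
  qed
qed

theorem dso_edges_vanish:
  assumes "1 \<le> g"
  obtains q a where "\<exists>\<alpha>\<in>exponents (2*g+2) q. a \<alpha> \<noteq> 0"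
    "\<And>E H l. E \<in> gap_compacts g \<Longrightarrow> is_dso H \<Longrightarrow> H \<in> isospectral_torus E
       \<Longrightarrow> polyval (2*g+2) q a (\<lambda>k. l * endpoints g E k) = 0"
proof -
  obtain q a where a: "\<exists>\<alpha>\<in>exponents (2*g+2) q. a \<alpha> \<noteq> 0"
    and v: "\<forall>x\<in>finite_gap_data g. polyval (2*g+2) q a (\<lambda>k. scale x * edge x k) = 0"
    using edges_dependent[OF assms] unfolding exponents_def polyval_def by blast
  show thesis
  proof (rule that[OF a])
    fix E H l assume E: "E \<in> gap_compacts g" and H: "is_dso H" "H \<in> isospectral_torus E"
    interpret finite_gap_set g "endpoints g E" by (rule gap_compacts_endpoints[OF E])
    have "bands = E" by (rule gap_compacts_endpoints[OF E])
    then obtain V c where "\<And>l. Spectral_data l V c (endpoints g E) \<in> finite_gap_data g"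
      using dso_finite_gap_data[of H] H by auto
    then show "polyval (2*g+2) q a (\<lambda>k. l * endpoints g E k) = 0" using v[rule_format, of "Spectral_data l V c (endpoints g E)"] by simp
  qed
qed

section \<open>Smallness of the set of Schroedinger compacts\<close>

text \<open>If the capacity were 0, the factor \<open>1 / capacity E\<close> would be 0 by
  convention and the normalized set would collapse to a point, which has no bands.\<close>

lemma normalize_cap_positive:
  assumes E: "E \<in> gap_compacts g" and N: "normalize_cap 1 E \<in> gap_compacts g"
  shows "0 < 1 / capacity E"
proof -
  have "0 \<le> capacity E" by (rule capacity_nonneg[OF compact_gap[OF E] gap_nonempty[OF E]])
  moreover have "capacity E \<noteq> 0"
  proof
    assume "capacity E = 0"
    then have "normalize_cap 1 E \<subseteq> {0}" by (auto simp: normalize_cap_def)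
    interpret f: finite_gap_set g "endpoints g (normalize_cap 1 E)" by (rule gap_compacts_endpoints[OF N])
    have "f.bands \<subseteq> {0}" using \<open>normalize_cap 1 E \<subseteq> {0}\<close> gap_compacts_endpoints(2)[OF N] by simp
    then have "x = 0" if "x \<in> f.bands" for x using that by blast
    from this[OF f.edge_in_bands[of 0]] this[OF f.edge_in_bands[of 1]] f.e_step[of 0] show False by simp
  qed
  ultimately show ?thesis by simp
qed

text \<open>\<open>capacity_bands_le\<close> is applied in both directions. The perturbed edges keep
  at least half the separation, which is why the reverse estimate has
  \<open>2 * \<kappa> s\<close>.\<close>

lemma capacity_perturbation_tendsto:
  assumes e: "finite_gap_set g e"
  shows "\<forall>\<^sub>F s in at_right 0. finite_gap_set g (\<lambda>k. e k + s * v k)"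
    and "((\<lambda>s. capacity (finite_gap_set.bands g (\<lambda>k. e k + s * v k))) \<longlongrightarrow> capacity (finite_gap_set.bands g e)) (at_right 0)"
proof -
  interpret e: finite_gap_set g e by fact
  define \<delta> where "\<delta> = Min ((\<lambda>k. e (Suc k) - e k) ` {..<2*g+1})"
  have "\<delta> \<in> (\<lambda>k. e (Suc k) - e k) ` {..<2*g+1}" unfolding \<delta>_def by (intro Min_in) auto
  then have \<delta>: "0 < \<delta>" using e.e_step by auto
  have gap: "e k + \<delta> \<le> e (Suc k)" if "k < 2*g+1" for k
  proof -
    have "\<delta> \<le> e (Suc k) - e k" unfolding \<delta>_def by (rule Min_le) (use that in auto)
    then show ?thesis by simp
  qed
  define b where "b = Max (insert 1 ((\<lambda>k. \<bar>v k\<bar>) ` {..<2*g+2}))"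
  have b1: "1 \<le> b" unfolding b_def by (rule Max_ge) auto
  have b: "\<bar>v k\<bar> \<le> b" if "k < 2*g+2" for k unfolding b_def by (rule Max_ge) (use that in auto)
  \<comment> \<open>Below \<open>s0\<close> each edge moves by at most \<open>\<delta> / 4\<close>,
    so neighbours stay \<open>\<delta> / 2\<close> apart, and
    \<open>\<kappa> s < 1 / 4\<close>.\<close>
  define s0 where "s0 = \<delta> / (4 * (2 * real g + 2) * b)"
  have s0: "0 < s0" using \<delta> b1 by (simp add: s0_def)
  define \<kappa> where "\<kappa> s = (2 * real g + 2) * (s * b) / \<delta>" for s
  have small: "\<forall>\<^sub>F s in at_right 0. 0 < s \<and> s < s0"
    using s0 by (auto simp: eventually_at_right_field)
  have basic: "finite_gap_set g (\<lambda>k. e k + s * v k)" "\<And>k. k < 2*g+2 \<Longrightarrow> \<bar>(e k + s * v k) - e k\<bar> \<le> s * b"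
      "\<And>k. k < 2*g+1 \<Longrightarrow> (e k + s * v k) + \<delta> / 2 \<le> e (Suc k) + s * v (Suc k)" "\<kappa> s < 1 / 4"
    if s: "0 < s" "s < s0" for s
  proof -
    have sv: "\<bar>s * v k\<bar> \<le> s * b" if "k < 2*g+2" for k
      using b[OF that] s by (simp add: abs_mult)
    then show "\<bar>(e k + s * v k) - e k\<bar> \<le> s * b" if "k < 2*g+2" for k using that by simp
    have "s * (4 * (2 * real g + 2) * b) < \<delta>" using s b1 unfolding s0_def by (subst (asm) less_divide_eq) auto
    then have kb: "4 * ((2 * real g + 2) * (s * b)) < \<delta>" by (simp only: ac_simps)
    then show "\<kappa> s < 1 / 4" using \<delta> by (simp add: \<kappa>_def pos_divide_less_eq)
    have "1 * (s * b) \<le> (2 * real g + 2) * (s * b)" using s b1 by (intro mult_right_mono) auto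
    then have sb: "s * b \<le> \<delta> / 4" using kb by linarith
    show g2: "(e k + s * v k) + \<delta> / 2 \<le> e (Suc k) + s * v (Suc k)" if "k < 2*g+1" for k
      using sv[of k] sv[of "Suc k"] gap[OF that] sb that by linarith
    show "finite_gap_set g (\<lambda>k. e k + s * v k)"
    proof
      show "e k + s * v k < e (Suc k) + s * v (Suc k)" if "k < 2*g+1" for k
        using g2[OF that] \<delta> by linarith
    qed
  qed
  show "\<forall>\<^sub>F s in at_right 0. finite_gap_set g (\<lambda>k. e k + s * v k)"
    using small by eventually_elim (use basic(1) in auto)
  define Cs where "Cs s = capacity (finite_gap_set.bands g (\<lambda>k. e k + s * v k))" for s
  let ?C0 = "capacity e.bands"
  have \<kappa>0: "(\<kappa> \<longlongrightarrow> 0) (at_right 0)"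
    unfolding \<kappa>_def by (rule tendsto_eq_intros refl | use \<delta> in simp)+
  show "((\<lambda>s. capacity (finite_gap_set.bands g (\<lambda>k. e k + s * v k))) \<longlongrightarrow> ?C0) (at_right 0)"
    unfolding Cs_def[symmetric]
  proof (rule tendsto_sandwich)
    show "((\<lambda>s. (1 - \<kappa> s) * ?C0) \<longlongrightarrow> ?C0) (at_right 0)"
      by (rule tendsto_eq_intros \<kappa>0 refl | simp)+
    show "((\<lambda>s. ?C0 / (1 - 2 * \<kappa> s)) \<longlongrightarrow> ?C0) (at_right 0)"
      by (rule tendsto_eq_intros \<kappa>0 refl | simp)+
    show "\<forall>\<^sub>F s in at_right 0. (1 - \<kappa> s) * ?C0 \<le> Cs s"
      using small
    proof eventually_elim
      case (elim s)
      then have s: "0 < s" "s < s0" by auto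
      show ?case unfolding Cs_def
        by (rule capacity_bands_le[OF e basic(1)[OF s] \<delta> gap basic(2)[OF s]])
           (use basic(4)[OF s] in \<open>auto simp: \<kappa>_def\<close>)
    qed
    show "\<forall>\<^sub>F s in at_right 0. Cs s \<le> ?C0 / (1 - 2 * \<kappa> s)"
      using small
    proof eventually_elim
      case (elim s)
      then have s: "0 < s" "s < s0" by auto
      have "(1 - 2 * \<kappa> s) * Cs s \<le> ?C0"
        unfolding Cs_def
      proof (rule capacity_bands_le[OF basic(1)[OF s] e _ basic(3)[OF s]])
        show "\<bar>e k - (e k + s * v k)\<bar> \<le> s * b" if "k < 2*g+2" for k using basic(2)[OF s that] by simp
      qed (use \<delta> basic(4)[OF s] in \<open>auto simp: \<kappa>_def\<close>)
      then show ?case using basic(4)[OF s] by (simp add: pos_le_divide_eq mult.commute)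
    qed
  qed
qed

definition dso_compacts :: "real set set" where
  "dso_compacts = {E \<in> finite_gap_compacts 1. \<exists>H. is_dso H \<and> H \<in> isospectral_torus E}"

text \<open>The zero set is taken for all dilations at once, so that normalizing the capacity does not leave it.\<close>

definition vanishing :: "nat \<Rightarrow> nat \<Rightarrow> ((nat \<Rightarrow> nat) \<Rightarrow> real) \<Rightarrow> real set set" where
  "vanishing g q a = {E \<in> gap_compacts_cap g 1. \<forall>l. polyval (2*g+2) q a (\<lambda>k. l * endpoints g E k) = 0}"

lemma index_set: "{..<2 * (g + 1)} = {..<2*g+2::nat}"
  by simp

lemma finite_gap_compacts_Int: "finite_gap_compacts \<alpha> \<inter> gap_compacts_cap n \<alpha> = (if 1 \<le> n then gap_compacts_cap n \<alpha> else {})"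
proof -
  have "m = n" if "E \<in> gap_compacts_cap m \<alpha>" "E \<in> gap_compacts_cap n \<alpha>" for E m
    by (rule gap_compacts_disjoint[of E]) (use that in \<open>auto simp: gap_compacts_cap_def\<close>)
  then show ?thesis unfolding finite_gap_compacts_def by auto
qed

text \<open>An intersection, over all dilations, of polynomial zero sets in the component
  \<open>g\<close>; other components are missed because the number of gaps is determined by the
  set.\<close>

lemma closedin_vanishing:
  assumes "1 \<le> g"
  shows "closedin (finite_gap_topology 1) (vanishing g q a)"
  unfolding closedin_def topspace_finite_gap_topology openin_finite_gap_topology
proof (intro conjI allI impI)
  show "vanishing g q a \<subseteq> finite_gap_compacts 1"
    using assms by (auto simp: vanishing_def finite_gap_compacts_def)
  show "finite_gap_compacts 1 - vanishing g q a \<subseteq> finite_gap_compacts 1" by auto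
  fix n :: nat assume n: "1 \<le> n"
  show "openin (gap_topology_cap n 1) ((finite_gap_compacts 1 - vanishing g q a) \<inter> gap_compacts_cap n 1)"
  proof (cases "n = g")
    case False
    have "vanishing g q a \<inter> gap_compacts_cap n 1 = {}"
    proof -
      have "g = n" if "E \<in> vanishing g q a" "E \<in> gap_compacts_cap n 1" for E
        by (rule gap_compacts_disjoint[of E]) (use that in \<open>auto simp: vanishing_def gap_compacts_cap_def\<close>)
      then show ?thesis using False by blast
    qed
    then have "(finite_gap_compacts 1 - vanishing g q a) \<inter> gap_compacts_cap n 1 = topspace (gap_topology_cap n 1)"
      using n finite_gap_compacts_Int[of 1 n] unfolding topspace_gap_topology_cap by auto
    then show ?thesis by simp
  next
    case True
    define U where "U = (\<Union>l. {x \<in> topspace (powertop_real {..<2*g+2}). polyval (2*g+2) q a (\<lambda>k. l * x k) \<in> - {0}})"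
    have op: "openin (powertop_real {..<2*g+2})
        {x \<in> topspace (powertop_real {..<2*g+2}). polyval (2*g+2) q a (\<lambda>k. l * x k) \<in> - {0}}" for l
      by (rule openin_continuous_map_preimage[OF polyval_continuous_map]) (simp add: open_Compl)
    have U: "openin (powertop_real {..<2*g+2}) U"
      unfolding U_def
    proof (rule openin_Union)
      fix S assume "S \<in> range (\<lambda>l. {x \<in> topspace (powertop_real {..<2*g+2}). polyval (2*g+2) q a (\<lambda>k. l * x k) \<in> - {0}})"
      then show "openin (powertop_real {..<2*g+2}) S" using op by (elim rangeE) (simp only:)
    qed
    have "openin (gap_topology g) (endpoints g -` U \<inter> gap_compacts g)"
      unfolding gap_topology_def openin_pullback_topology index_set using U by blast
    then have "openin (gap_topology_cap g 1) (gap_compacts_cap g 1 \<inter> (endpoints g -` U \<inter> gap_compacts g))"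
      unfolding gap_topology_cap_def openin_subtopology by blast
    also have "gap_compacts_cap g 1 \<inter> (endpoints g -` U \<inter> gap_compacts g)
        = (finite_gap_compacts 1 - vanishing g q a) \<inter> gap_compacts_cap g 1"
      using finite_gap_compacts_Int[of 1 g] assms
      by (auto simp: vanishing_def U_def gap_compacts_cap_def endpoints_def)
    finally show ?thesis using True by simp
  qed
qed

text \<open>The edges are moved a little towards a point \<open>p\<close> off the zero set and the
  result is renormalized. Continuity of the capacity keeps it in the given neighbourhood, and
  invariance under dilations carries the nonvanishing over.\<close>

lemma interior_vanishing:
  assumes g: "1 \<le> g" and a: "\<exists>\<alpha>\<in>exponents (2*g+2) q. a \<alpha> \<noteq> 0"
  shows "finite_gap_topology 1 interior_of vanishing g q a = {}"
proof (rule ccontr)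
  let ?m = "2*g+2" and ?\<Phi> = "polyval (2*g+2) q a"
  assume "finite_gap_topology 1 interior_of vanishing g q a \<noteq> {}"
  then obtain E T where T: "openin (finite_gap_topology 1) T" "T \<subseteq> vanishing g q a" "E \<in> T"
    by (auto simp: interior_of_def)
  then have E: "E \<in> gap_compacts g" "capacity E = 1" by (auto simp: vanishing_def gap_compacts_cap_def)
  have "openin (gap_topology_cap g 1) (T \<inter> gap_compacts_cap g 1)"
    using T(1) g by (simp add: openin_finite_gap_topology)
  then obtain W where W: "openin (gap_topology g) W" "T \<inter> gap_compacts_cap g 1 = W \<inter> gap_compacts_cap g 1"
    unfolding gap_topology_cap_def openin_subtopology by blast
  then obtain U where U: "openin (powertop_real {..<?m}) U" "W = endpoints g -` U \<inter> gap_compacts g"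
    unfolding gap_topology_def openin_pullback_topology index_set by blast
  have "E \<in> W" using W(2) T E by (auto simp: gap_compacts_cap_def)
  then have "endpoints g E \<in> U" using U(2) by simp
  then obtain \<epsilon> where \<epsilon>: "0 < \<epsilon>"
    "\<And>y. y \<in> extensional {..<?m} \<Longrightarrow> (\<And>k. k < ?m \<Longrightarrow> \<bar>y k - endpoints g E k\<bar> < \<epsilon>) \<Longrightarrow> y \<in> U"
    by (rule powertop_real_neighbourhood[OF U(1)]) blast
  define e where "e = endpoints g E"
  have e: "finite_gap_set g e" "finite_gap_set.bands g e = E"
    unfolding e_def by (rule gap_compacts_endpoints[OF E(1)])+
  obtain p where p: "?\<Phi> p \<noteq> 0" using polyval_nonzero_exists[OF a] by blast
  define v where "v k = p k - e k" for k
  define C where "C s = capacity (finite_gap_set.bands g (\<lambda>k. e k + s * v k))" for s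
  have C: "(C \<longlongrightarrow> 1) (at_right 0)"
    using capacity_perturbation_tendsto(2)[OF e(1), of v] unfolding C_def e(2) E(2) .
  have 1: "\<forall>\<^sub>F s in at_right 0. finite_gap_set g (\<lambda>k. e k + s * v k)"
    by (rule capacity_perturbation_tendsto(1)[OF e(1)])
  have 2: "\<forall>\<^sub>F s in at_right 0. 0 < C s" using C by (rule order_tendstoD) simp
  have "\<forall>\<^sub>F s in at_right 0. \<bar>1 / C s * (e k + s * v k) - e k\<bar> < \<epsilon>" for k
  proof -
    have "((\<lambda>s. 1 / C s * (e k + s * v k) - e k) \<longlongrightarrow> 1 / 1 * (e k + 0 * v k) - e k) (at_right 0)"
      by (intro tendsto_intros C) simp
    then have "((\<lambda>s. \<bar>1 / C s * (e k + s * v k) - e k\<bar>) \<longlongrightarrow> 0) (at_right 0)"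
      by (intro tendsto_rabs_zero) simp
    then show ?thesis using \<epsilon>(1) by (rule order_tendstoD)
  qed
  then have 3: "\<forall>\<^sub>F s in at_right 0. \<forall>k\<in>{..<?m}. \<bar>1 / C s * (e k + s * v k) - e k\<bar> < \<epsilon>"
    by (intro eventually_ball_finite) auto
  have 4: "\<forall>\<^sub>F s in at_right 0. ?\<Phi> (\<lambda>k. e k + s * v k) \<noteq> 0"
  proof -
    let ?Z = "{s. ?\<Phi> (\<lambda>k. e k + s * v k) = 0}"
    have "finite ?Z" unfolding v_def by (rule polyval_line_finite[OF p])
    \<comment> \<open>The parameter 0 must be excepted, since \<open>E\<close> itself lies in the
      zero set.\<close>
    then have "open (- (?Z - {0}))" by (intro open_Compl finite_imp_closed) auto
    then have "\<forall>\<^sub>F s in nhds 0. s \<in> - (?Z - {0})" by (rule eventually_nhds_in_open) simp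
    then have "\<forall>\<^sub>F s in at_right 0. s \<in> - (?Z - {0})"
      unfolding eventually_at_filter by (rule eventually_mono) blast
    then show ?thesis using eventually_at_right_less
      by eventually_elim auto
  qed
  from 1 2 3 4 have "\<forall>\<^sub>F s in at_right 0. finite_gap_set g (\<lambda>k. e k + s * v k) \<and> 0 < C s
      \<and> (\<forall>k\<in>{..<?m}. \<bar>1 / C s * (e k + s * v k) - e k\<bar> < \<epsilon>) \<and> ?\<Phi> (\<lambda>k. e k + s * v k) \<noteq> 0"
    by eventually_elim blast
  from eventually_happens'[OF trivial_limit_at_right_real this]
  obtain s where "finite_gap_set g (\<lambda>k. e k + s * v k) \<and> 0 < C s
      \<and> (\<forall>k\<in>{..<?m}. \<bar>1 / C s * (e k + s * v k) - e k\<bar> < \<epsilon>) \<and> ?\<Phi> (\<lambda>k. e k + s * v k) \<noteq> 0" ..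
  then have s: "finite_gap_set g (\<lambda>k. e k + s * v k)" "0 < C s"
      "\<And>k. k < ?m \<Longrightarrow> \<bar>1 / C s * (e k + s * v k) - e k\<bar> < \<epsilon>" "?\<Phi> (\<lambda>k. e k + s * v k) \<noteq> 0"
    by simp_all
  interpret s: finite_gap_set g "\<lambda>k. e k + s * v k" by (rule s(1))
  define F where "F = (\<lambda>x. 1 / C s * x) ` s.bands"
  have sb: "s.bands \<in> gap_compacts g" by (rule s.bands_in_gap_compacts)
  have F: "F \<in> gap_compacts g" unfolding F_def by (rule gap_compacts_scale[OF sb]) (use s(2) in simp)
  have Fe: "endpoints g F k = 1 / C s * (e k + s * v k)" if "k < ?m" for k
    unfolding F_def using gap_compacts_scale(2)[OF sb _ that, of "1 / C s"] s(2) that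
    by (simp add: s.endpoints_bands)
  have "capacity F = 1 / C s * C s"
    unfolding F_def C_def[of s] using s(2) compact_gap[OF sb] gap_nonempty[OF sb]
    by (intro capacity_scale) (auto simp: C_def)
  then have FK: "F \<in> gap_compacts_cap g 1" using F s(2) by (simp add: gap_compacts_cap_def)
  have "endpoints g F \<in> U"
  proof (rule \<epsilon>(2))
    show "endpoints g F \<in> extensional {..<?m}" unfolding endpoints_def index_set by simp
    show "\<bar>endpoints g F k - endpoints g E k\<bar> < \<epsilon>" if "k < ?m" for k
      using s(3)[OF that] Fe[OF that] by (simp add: e_def)
  qed
  then have "F \<in> T" using W(2) U(2) F FK by blast
  \<comment> \<open>The dilation by \<open>C s\<close> undoes the normalization and recovers the
    perturbed edges.\<close>
  then have "?\<Phi> (\<lambda>k. C s * endpoints g F k) = 0" using T(2) by (auto simp: vanishing_def)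
  moreover have "?\<Phi> (\<lambda>k. C s * endpoints g F k) = ?\<Phi> (\<lambda>k. e k + s * v k)"
    by (rule polyval_cong) (use Fe s(2) in simp)
  ultimately show False using s(4) by simp
qed

lemma dso_compacts_nowhere_dense:
  assumes "1 \<le> g"
  shows "nowhere_dense_in (finite_gap_topology 1) (dso_compacts \<inter> gap_compacts_cap g 1)"
proof -
  obtain q a where a: "\<exists>\<alpha>\<in>exponents (2*g+2) q. a \<alpha> \<noteq> 0"
    and v: "\<And>E H l. E \<in> gap_compacts g \<Longrightarrow> is_dso H \<Longrightarrow> H \<in> isospectral_torus E
       \<Longrightarrow> polyval (2*g+2) q a (\<lambda>k. l * endpoints g E k) = 0"
    using dso_edges_vanish[OF assms] by metis
  have sub: "dso_compacts \<inter> gap_compacts_cap g 1 \<subseteq> vanishing g q a"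
    using v by (auto simp: dso_compacts_def vanishing_def gap_compacts_cap_def)
  have "finite_gap_topology 1 closure_of (dso_compacts \<inter> gap_compacts_cap g 1) \<subseteq> vanishing g q a"
    by (rule closure_of_minimal[OF sub closedin_vanishing[OF assms]])
  then have "finite_gap_topology 1 interior_of (finite_gap_topology 1 closure_of (dso_compacts \<inter> gap_compacts_cap g 1)) = {}"
    using interior_of_mono interior_vanishing[OF assms a] by blast
  then show ?thesis unfolding nowhere_dense_in_def topspace_finite_gap_topology
    by (auto simp: dso_compacts_def)
qed

text \<open>Vanishing on all dilates passes from a normalized set to every set normalized to it, so
  the whole preimage lies in one polynomial zero set.\<close>

lemma dso_compacts_null:
  assumes "1 \<le> g"
  shows "gap_cap_null g 1 (dso_compacts \<inter> gap_compacts_cap g 1)"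
proof -
  let ?m = "2*g+2" and ?D = "dso_compacts \<inter> gap_compacts_cap g 1"
  let ?M = "PiM {..<2*g+2} (\<lambda>_. lborel :: real measure)"
  obtain q a where a: "\<exists>\<alpha>\<in>exponents ?m q. a \<alpha> \<noteq> 0"
    and v: "\<And>E H l. E \<in> gap_compacts g \<Longrightarrow> is_dso H \<Longrightarrow> H \<in> isospectral_torus E
       \<Longrightarrow> polyval ?m q a (\<lambda>k. l * endpoints g E k) = 0"
    using dso_edges_vanish[OF assms] by metis
  define N where "N = {x \<in> space ?M. polyval ?m q a x = 0}"
  have "N \<in> null_sets ?M"
  proof -
    have "N \<in> sets ?M" unfolding N_def using polyval_measurable[of ?m q a] by measurable
    moreover have "AE x in ?M. x \<notin> N"
      using polyval_AE_nonzero[OF a] by eventually_elim (simp add: N_def)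
    ultimately show ?thesis using AE_iff_null_sets by blast
  qed
  then have N: "N \<in> null_sets (completion ?M)" by (rule null_sets_completionI)
  have "endpoints g ` {E \<in> gap_compacts g. normalize_cap 1 E \<in> ?D} \<subseteq> N"
  proof safe
    fix E assume E: "E \<in> gap_compacts g" and "normalize_cap 1 E \<in> dso_compacts" "normalize_cap 1 E \<in> gap_compacts_cap g 1"
    then obtain H where H: "is_dso H" "H \<in> isospectral_torus (normalize_cap 1 E)" and G: "normalize_cap 1 E \<in> gap_compacts g"
      by (auto simp: dso_compacts_def gap_compacts_cap_def)
    define t where "t = 1 / capacity E"
    have t: "0 < t" unfolding t_def by (rule normalize_cap_positive[OF E G])
    have n: "normalize_cap 1 E = (\<lambda>x. t * x) ` E" by (simp add: normalize_cap_def t_def)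
    have "0 = polyval ?m q a (\<lambda>k. 1 / t * endpoints g (normalize_cap 1 E) k)"
      by (rule v[OF G H, symmetric])
    also have "\<dots> = polyval ?m q a (endpoints g E)"
      unfolding n by (rule polyval_cong) (use gap_compacts_scale(2)[OF E t] t in simp)
    finally show "endpoints g E \<in> N"
      unfolding N_def by (auto simp: space_PiM endpoints_def index_set PiE_def)
  qed
  \<comment> \<open>The set of edges is only known to lie inside a Borel null set; completeness of
    the measure closes this gap.\<close>
  then have "endpoints g ` {E \<in> gap_compacts g. normalize_cap 1 E \<in> ?D} \<in> null_sets (completion ?M)"
    using N by (rule null_sets_completion_subset)
  note null = this
  show ?thesis unfolding gap_cap_null_def gap_null_def index_set
  proof (intro conjI)
    show "?D \<subseteq> gap_compacts_cap g 1" by (rule Int_lower2)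
    show "{E \<in> gap_compacts g. normalize_cap 1 E \<in> ?D} \<subseteq> gap_compacts g" by (rule Collect_restrict)
  qed (rule null)
qed

theorem theorem1p1:
  shows "meager_in (finite_gap_topology 1)
           {E \<in> finite_gap_compacts 1. \<exists>H. is_dso H \<and> H \<in> isospectral_torus E}
       \<and> finite_gap_null 1
           {E \<in> finite_gap_compacts 1. \<exists>H. is_dso H \<and> H \<in> isospectral_torus E}"
  unfolding dso_compacts_def[symmetric]
proof
  let ?N = "(\<lambda>g. dso_compacts \<inter> gap_compacts_cap g 1) ` {1..}"
  show "meager_in (finite_gap_topology 1) dso_compacts"
    unfolding meager_in_def
  proof (intro exI[of _ ?N] conjI ballI)
    show "countable ?N" by (intro countable_image countableI_type)
    show "nowhere_dense_in (finite_gap_topology 1) S" if "S \<in> ?N" for S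
      using that dso_compacts_nowhere_dense by auto
    show "dso_compacts = \<Union> ?N"
      by (auto simp: dso_compacts_def finite_gap_compacts_def)
  qed
  show "finite_gap_null 1 dso_compacts"
    unfolding finite_gap_null_def using dso_compacts_null by (auto simp: dso_compacts_def)
qed


end
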